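(* Suppose that $m_-(x)/m_+(x)\to1$ as $x\to\infty$. Then: (i) $\displaystyle\lim_{t\downarrow0}\frac{\gamma(t)}{t\,m(1/t)}=0$; (ii) each of the three inequalities $$\limsup_{x\to\infty}\frac{x\eta_+(x)}{m_+(x)}<1,\qquad \limsup_{x\to\infty}\frac{x\eta_-(x)}{m_-(x)}<1,\qquad \limsup_{x\to\infty}\frac{x\eta(x)}{m(x)}<1$$ is (individually) necessary and sufficient in order that $\displaystyle\limsup_{x\to\infty}\frac{\bar a(x)m(x)}{x}<\infty$.
   Context: Let $X,X_1,X_2,\dots$ be i.i.d. integer-valued random variables and $S_n=X_1+\dots+X_n$, $S_0=0$. Standing assumptions: the random walk $S$ is irreducible as a Markov chain on $\mathbb Z$, $EX=0$, and $EX^2=\infty$. The potential function is $a(x)=\sum_{n=0}^\infty\big(P[S_n=0]-P[S_n=-x]\big)$, $x\in\mathbb Z$ (the series converges), and $\bar a(x)=\frac12[a(x)+a(-x)]$. For real $x\ge0$, $t\ge0$: $\mu_-(x)=P[X<-x]$, $\mu_+(x)=P[X>x]$; $\eta_\pm(x)=\int_x^\infty\mu_\pm(y)\,dy$, $\eta=\eta_++\eta_-$; $m_\pm(x)=\int_0^x\eta_\pm(s)\,ds$, $m=m_++m_-$; $\beta_\pm(t)=\int_0^\infty\mu_\pm(y)(1-\cos ty)\,dy$; $\gamma(t)=\beta_+(t)-\beta_-(t)$. *)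

theory Defs
  imports "HOL-Probability.Probability"
begin

definition iid_integer :: "'a measure \<Rightarrow> (nat \<Rightarrow> 'a \<Rightarrow> int) \<Rightarrow> bool" where
  "iid_integer M X \<longleftrightarrow> prob_space M \<and>
     prob_space.indep_vars M (\<lambda>_. count_space UNIV) X UNIV \<and>
     (\<forall>n. distr M (count_space UNIV) (X n) = distr M (count_space UNIV) (X 0))"

(* X 0 plays the role of the generic variable X; the steps of the walk are X 1, X 2, ... *)
definition walk :: "(nat \<Rightarrow> 'a \<Rightarrow> int) \<Rightarrow> nat \<Rightarrow> 'a \<Rightarrow> int" where
  "walk X n w = (\<Sum>i=1..n. X i w)"

definition irreducible_walk :: "'a measure \<Rightarrow> (nat \<Rightarrow> 'a \<Rightarrow> int) \<Rightarrow> bool" where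
  "irreducible_walk M X \<longleftrightarrow> (\<forall>x y. \<exists>n. \<P>(w in M. x + walk X n w = y) > 0)"

definition potential :: "'a measure \<Rightarrow> (nat \<Rightarrow> 'a \<Rightarrow> int) \<Rightarrow> int \<Rightarrow> real" where
  "potential M X x = (\<Sum>n. \<P>(w in M. walk X n w = 0) - \<P>(w in M. walk X n w = - x))"

definition sym_potential :: "'a measure \<Rightarrow> (nat \<Rightarrow> 'a \<Rightarrow> int) \<Rightarrow> int \<Rightarrow> real" where
  "sym_potential M X x = (potential M X x + potential M X (- x)) / 2"

(* The functions below depend only on the law of a single variable Y. They are meant for
   arguments x, t \<ge> 0. *)

definition mu_minus :: "'a measure \<Rightarrow> ('a \<Rightarrow> int) \<Rightarrow> real \<Rightarrow> real" where
  "mu_minus M Y x = \<P>(w in M. real_of_int (Y w) < - x)"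

definition mu_plus :: "'a measure \<Rightarrow> ('a \<Rightarrow> int) \<Rightarrow> real \<Rightarrow> real" where
  "mu_plus M Y x = \<P>(w in M. real_of_int (Y w) > x)"

definition eta_minus :: "'a measure \<Rightarrow> ('a \<Rightarrow> int) \<Rightarrow> real \<Rightarrow> real" where
  "eta_minus M Y x = (LBINT y:{x..}. mu_minus M Y y)"

definition eta_plus :: "'a measure \<Rightarrow> ('a \<Rightarrow> int) \<Rightarrow> real \<Rightarrow> real" where
  "eta_plus M Y x = (LBINT y:{x..}. mu_plus M Y y)"

definition eta :: "'a measure \<Rightarrow> ('a \<Rightarrow> int) \<Rightarrow> real \<Rightarrow> real" where
  "eta M Y x = eta_plus M Y x + eta_minus M Y x"

definition m_minus :: "'a measure \<Rightarrow> ('a \<Rightarrow> int) \<Rightarrow> real \<Rightarrow> real" where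
  "m_minus M Y x = (LBINT s:{0..x}. eta_minus M Y s)"

definition m_plus :: "'a measure \<Rightarrow> ('a \<Rightarrow> int) \<Rightarrow> real \<Rightarrow> real" where
  "m_plus M Y x = (LBINT s:{0..x}. eta_plus M Y s)"

definition m_total :: "'a measure \<Rightarrow> ('a \<Rightarrow> int) \<Rightarrow> real \<Rightarrow> real" where
  "m_total M Y x = m_plus M Y x + m_minus M Y x"

definition beta_minus :: "'a measure \<Rightarrow> ('a \<Rightarrow> int) \<Rightarrow> real \<Rightarrow> real" where
  "beta_minus M Y t = (LBINT y:{0..}. mu_minus M Y y * (1 - cos (t * y)))"

definition beta_plus :: "'a measure \<Rightarrow> ('a \<Rightarrow> int) \<Rightarrow> real \<Rightarrow> real" where
  "beta_plus M Y t = (LBINT y:{0..}. mu_plus M Y y * (1 - cos (t * y)))"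

definition gamma_diff :: "'a measure \<Rightarrow> ('a \<Rightarrow> int) \<Rightarrow> real \<Rightarrow> real" where
  "gamma_diff M Y t = beta_plus M Y t - beta_minus M Y t"

end

theory Submission
  imports Defs
begin

text \<open>
  Write \<open>\<psi>\<close> for the characteristic function of a step, \<open>R(t) = E(1 - cos tX)\<close> and \<open>J(t) = E sin tX\<close>,
  so that \<open>1 - \<psi> = R - iJ\<close>; as the mean is zero, \<open>J(t) = - t \<gamma>(t)\<close>. The symmetrized potential is
  the integral of \<open>K(t) (1 - cos tx) / \<pi>\<close> over \<open>[0, \<pi>]\<close> with \<open>K = Re (1 / (1 - \<psi>)) = R / (R^2 + J^2)\<close>,
  and the theorem follows by comparing \<open>R\<close> and \<open>J\<close> with \<open>t^2 m(1/t)\<close>. Throughout, \<open>f(x) = x / m(x)\<close> and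
  \<open>c(x) = m(x) - x \<eta>(x) = E min(x, |X|)^2 / 2\<close>, so that \<open>f' = c / m^2\<close>.

  Existence of the potential. The even part of the series is given by an absolutely convergent Fourier
  integral, because \<open>K \<le> 1 / R = o(t^{-2})\<close>; the odd part need not be, and is treated by compactness.
  The partial sums \<open>A(N, x)\<close> of \<open>P[S_n = 0] - P[S_n = x]\<close> are non-negative and have increments in \<open>x\<close>
  bounded uniformly in \<open>N\<close>: both are maximum principles for the truncated Green function, proved by
  induction on \<open>N\<close>. Hence they are dominated by the even part, which is \<open>o(|x|)\<close> uniformly in \<open>N\<close>, and
  the difference of two limit points is a harmonic function with bounded increments and sublinear
  growth. Since bounded harmonic functions are constant (\<open>bounded_harmonic_constant\<close>), it is linear, and
  so it vanishes (\<open>subsequential_limits_agree\<close>).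

  Part (i). Two integrations by parts turn \<open>\<beta>(t)\<close>, for either sign, into an expression in \<open>m\<close> on \<open>[0, x]\<close>
  with an error of order \<open>m(x) / (t x^2)\<close>, provided \<open>cos tx = 0\<close> (\<open>sin_defect_approx\<close>). For \<open>x = C / t\<close>
  the main terms for the two signs cancel up to \<open>o(t m(1/t))\<close>, because the two functions \<open>m\<close> are
  asymptotically equal, and the error is \<open>t m(1/t) O(1/C)\<close>.

  The three conditions agree. The function \<open>m\<close> is concave with slope \<open>\<eta>\<close>, and \<open>limsup x \<eta>(x) / m(x) < 1\<close>
  means that \<open>m(2x) \<le> 2 q m(x)\<close> eventually, for some \<open>q < 1\<close>. This property is insensitive to replacing
  \<open>m\<close> by a function asymptotic to a multiple of it.

  Sufficiency. If \<open>c \<ge> \<delta> m\<close> eventually, then \<open>R(t) \<ge> \<kappa> t^2 m(1/t)\<close> near \<open>0\<close>. Now \<open>f' \<ge> \<delta> / m\<close> bounds the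
  integral of \<open>1 / (t^2 m(1/t))\<close> over \<open>t \<ge> 1/x\<close> by \<open>f(x) / \<delta>\<close>, and smaller \<open>t\<close> contribute at most a multiple
  of \<open>f(x)\<close> too (\<open>green_kernel_upper\<close>).

  Necessity (\<open>slope_ratio_of_green_kernel_bound\<close>). Averaging the assumed bound \<open>B f(a)\<close> over \<open>A < a \<le> 2A\<close>
  bounds the integral of \<open>K\<close> over \<open>[2\<pi>/A, \<pi>]\<close> by a multiple of \<open>B f(A)\<close>. Where \<open>c(b) \<le> e m(b)\<close>, part (i)
  makes both \<open>R\<close> and \<open>J\<close> of order \<open>e t^2 m(1/t)\<close> for \<open>t\<close> near \<open>1/b\<close>, and the integral of \<open>K\<close> over
  \<open>[\<pi>/2b, 3\<pi>/2b]\<close> is at least a multiple of \<open>e^{-2} b c(b) / m(b)^2\<close>. For small \<open>e\<close> this excludes scales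
  with \<open>e/4 \<le> c/m \<le> e\<close>, where it would be of order \<open>f(b) / e\<close>. Therefore \<open>c/m \<le> e\<close> at one large scale \<open>x\<close>
  persists down the scales \<open>x / 4^j\<close>, and summing over them, where \<open>b c(b) / m(b)^2\<close> dominates the
  increments of \<open>f\<close>, produces a multiple of \<open>e^{-2} f(x)\<close>, which exceeds \<open>B f(x)\<close>.
\<close>

section \<open>Interchanging expectations and integrals\<close>

text \<open>A step is integer-valued, so joint measurability is automatic and Fubini's theorem only needs
  an integrable majorant in the step.\<close>

lemma expectation_lborel_swap:
  fixes p :: "int pmf" and f :: "int \<Rightarrow> real \<Rightarrow> 'b::{banach, second_countable_topology}"
  assumes int: "\<And>k. integrable lborel (f k)"
    and norm_int: "integrable p (\<lambda>k. LINT y|lborel. norm (f k y))"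
  shows "(LINT y|lborel. (\<integral>k. f k y \<partial>p)) = (\<integral>k. (LINT y|lborel. f k y) \<partial>p)"
    and "integrable lborel (\<lambda>y. \<integral>k. f k y \<partial>p)"
proof -
  interpret pair_sigma_finite "measure_pmf p" lborel
    by (intro pair_sigma_finite.intro measure_pmf.sigma_finite_measure_axioms
        lborel.sigma_finite_measure_axioms)
  have meas: "case_prod f \<in> borel_measurable (measure_pmf p \<Otimes>\<^sub>M lborel)"
  proof -
    have "case_prod f \<in> borel_measurable (count_space UNIV \<Otimes>\<^sub>M lborel)"
      by (rule measurable_pair_measure_countable1) (use int in auto)
    moreover have "sets (measure_pmf p \<Otimes>\<^sub>M (lborel :: real measure))
        = sets (count_space UNIV \<Otimes>\<^sub>M lborel)"
      by (intro sets_pair_measure_cong) auto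
    ultimately show ?thesis
      using measurable_cong_sets by blast
  qed
  have ib: "integrable (measure_pmf p \<Otimes>\<^sub>M lborel) (case_prod f)"
    by (rule Fubini_integrable[OF meas]) (use int norm_int in auto)
  show "(LINT y|lborel. (\<integral>k. f k y \<partial>p)) = (\<integral>k. (LINT y|lborel. f k y) \<partial>p)"
    by (rule Fubini_integral[OF ib])
  show "integrable lborel (\<lambda>y. \<integral>k. f k y \<partial>p)"
    by (rule integrable_snd[OF ib])
qed

lemma continuous_on_expectation:
  fixes p :: "int pmf" and f :: "int \<Rightarrow> real \<Rightarrow> 'b::{banach, second_countable_topology}"
  assumes cont: "\<And>k. continuous_on S (f k)"
    and bound: "\<And>k y. y \<in> S \<Longrightarrow> norm (f k y) \<le> B k" and B: "integrable p B"
  shows "continuous_on S (\<lambda>y. \<integral>k. f k y \<partial>p)"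
proof (rule continuous_on_sequentiallyI)
  fix u a assume u: "\<forall>n. u n \<in> S" "a \<in> S" "u \<longlonglongrightarrow> a"
  show "(\<lambda>n. \<integral>k. f k (u n) \<partial>p) \<longlonglongrightarrow> (\<integral>k. f k a \<partial>p)"
  proof (rule integral_dominated_convergence[where w = B])
    show "AE k in p. (\<lambda>n. f k (u n)) \<longlonglongrightarrow> f k a"
      using continuous_on_tendsto_compose[OF cont u(3,2)] u by auto
  qed (use bound B u in auto)
qed

lemma expectation_integral_swap:
  fixes p :: "int pmf" and f :: "int \<Rightarrow> real \<Rightarrow> 'b::euclidean_space"
  assumes ab: "a \<le> b" and cont: "\<And>k. continuous_on {a..b} (f k)"
    and bound: "\<And>k y. y \<in> {a..b} \<Longrightarrow> norm (f k y) \<le> B k" and B: "integrable p B"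
  shows "integral {a..b} (\<lambda>y. \<integral>k. f k y \<partial>p) = (\<integral>k. integral {a..b} (f k) \<partial>p)"
proof -
  have int: "set_integrable lborel {a..b} (f k)" for k
    by (rule borel_integrable_atLeastAtMost'[OF cont])
  have int': "set_integrable lborel {a..b} (\<lambda>y. \<integral>k. f k y \<partial>p)"
    by (intro borel_integrable_atLeastAtMost' continuous_on_expectation[OF cont bound B])
  define g where "g k y = indicator {a..b} y *\<^sub>R f k y" for k y
  have gi: "integrable lborel (g k)" for k
    using int[of k] unfolding set_integrable_def g_def .
  have "integrable p (\<lambda>k. LINT y|lborel. norm (g k y))"
  proof (rule Bochner_Integration.integrable_bound[where f = "\<lambda>k. (b - a) * B k"])
    show "AE k in p. norm (LINT y|lborel. norm (g k y)) \<le> norm ((b - a) * B k)"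
    proof (rule AE_I2)
      fix k
      have "B k \<ge> 0"
        using bound[of a k] ab norm_ge_zero order_trans by (metis atLeastAtMost_iff order_refl)
      have "(LINT y|lborel. norm (g k y)) \<le> (LINT y|lborel. B k * indicator {a..b} y)"
      proof (rule integral_mono)
        show "norm (g k y) \<le> B k * indicator {a..b} y" for y
          using bound[of y k] by (auto simp: g_def indicator_def)
        show "integrable lborel (\<lambda>y. B k * indicator {a..b} y)"
          using ab by (intro integrable_mult_right integrable_real_indicator) auto
      qed (use gi in auto)
      also have "\<dots> = (b - a) * B k"
        using ab by simp
      finally show "norm (LINT y|lborel. norm (g k y)) \<le> norm ((b - a) * B k)"
        using \<open>B k \<ge> 0\<close> ab by (simp add: integral_nonneg_AE)
    qed
  qed (use B in auto)
  then have "(LINT y|lborel. (\<integral>k. g k y \<partial>p)) = (\<integral>k. (LINT y|lborel. g k y) \<partial>p)"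
    by (rule expectation_lborel_swap(1)[OF gi])
  moreover have "(LINT y|lborel. g k y) = integral {a..b} (f k)" for k
    using set_borel_integral_eq_integral(2)[OF int[of k]]
    by (simp add: set_lebesgue_integral_def g_def)
  moreover have "(LINT y|lborel. (\<integral>k. g k y \<partial>p)) = integral {a..b} (\<lambda>y. \<integral>k. f k y \<partial>p)"
    using set_borel_integral_eq_integral(2)[OF int']
    by (simp add: set_lebesgue_integral_def g_def)
  ultimately show ?thesis by simp
qed

section \<open>Trigonometric inequalities\<close>

text \<open>The sine is concave on the interval, so it lies above its chord.\<close>

lemma jordan_inequality:
  fixes v :: real assumes "0 \<le> v" "v \<le> pi / 2" shows "2 * v / pi \<le> sin v"
proof -
  have "concave_on {0..pi/2} sin"
  proof (rule f''_le0_imp_concave)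
    show "((sin :: real \<Rightarrow> real) has_real_derivative cos x) (at x)" for x by (rule DERIV_sin)
    show "((cos :: real \<Rightarrow> real) has_real_derivative - sin x) (at x)" for x by (rule DERIV_cos)
  qed (auto intro!: sin_ge_zero)
  from concave_onD[OF this, of "2 * v / pi" 0 "pi / 2"] assms show ?thesis
    by (simp add: field_simps)
qed

lemma cos_eq_one_minus_sin_half: "1 - cos u = 2 * (sin (u / 2))\<^sup>2" for u :: real
  using cos_double_sin[of "u / 2"] by simp

lemma one_minus_cos_ge:
  fixes u :: real assumes "\<bar>u\<bar> \<le> pi" shows "2 / pi\<^sup>2 * u\<^sup>2 \<le> 1 - cos u"
proof -
  have "2 * (\<bar>u\<bar> / 2) / pi \<le> sin (\<bar>u\<bar> / 2)"
    by (rule jordan_inequality) (use assms in auto)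
  then have "(2 * (\<bar>u\<bar> / 2) / pi)\<^sup>2 \<le> (sin (\<bar>u\<bar> / 2))\<^sup>2"
    by (rule power_mono) auto
  moreover have "1 - cos u = 2 * (sin (\<bar>u\<bar> / 2))\<^sup>2"
    using cos_eq_one_minus_sin_half[of "\<bar>u\<bar>"] by simp
  ultimately show ?thesis by (simp add: power_divide)
qed

lemma one_minus_cos_le: "1 - cos u \<le> u\<^sup>2 / 2" for u :: real
proof -
  have "\<bar>sin (u / 2)\<bar>\<^sup>2 \<le> \<bar>u / 2\<bar>\<^sup>2" by (rule power_mono[OF abs_sin_x_le_abs_x]) auto
  then show ?thesis by (simp add: cos_eq_one_minus_sin_half power_divide)
qed

lemma one_minus_cos_le_2: "1 - cos u \<le> 2" for u :: real
  using cos_ge_minus_one[of u] by linarith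

text \<open>One smooth majorant that is quadratic near zero and bounded at infinity; its integral in the
  frequency is an arctangent.\<close>

lemma one_minus_cos_le_rational:
  "1 - cos u \<le> (5 / 2) * (u\<^sup>2 / (1 + u\<^sup>2))" for u :: real
proof (cases "u\<^sup>2 \<le> 4")
  case True
  have "u\<^sup>2 * (1 + u\<^sup>2) \<le> u\<^sup>2 * 5" using True by (intro mult_left_mono) auto
  then have "u\<^sup>2 / 2 \<le> (5 / 2) * (u\<^sup>2 / (1 + u\<^sup>2))"
    by (simp add: field_simps add_pos_nonneg)
  with one_minus_cos_le[of u] show ?thesis by linarith
next
  case False
  note one_minus_cos_le_2[of u]
  also have "2 \<le> (5 / 2) * (u\<^sup>2 / (1 + u\<^sup>2))"
    using False by (simp add: field_simps add_pos_nonneg)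
  finally show ?thesis .
qed

section \<open>The law of the walk and its characteristic function\<close>

text \<open>The law of \<open>S_n\<close>, computed by conditioning on the last step.\<close>

primrec walk_prob :: "int pmf \<Rightarrow> nat \<Rightarrow> int \<Rightarrow> real" where
  "walk_prob p 0 y = (if y = 0 then 1 else 0)"
| "walk_prob p (Suc n) y = (\<integral>k. walk_prob p n (y - k) \<partial>p)"

definition charfun :: "int pmf \<Rightarrow> real \<Rightarrow> complex" where
  "charfun p t = (\<integral>k. cis (t * real_of_int k) \<partial>p)"

definition cos_defect :: "int pmf \<Rightarrow> real \<Rightarrow> real" where
  "cos_defect p t = (\<integral>k. 1 - cos (t * real_of_int k) \<partial>p)"

definition sin_mean :: "int pmf \<Rightarrow> real \<Rightarrow> real" where
  "sin_mean p t = (\<integral>k. sin (t * real_of_int k) \<partial>p)"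

lemma integrable_pmf_bounded:
  fixes f :: "'a \<Rightarrow> 'b::{banach, second_countable_topology}"
  assumes "\<And>k. norm (f k) \<le> B" shows "integrable (measure_pmf p) f"
  by (rule measure_pmf.integrable_const_bound[where B = B]) (use assms in auto)

lemma expectation_le_bound:
  fixes f :: "'a \<Rightarrow> real"
  assumes "integrable (measure_pmf p) f" "\<And>k. f k \<le> B" shows "(\<integral>k. f k \<partial>p) \<le> B"
  by (rule measure_pmf.integral_le_const) (use assms in auto)

lemma expectation_ge_bound:
  fixes f :: "'a \<Rightarrow> real"
  assumes "integrable (measure_pmf p) f" "\<And>k. B \<le> f k" shows "B \<le> (\<integral>k. f k \<partial>p)"
  by (rule measure_pmf.integral_ge_const) (use assms in auto)

lemma walk_prob_bounds: "0 \<le> walk_prob p n y \<and> walk_prob p n y \<le> 1"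
proof (induction n arbitrary: y)
  case (Suc n)
  have "integrable p (\<lambda>k. walk_prob p n (y - k))"
    by (rule integrable_pmf_bounded[where B = 1]) (use Suc in auto)
  with Suc show ?case by (auto intro!: expectation_le_bound)
qed auto

lemma integrable_cis [simp]: "integrable (measure_pmf p) (\<lambda>k. cis (f k))"
  by (rule integrable_pmf_bounded[where B = 1]) auto

lemma integrable_cos [simp]: "integrable (measure_pmf p) (\<lambda>k. cos (f k :: real))"
  by (rule integrable_pmf_bounded[where B = 1]) auto

lemma integrable_sin [simp]: "integrable (measure_pmf p) (\<lambda>k. sin (f k :: real))"
  by (rule integrable_pmf_bounded[where B = 1]) auto

lemma Re_charfun: "Re (charfun p t) = 1 - cos_defect p t"
  unfolding charfun_def cos_defect_def
  by (subst integral_Re[symmetric]) (auto simp: measure_pmf.prob_space)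

lemma Im_charfun: "Im (charfun p t) = sin_mean p t"
  unfolding charfun_def sin_mean_def by (subst integral_Im[symmetric]) auto

lemma norm_charfun_le_1: "norm (charfun p t) \<le> 1"
proof -
  have "norm (charfun p t) \<le> (\<integral>k. norm (cis (t * real_of_int k)) \<partial>p)"
    unfolding charfun_def by (rule integral_norm_bound)
  then show ?thesis by (simp add: measure_pmf.prob_space)
qed

lemma continuous_on_charfun: "continuous_on S (charfun p)"
  unfolding charfun_def
  by (rule continuous_on_expectation[where B = "\<lambda>_. 1"]) (auto intro!: continuous_intros)

lemma continuous_on_cos_defect: "continuous_on S (cos_defect p)"
  unfolding cos_defect_def
  by (rule continuous_on_expectation[where B = "\<lambda>_. 2"])
    (use one_minus_cos_le_2 in \<open>auto intro!: continuous_intros simp del: diff_le_eq\<close>)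

lemma continuous_on_sin_mean: "continuous_on S (sin_mean p)"
  unfolding sin_mean_def
  by (rule continuous_on_expectation[where B = "\<lambda>_. 1"]) (auto intro!: continuous_intros)

lemma cos_defect_nonneg: "0 \<le> cos_defect p t"
  unfolding cos_defect_def by (rule integral_nonneg_AE) auto

lemma integral_cos_int:
  "integral {0..pi} (\<lambda>t. cos (t * real_of_int y)) = (if y = 0 then pi else 0)"
proof (cases "y = 0")
  case False
  have "((\<lambda>t. cos (t * real_of_int y)) has_integral
     (sin (pi * real_of_int y) / real_of_int y - sin (0 * real_of_int y) / real_of_int y)) {0..pi}"
    by (rule fundamental_theorem_of_calculus)
      (use False in \<open>auto intro!: derivative_eq_intros
        simp flip: has_real_derivative_iff_has_vector_derivative\<close>)
  moreover have "sin (pi * real_of_int y) = 0"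
    by (auto simp: sin_zero_iff_int2 mult.commute)
  ultimately show ?thesis using False by (simp add: integral_unique)
qed auto

text \<open>The integrand has a conjugate-symmetric complex counterpart on \<open>[-\<pi>, \<pi>]\<close>, which is why half of
  the interval and the real part suffice. Conditioning on the last step multiplies the integrand by
  the characteristic function.\<close>

lemma walk_prob_fourier:
  "walk_prob p n y = integral {0..pi} (\<lambda>t. Re (charfun p t ^ n * cis (- (t * real_of_int y)))) / pi"
proof (induction n arbitrary: y)
  case 0
  then show ?case by (simp add: integral_cos_int)
next
  case (Suc n)
  let ?f = "\<lambda>k t. Re (charfun p t ^ n * cis (- (t * real_of_int (y - k))))"
  have bound: "norm (?f k t) \<le> 1" for k t
  proof -
    have "norm (?f k t) \<le> norm (charfun p t ^ n * cis (- (t * real_of_int (y - k))))"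
      by (metis abs_Re_le_cmod real_norm_def)
    also have "\<dots> \<le> 1"
      by (simp add: norm_mult norm_power power_le_one norm_charfun_le_1)
    finally show ?thesis .
  qed
  have step: "(\<integral>k. ?f k t \<partial>p) = Re (charfun p t ^ Suc n * cis (- (t * real_of_int y)))" for t
  proof -
    have int: "integrable p (\<lambda>k. charfun p t ^ n * cis (- (t * real_of_int (y - k))))" by simp
    have "(\<integral>k. ?f k t \<partial>p) = Re (\<integral>k. charfun p t ^ n * cis (- (t * real_of_int (y - k))) \<partial>p)"
      using integral_Re[OF int] by simp
    also have "(\<integral>k. charfun p t ^ n * cis (- (t * real_of_int (y - k))) \<partial>p)
        = (\<integral>k. charfun p t ^ n * cis (- (t * real_of_int y)) * cis (t * real_of_int k) \<partial>p)"
      by (intro Bochner_Integration.integral_cong refl) (simp add: cis_mult mult.assoc algebra_simps)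
    also have "\<dots> = charfun p t ^ n * cis (- (t * real_of_int y)) * charfun p t"
      unfolding charfun_def by (intro Bochner_Integration.integral_mult_right) simp
    finally show ?thesis by (simp add: algebra_simps)
  qed
  have "walk_prob p (Suc n) y = (\<integral>k. integral {0..pi} (?f k) \<partial>p) / pi"
    by (simp add: Suc)
  also have "(\<integral>k. integral {0..pi} (?f k) \<partial>p) = integral {0..pi} (\<lambda>t. \<integral>k. ?f k t \<partial>p)"
    by (rule expectation_integral_swap[symmetric, where B = "\<lambda>_. 1"])
      (use bound in \<open>auto intro!: continuous_intros continuous_on_charfun\<close>)
  finally show ?case by (simp only: step)
qed

lemma walk_prob_le_integral:
  "walk_prob p n y \<le> integral {0..pi} (\<lambda>t. norm (charfun p t) ^ n) / pi"
proof -
  have "integral {0..pi} (\<lambda>t. Re (charfun p t ^ n * cis (- (t * real_of_int y))))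
      \<le> integral {0..pi} (\<lambda>t. norm (charfun p t) ^ n)"
  proof (rule integral_le)
    show "Re (charfun p t ^ n * cis (- (t * real_of_int y))) \<le> norm (charfun p t) ^ n" for t
      using complex_Re_le_cmod[of "charfun p t ^ n * cis (- (t * real_of_int y))"]
      by (simp add: norm_mult norm_power)
  qed (auto intro!: integrable_continuous_real continuous_intros continuous_on_charfun)
  then show ?thesis unfolding walk_prob_fourier by (simp add: divide_right_mono)
qed

lemma cis_eq_1_iff: "cis u = 1 \<longleftrightarrow> (\<exists>j::int. u = 2 * pi * real_of_int j)"
proof -
  have "cis u = 1 \<longleftrightarrow> cos u = 1"
    by (auto simp: complex_eq_iff) (metis cos_one_sin_zero)
  then show ?thesis by (simp add: cos_one_2pi_int mult_ac)
qed

text \<open>If the modulus were \<open>1\<close>, then \<open>e^{itX}\<close> would have a mean on the unit circle and would be almost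
  surely equal to it.\<close>

lemma norm_charfun_less_1:
  assumes z: "z1 \<in> set_pmf p" "z2 \<in> set_pmf p" and ne: "cis (t * real_of_int (z1 - z2)) \<noteq> 1"
  shows "norm (charfun p t) < 1"
proof (rule ccontr)
  assume "\<not> norm (charfun p t) < 1"
  then have n1: "norm (charfun p t) = 1" using norm_charfun_le_1[of p t] by simp
  define w where "w = charfun p t"
  have ww: "cnj w * w = 1" using n1 complex_norm_square[of w] by (simp add: w_def mult.commute)
  have le: "Re (cnj w * cis u) \<le> 1" "norm (Re (cnj w * cis u)) \<le> 1" for u
    using complex_Re_le_cmod[of "cnj w * cis u"] abs_Re_le_cmod[of "cnj w * cis u"] n1
    by (simp_all add: norm_mult w_def)
  have int: "integrable p (\<lambda>k. Re (cnj w * cis (t * real_of_int k)))"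
    by (rule integrable_pmf_bounded[where B = 1]) (rule le(2))
  have "(\<integral>k. cnj w * cis (t * real_of_int k) \<partial>p) = cnj w * w"
    by (subst Bochner_Integration.integral_mult_right) (simp_all add: w_def charfun_def)
  then have "(\<integral>k. Re (cnj w * cis (t * real_of_int k)) \<partial>p) = 1"
    using ww by (subst integral_Re) auto
  then have 0: "(\<integral>k. 1 - Re (cnj w * cis (t * real_of_int k)) \<partial>p) = 0"
    by (subst Bochner_Integration.integral_diff) (auto simp: measure_pmf.prob_space intro: int)
  have int': "integrable p (\<lambda>k. 1 - Re (cnj w * cis (t * real_of_int k)))"
    by (intro Bochner_Integration.integrable_diff int) simp
  have "AE k in p. 1 - Re (cnj w * cis (t * real_of_int k)) = 0"
    by (rule integral_nonneg_eq_0_iff_AE[OF int', THEN iffD1])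
      (simp_all only: 0 le(1) diff_ge_0_iff_ge AE_I2)
  then have "1 - Re (cnj w * cis (t * real_of_int k)) = 0" if "k \<in> set_pmf p" for k
    using that unfolding AE_measure_pmf_iff by blast
  moreover have "cis u = w" if "1 - Re (cnj w * cis u) = 0" for u
  proof -
    have "norm (cnj w * cis u) = 1" using n1 by (simp add: norm_mult w_def)
    with that have "cnj w * cis u = 1"
      using cmod_power2[of "cnj w * cis u"] by (simp add: complex_eq_iff)
    then have "w * (cnj w * cis u) = w" by simp
    then show ?thesis using ww by (metis mult.assoc mult.commute mult_1)
  qed
  ultimately have "cis (t * real_of_int z1) = w" "cis (t * real_of_int z2) = w" using z by auto
  then have "cis (t * real_of_int z1) * cnj (cis (t * real_of_int z2)) = w * cnj w" by simp
  then have "cis (t * real_of_int (z1 - z2)) = 1"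
    using ww by (simp add: cis_cnj cis_mult algebra_simps)
  with ne show False by simp
qed

lemma AE_norm_charfun_less_1:
  assumes z: "z1 \<in> set_pmf p" "z2 \<in> set_pmf p" and ne: "z1 \<noteq> z2"
  shows "AE t in lborel. norm (charfun p t) < 1"
proof -
  have "countable (range (\<lambda>j::int. 2 * pi * real_of_int j / real_of_int (z1 - z2)))" by simp
  then have "AE t in lborel. t \<notin> range (\<lambda>j::int. 2 * pi * real_of_int j / real_of_int (z1 - z2))"
    by (intro AE_not_in countable_imp_null_set_lborel)
  then show ?thesis
  proof eventually_elim
    case (elim t)
    have "cis (t * real_of_int (z1 - z2)) \<noteq> 1"
    proof
      assume "cis (t * real_of_int (z1 - z2)) = 1"
      then obtain j :: int where "t * real_of_int (z1 - z2) = 2 * pi * real_of_int j"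
        unfolding cis_eq_1_iff by blast
      then have "t = 2 * pi * real_of_int j / real_of_int (z1 - z2)"
        using ne by (simp add: field_simps)
      with elim show False by blast
    qed
    then show ?case by (rule norm_charfun_less_1[OF z])
  qed
qed

text \<open>The walk may be periodic, so the modulus of the characteristic function can equal \<open>1\<close> away
  from zero; it does so only on a countable set.\<close>

lemma walk_prob_tendsto_0:
  assumes z: "z1 \<in> set_pmf p" "z2 \<in> set_pmf p" "z1 \<noteq> z2"
  shows "(\<lambda>n. walk_prob p n y) \<longlonglongrightarrow> 0"
proof (rule tendsto_sandwich[OF _ _ tendsto_const])
  have eq: "integral {0..pi} (\<lambda>t. norm (charfun p t) ^ n)
      = (LINT t|lborel. indicator {0..pi} t * norm (charfun p t) ^ n)" for n
  proof -
    have "set_integrable lborel {0..pi} (\<lambda>t. norm (charfun p t) ^ n)"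
      by (intro borel_integrable_atLeastAtMost' continuous_intros continuous_on_charfun)
    from set_borel_integral_eq_integral(2)[OF this] show ?thesis
      by (simp add: set_lebesgue_integral_def)
  qed
  have [measurable]: "charfun p \<in> borel_measurable borel"
    by (rule borel_measurable_continuous_onI[OF continuous_on_charfun])
  have "(\<lambda>n. LINT t|lborel. indicator {0..pi} t * norm (charfun p t) ^ n)
      \<longlonglongrightarrow> integral\<^sup>L lborel (\<lambda>_::real. 0::real)"
  proof (rule Bochner_Integration.integral_dominated_convergence[where w = "indicator {0..pi}"])
    show "AE t in lborel. (\<lambda>n. indicator {0..pi} t * norm (charfun p t) ^ n) \<longlonglongrightarrow> 0"
      using AE_norm_charfun_less_1[OF z]
      by eventually_elim (auto intro!: tendsto_mult_right_zero LIMSEQ_power_zero)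
    show "AE t in lborel. norm (indicator {0..pi} t * norm (charfun p t) ^ n)
        \<le> indicator {0..pi} t" for n
      by (auto simp: indicator_def power_le_one norm_charfun_le_1)
  qed auto
  then have "(\<lambda>n. integral {0..pi} (\<lambda>t. norm (charfun p t) ^ n) / pi) \<longlonglongrightarrow> 0 / pi"
    unfolding eq by (intro tendsto_divide) auto
  then show "(\<lambda>n. integral {0..pi} (\<lambda>t. norm (charfun p t) ^ n) / pi) \<longlonglongrightarrow> 0" by simp
qed (auto simp: walk_prob_bounds walk_prob_le_integral)

section \<open>Harmonic functions and compactness\<close>

text \<open>Tychonoff's theorem; the product topology is metrizable because there are countably many
  coordinates.\<close>

lemma pointwise_convergent_subsequence:
  fixes a :: "nat \<Rightarrow> int \<Rightarrow> real"
  assumes "\<And>n x. \<bar>a n x\<bar> \<le> B x"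
  shows "\<exists>l r. strict_mono (r :: nat \<Rightarrow> nat) \<and> (\<forall>x. (\<lambda>n. a (r n) x) \<longlonglongrightarrow> l x)"
proof -
  let ?K = "PiE UNIV (\<lambda>x. {- B x..B x})"
  have "compactin (product_topology (\<lambda>x::int. euclidean) UNIV) ?K"
    by (subst compactin_PiE) auto
  then have "compact ?K"
    by (simp add: euclidean_product_topology)
  then have "seq_compact ?K"
    by (simp add: compact_eq_seq_compact_metric)
  moreover have "a n \<in> ?K" for n
    using assms[of n] by (auto simp: abs_le_iff) (metis minus_le_iff)
  ultimately obtain l r where lr: "strict_mono (r :: nat \<Rightarrow> nat)" "(a \<circ> r) \<longlonglongrightarrow> l"
    by (metis seq_compactE)
  have "(\<lambda>n. a (r n) x) \<longlonglongrightarrow> l x" for x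
  proof -
    have "continuous_on UNIV (\<lambda>f :: int \<Rightarrow> real. f x)" by (rule continuous_on_product_coordinates)
    from continuous_on_tendsto_compose[OF this lr(2)] show ?thesis by (simp add: o_def)
  qed
  with lr(1) show ?thesis by blast
qed

lemma abs_expectation_le:
  fixes f :: "int \<Rightarrow> real"
  assumes "\<And>k. \<bar>f k\<bar> \<le> B" shows "\<bar>\<integral>k. f k \<partial>measure_pmf p\<bar> \<le> B"
proof -
  have i: "integrable p f" by (rule integrable_pmf_bounded[where B = B]) (use assms in auto)
  have "f k \<le> B" "- B \<le> f k" for k using assms[of k] by auto
  then have "(\<integral>k. f k \<partial>p) \<le> B" "- B \<le> (\<integral>k. f k \<partial>p)"
    using expectation_le_bound[OF i] expectation_ge_bound[OF i] by blast+
  then show ?thesis by linarith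
qed

definition avg :: "int pmf \<Rightarrow> (int \<Rightarrow> real) \<Rightarrow> int \<Rightarrow> real" where
  "avg p f x = (\<integral>k. f (x - k) \<partial>p)"

text \<open>Irreducibility of the chain, with the starting point moved to \<open>0\<close> by translation invariance.\<close>

definition irreducible_law :: "int pmf \<Rightarrow> bool" where
  "irreducible_law p \<longleftrightarrow> (\<forall>y. \<exists>n. walk_prob p n y > 0)"

text \<open>The support of the step generates the integers as a semigroup: every value reached with
  positive probability is a sum of support points.\<close>

lemma irreducible_induct:
  assumes irr: "irreducible_law p" and "Q 0"
    and step: "\<And>x k. Q x \<Longrightarrow> k \<in> set_pmf p \<Longrightarrow> Q (x + k)"
  shows "Q (y :: int)"
proof -
  have "walk_prob p n y > 0 \<Longrightarrow> Q y" for n y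
  proof (induction n arbitrary: y)
    case 0 then show ?case using \<open>Q 0\<close> by (auto split: if_splits)
  next
    case (Suc n)
    have "\<exists>k\<in>set_pmf p. walk_prob p n (y - k) > 0"
    proof (rule ccontr)
      assume "\<not> ?thesis"
      then have "AE k in p. walk_prob p n (y - k) = 0"
        unfolding AE_measure_pmf_iff using walk_prob_bounds by (metis not_le_imp_less antisym)
      then have "walk_prob p (Suc n) y = (\<integral>k. 0 \<partial>p)"
        unfolding walk_prob.simps by (intro integral_cong_AE) auto
      with Suc.prems show False by simp
    qed
    then obtain k where "k \<in> set_pmf p" "walk_prob p n (y - k) > 0" by blast
    with Suc.IH step[of "y - k" k] show ?case by simp
  qed
  with irr show ?thesis unfolding irreducible_law_def by blast
qed

text \<open>Let \<open>z\<close> be in the support and let \<open>V\<close> be the square of the increment of \<open>g\<close> along \<open>z\<close>. By Jensen's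
  inequality \<open>V\<close> is subharmonic, so each of its averages \<open>P^n V\<close> is at least \<open>V\<close>. On the other hand
  \<open>p(z) V \<le> P(g^2) - g^2\<close>, so the sum over \<open>i < n\<close> of \<open>p(z) P^i V\<close> telescopes to at most
  \<open>P^n(g^2) - g^2\<close>, which is bounded in \<open>n\<close>. Hence \<open>V = 0\<close>, and \<open>g\<close> is invariant under the support.\<close>

lemma bounded_harmonic_constant:
  assumes irr: "irreducible_law p"
    and bound: "\<And>x. \<bar>g x\<bar> \<le> C" and harm: "\<And>x. avg p g x = g x"
  shows "g y = g 0"
proof -
  have intb: "integrable p (\<lambda>k. f (x - k))" if "\<And>y. \<bar>f y\<bar> \<le> B" for f :: "int \<Rightarrow> real" and B x
    by (rule integrable_pmf_bounded[where B = B]) (use that in auto)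
  have avg_bound: "\<bar>avg p f x\<bar> \<le> B" if "\<And>y. \<bar>f y\<bar> \<le> B" for f :: "int \<Rightarrow> real" and B x
    unfolding avg_def by (rule abs_expectation_le) (rule that)
  have C: "0 \<le> C" using bound[of 0] by linarith
  have g2: "\<bar>(g y)\<^sup>2\<bar> \<le> C\<^sup>2" for y using bound[of y] C by (simp add: abs_le_square_iff[symmetric])
  have ig: "integrable p (\<lambda>k. g (x - k))" for x
    by (rule integrable_pmf_bounded[where B = C]) (use bound in auto)
  have ig2: "integrable p (\<lambda>k. (g (x - k))\<^sup>2)" for x
    by (rule integrable_pmf_bounded[where B = "C\<^sup>2"]) (use g2 in auto)
  have step: "g (x - z) = g x" if z: "z \<in> set_pmf p" for x z
  proof -
    define V where "V x = (g (x - z) - g x)\<^sup>2" for x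
    have V4: "\<bar>V x\<bar> \<le> 4 * C\<^sup>2" for x
    proof -
      have "\<bar>g (x - z) - g x\<bar> \<le> 2 * C" using bound[of x] bound[of "x - z"] by linarith
      then have "(g (x - z) - g x)\<^sup>2 \<le> (2 * C)\<^sup>2" by (metis abs_le_square_iff abs_of_nonneg C mult_nonneg_nonneg zero_le_numeral)
      then show ?thesis unfolding V_def by (simp add: power_mult_distrib)
    qed
    \<comment> \<open>Jensen's inequality, applied to the increment of \<open>g\<close>, which is harmonic too\<close>
    have sub: "V x \<le> avg p V x" for x
    proof -
      have "g (x - z) - g x = (\<integral>k. g (x - z - k) - g (x - k) \<partial>p)"
        using harm[of x] harm[of "x - z"] unfolding avg_def
        by (subst Bochner_Integration.integral_diff) (simp_all add: ig)
      then have "V x = (\<integral>k. g (x - z - k) - g (x - k) \<partial>p)\<^sup>2" by (simp add: V_def)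
      also have "\<dots> \<le> (\<integral>k. (g (x - z - k) - g (x - k))\<^sup>2 \<partial>p)"
      proof -
        let ?u = "\<lambda>k. g (x - z - k) - g (x - k)"
        have iu: "integrable p ?u" by (intro Bochner_Integration.integrable_diff ig)
        have iu2: "integrable p (\<lambda>k. (?u k)\<^sup>2)"
          using intb[where f = V, OF V4, of x] by (simp add: V_def algebra_simps)
        show ?thesis
          using measure_pmf.variance_eq[OF iu iu2] measure_pmf.variance_positive[of p ?u] by simp
      qed
      also have "\<dots> = avg p V x" unfolding avg_def V_def by (simp add: algebra_simps)
      finally show ?thesis .
    qed
    \<comment> \<open>since \<open>P g = g\<close>, the right-hand side is the mean of the squared increment over all steps\<close>
    have energy: "pmf p z * V x \<le> avg p (\<lambda>y. (g y)\<^sup>2) x - (g x)\<^sup>2" for x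
    proof -
      have "pmf p z * V x = (\<integral>k. indicator {z} k * (g (x - z) - g x)\<^sup>2 \<partial>p)"
        by (simp add: V_def measure_pmf_single)
      also have "\<dots> \<le> (\<integral>k. (g (x - k) - g x)\<^sup>2 \<partial>p)"
      proof (rule integral_mono)
        show "integrable p (\<lambda>k. indicator {z} k * (g (x - z) - g x)\<^sup>2)"
          by (rule integrable_pmf_bounded[where B = "(g (x - z) - g x)\<^sup>2"]) (auto simp: indicator_def)
        show "integrable p (\<lambda>k. (g (x - k) - g x)\<^sup>2)"
          using ig[of x] ig2[of x] by (simp add: power2_diff)
      qed (auto simp: indicator_def)
      also have "\<dots> = (\<integral>k. (g (x - k))\<^sup>2 - 2 * g x * g (x - k) + (g x)\<^sup>2 \<partial>p)"
        by (simp add: power2_diff algebra_simps)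
      also have "\<dots> = avg p (\<lambda>y. (g y)\<^sup>2) x - 2 * g x * g x + (g x)\<^sup>2"
        using ig[of x] ig2[of x] harm[of x] unfolding avg_def by (simp add: measure_pmf.prob_space)
      finally show ?thesis by (simp add: power2_eq_square)
    qed
    have avg_mono: "avg p f x \<le> avg p h x" if "\<And>y. \<bar>f y\<bar> \<le> B" "\<And>y. \<bar>h y\<bar> \<le> B'" "\<And>y. f y \<le> h y" for f h B B' x
      unfolding avg_def by (rule integral_mono) (use that in \<open>auto intro: intb\<close>)
    define P where "P n f = (avg p ^^ n) f" for n f
    have Pbound: "\<bar>P n f y\<bar> \<le> B" if "\<And>y. \<bar>f y\<bar> \<le> B" for n f B y
      unfolding P_def by (induction n arbitrary: y) (use that avg_bound in auto)
    have Psub: "V x \<le> P n V x" for n x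
    proof (induction n arbitrary: x)
      case (Suc n)
      have "V x \<le> avg p V x" by (rule sub)
      also have "\<dots> \<le> avg p (P n V) x" by (rule avg_mono[OF V4 Pbound[OF V4] Suc])
      finally show ?case by (simp add: P_def)
    qed (simp add: P_def)
    let ?G = "\<lambda>y. (g y)\<^sup>2"
    have Pen: "pmf p z * P n V x \<le> P (Suc n) ?G x - P n ?G x" for n x
    proof (induction n arbitrary: x)
      case 0 then show ?case using energy by (simp add: P_def)
    next
      case (Suc n)
      have i: "integrable p (\<lambda>k. P m ?G (x - k))" for m x by (rule intb[where f = "P m ?G", OF Pbound[OF g2]])
      have "pmf p z * P (Suc n) V x = avg p (\<lambda>y. pmf p z * P n V y) x"
        by (simp add: P_def avg_def)
      also have "\<dots> \<le> avg p (\<lambda>y. P (Suc n) ?G y - P n ?G y) x"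
        unfolding avg_def using Suc intb[where f = "P n V", OF Pbound[OF V4], of x] i[of "Suc n" x] i[of n x]
        by (intro integral_mono) auto
      also have "\<dots> = P (Suc (Suc n)) ?G x - P (Suc n) ?G x"
        using i[of "Suc n" x] i[of n x] unfolding avg_def by (simp add: P_def avg_def)
      finally show ?case .
    qed
    have energy_sum: "real n * (pmf p z * V x) \<le> C\<^sup>2" for n
    proof -
      have "real n * (pmf p z * V x) = (\<Sum>i<n. pmf p z * V x)" by simp
      also have "\<dots> \<le> (\<Sum>i<n. P (Suc i) ?G x - P i ?G x)"
        by (intro sum_mono order_trans[OF _ Pen] mult_left_mono Psub) auto
      also have "\<dots> = P n ?G x - P 0 ?G x" by (rule sum_lessThan_telescope)
      also have "\<dots> \<le> C\<^sup>2"
      proof -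
        have "P n ?G x \<le> C\<^sup>2" by (rule abs_le_D1[OF Pbound[where f = ?G, OF g2]])
        moreover have "0 \<le> P 0 ?G x" by (simp add: P_def)
        ultimately show ?thesis by linarith
      qed
      finally show ?thesis .
    qed
    have "pmf p z * V x \<le> 0"
    proof (rule ccontr)
      assume "\<not> pmf p z * V x \<le> 0"
      then obtain n where "C\<^sup>2 < real n * (pmf p z * V x)"
        using reals_Archimedean3[of "pmf p z * V x"] by auto
      with energy_sum[of n] show False by linarith
    qed
    moreover have "pmf p z > 0" using z by (simp add: pmf_positive)
    ultimately have "V x \<le> 0" by (simp add: mult_le_0_iff)
    then show ?thesis by (simp add: V_def)
  qed
  show ?thesis
    by (rule irreducible_induct[OF irr, where Q = "\<lambda>x. g x = g 0"])
      (use step in \<open>auto, metis add_diff_cancel_right'\<close>)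
qed


section \<open>Convergence of the potential series\<close>

locale walk_law =
  fixes p :: "int pmf"
  assumes integrable_step: "integrable p real_of_int"
    and irreducible: "irreducible_law p"
    and infinite_variance: "(\<integral>\<^sup>+k. ennreal ((real_of_int k)\<^sup>2) \<partial>p) = \<infinity>"
begin

abbreviation "\<psi> \<equiv> charfun p"

lemma support_not_singleton: obtains z1 z2 where "z1 \<in> set_pmf p" "z2 \<in> set_pmf p" "z1 \<noteq> z2"
proof (rule ccontr)
  assume "\<not> thesis"
  with that have eq: "z1 = z2" if "z1 \<in> set_pmf p" "z2 \<in> set_pmf p" for z1 z2 using that by blast
  obtain z where z: "z \<in> set_pmf p" using set_pmf_not_empty by fast
  have "(\<integral>\<^sup>+k. ennreal ((real_of_int k)\<^sup>2) \<partial>p) = (\<integral>\<^sup>+k. ennreal ((real_of_int z)\<^sup>2) \<partial>p)"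
    by (rule nn_integral_cong_AE) (auto simp: AE_measure_pmf_iff dest: eq[OF z])
  then show False using infinite_variance by (simp add: measure_pmf.emeasure_space_1)
qed

text \<open>A zero at \<open>t\<close> would put the whole support, hence by irreducibility also \<open>1\<close>, into the kernel of
  the character \<open>k \<mapsto> e^{itk}\<close>.\<close>

lemma cos_defect_pos:
  assumes t: "0 < t" "t \<le> pi" shows "0 < cos_defect p t"
proof (rule ccontr)
  assume "\<not> 0 < cos_defect p t"
  then have 0: "(\<integral>k. 1 - cos (t * real_of_int k) \<partial>p) = 0"
    using cos_defect_nonneg[of p t] by (simp add: cos_defect_def)
  have "AE k in p. 1 - cos (t * real_of_int k) = 0"
    by (rule integral_nonneg_eq_0_iff_AE[THEN iffD1, OF _ _ 0]) auto
  then have one: "cis (t * real_of_int k) = 1" if "k \<in> set_pmf p" for k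
    using that by (auto simp: AE_measure_pmf_iff complex_eq_iff) (metis cos_one_sin_zero)
  have "cis (t * real_of_int 1) = 1"
    by (rule irreducible_induct[OF irreducible, where Q = "\<lambda>x. cis (t * real_of_int x) = 1"])
      (use one in \<open>simp_all add: distrib_left flip: cis_mult\<close>)
  then obtain j :: int where j: "t = 2 * pi * real_of_int j" by (auto simp: cis_eq_1_iff)
  with t have "0 < real_of_int j" "2 * pi * real_of_int j \<le> pi * 1" by (auto simp: zero_less_mult_iff)
  then have "0 < j" and le: "2 * real_of_int j \<le> 1" by auto
  then have "1 \<le> real_of_int j" by (simp add: int_one_le_iff_zero_less)
  with le show False by linarith
qed

text \<open>Only steps with \<open>t|k| \<le> \<pi>\<close> are kept; the other ones may contribute nothing, as \<open>tk\<close> can be a multiple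
  of \<open>2\<pi>\<close>.\<close>

lemma cos_defect_ge_truncated:
  assumes "0 \<le> t" "t * A \<le> pi"
  shows "2 / pi\<^sup>2 * t\<^sup>2 * (\<integral>k. (real_of_int k)\<^sup>2 * of_bool (\<bar>real_of_int k\<bar> \<le> A) \<partial>p) \<le> cos_defect p t"
proof -
  have "(\<integral>k. 2 / pi\<^sup>2 * t\<^sup>2 * ((real_of_int k)\<^sup>2 * of_bool (\<bar>real_of_int k\<bar> \<le> A)) \<partial>p)
      \<le> (\<integral>k. 1 - cos (t * real_of_int k) \<partial>p)"
  proof (rule integral_mono)
    have "(real_of_int k)\<^sup>2 * of_bool (\<bar>real_of_int k\<bar> \<le> A) \<le> A\<^sup>2" for k
      by (auto simp: abs_le_square_iff[symmetric])
    then have "integrable p (\<lambda>k. (real_of_int k)\<^sup>2 * of_bool (\<bar>real_of_int k\<bar> \<le> A))"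
      by (intro integrable_pmf_bounded[where B = "A\<^sup>2"]) auto
    then show "integrable p (\<lambda>k. 2 / pi\<^sup>2 * t\<^sup>2 * ((real_of_int k)\<^sup>2 * of_bool (\<bar>real_of_int k\<bar> \<le> A)))"
      by simp
    show "2 / pi\<^sup>2 * t\<^sup>2 * ((real_of_int k)\<^sup>2 * of_bool (\<bar>real_of_int k\<bar> \<le> A))
        \<le> 1 - cos (t * real_of_int k)" for k
    proof (cases "\<bar>real_of_int k\<bar> \<le> A")
      case True
      then have "\<bar>t * real_of_int k\<bar> \<le> t * A"
        using assms(1) by (simp add: abs_mult mult_left_mono)
      then show ?thesis using one_minus_cos_ge[of "t * real_of_int k"] assms(2) True
        by (simp add: power_mult_distrib mult_ac)
    qed auto
  qed auto
  then show ?thesis by (simp add: cos_defect_def)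
qed

lemma truncated_variance_unbounded:
  obtains n :: nat where "K \<le> (\<integral>k. (real_of_int k)\<^sup>2 * of_bool (\<bar>real_of_int k\<bar> \<le> real n) \<partial>p)"
proof (rule ccontr)
  assume "\<not> thesis"
  with that have less: "(\<integral>k. (real_of_int k)\<^sup>2 * of_bool (\<bar>real_of_int k\<bar> \<le> real n) \<partial>p) < K" for n
    by (meson not_le)
  let ?f = "\<lambda>n k. (real_of_int k)\<^sup>2 * of_bool (\<bar>real_of_int k\<bar> \<le> real n)"
  have int: "integrable p (?f n)" for n
  proof (rule integrable_pmf_bounded[where B = "(real n)\<^sup>2"])
    show "norm (?f n k) \<le> (real n)\<^sup>2" for k by (auto simp: abs_le_square_iff[symmetric])
  qed
  have nn: "(\<integral>\<^sup>+k. ennreal (?f n k) \<partial>p) \<le> ennreal K" for n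
    using less[of n] by (subst nn_integral_eq_integral[OF int]) (auto intro!: ennreal_leI)
  have sup: "(SUP n. ennreal (?f n k)) = ennreal ((real_of_int k)\<^sup>2)" for k
  proof (rule antisym)
    show "(SUP n. ennreal (?f n k)) \<le> ennreal ((real_of_int k)\<^sup>2)"
      by (rule SUP_least) (auto intro!: ennreal_leI)
    have "ennreal (?f (nat \<bar>k\<bar>) k) \<le> (SUP n. ennreal (?f n k))" by (rule SUP_upper) simp
    then show "ennreal ((real_of_int k)\<^sup>2) \<le> (SUP n. ennreal (?f n k))" by simp
  qed
  have "(SUP n. \<integral>\<^sup>+k. ennreal (?f n k) \<partial>p) = (\<integral>\<^sup>+k. (SUP n. ennreal (?f n k)) \<partial>p)"
    by (rule nn_integral_monotone_convergence_SUP[symmetric])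
      (auto simp: incseq_def le_fun_def intro!: ennreal_leI mult_left_mono)
  then have "(SUP n. \<integral>\<^sup>+k. ennreal (?f n k) \<partial>p) = \<infinity>"
    using infinite_variance by (simp only: sup)
  moreover have "(SUP n. \<integral>\<^sup>+k. ennreal (?f n k) \<partial>p) \<le> ennreal K" by (rule SUP_least) (rule nn)
  ultimately have "\<infinity> \<le> ennreal K" by (simp only:)
  then show False by (simp add: top_unique)
qed

text \<open>This is where the infinite variance enters the existence proof: it makes the symmetrized
  potential sublinear, which in turn leaves no room for a linear harmonic function.\<close>

lemma cos_defect_superquadratic:
  "\<exists>t0>0. t0 \<le> pi \<and> (\<forall>t. 0 \<le> t \<longrightarrow> t \<le> t0 \<longrightarrow> K * t\<^sup>2 \<le> cos_defect p t)"
proof -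
  let ?v = "\<lambda>n. (\<integral>k. (real_of_int k)\<^sup>2 * of_bool (\<bar>real_of_int k\<bar> \<le> real n) \<partial>p)"
  obtain n where n: "K * pi\<^sup>2 / 2 \<le> ?v n" by (rule truncated_variance_unbounded)
  have "K * t\<^sup>2 \<le> cos_defect p t" if "0 \<le> t" "t \<le> pi / (real n + 1)" for t
  proof -
    have "t * real n \<le> t * (real n + 1)" using that by (intro mult_left_mono) auto
    also have "\<dots> \<le> pi" using that by (simp add: field_simps)
    finally have "2 / pi\<^sup>2 * t\<^sup>2 * ?v n \<le> cos_defect p t" by (rule cos_defect_ge_truncated[OF that(1)])
    moreover have "2 / pi\<^sup>2 * t\<^sup>2 * (K * pi\<^sup>2 / 2) \<le> 2 / pi\<^sup>2 * t\<^sup>2 * ?v n"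
      by (rule mult_left_mono[OF n]) auto
    ultimately show ?thesis by (simp add: mult_ac)
  qed
  moreover have "pi / (real n + 1) \<le> pi" by (simp add: field_simps)
  ultimately show ?thesis by (intro exI[of _ "pi / (real n + 1)"]) auto
qed

text \<open>Near zero the bound is \<open>\<epsilon>\<close> times a function whose integral is of order \<open>|x|\<close>; away from zero the
  denominator is bounded below. Both parts are uniform in \<open>x\<close>.\<close>

lemma kernel_majorant:
  assumes "0 < \<epsilon>"
  shows "\<exists>C\<ge>0. \<forall>x t. 0 \<le> t \<longrightarrow> t \<le> pi \<longrightarrow>
    (1 - cos (t * x)) / cos_defect p t \<le> \<epsilon> * (x\<^sup>2 / (1 + x\<^sup>2 * t\<^sup>2)) + C"
proof -
  obtain t0 where t0: "0 < t0" "t0 \<le> pi"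
    and le: "\<And>t. 0 \<le> t \<Longrightarrow> t \<le> t0 \<Longrightarrow> 5 / (2 * \<epsilon>) * t\<^sup>2 \<le> cos_defect p t"
    using cos_defect_superquadratic[of "5 / (2 * \<epsilon>)"] by metis
  obtain s where s: "s \<in> {t0..pi}" "\<And>t. t \<in> {t0..pi} \<Longrightarrow> cos_defect p s \<le> cos_defect p t"
    using continuous_attains_inf[of "{t0..pi}" "cos_defect p"] t0 continuous_on_cos_defect by auto
  define r where "r = cos_defect p s"
  have r: "0 < r" using s t0 cos_defect_pos[of s] by (simp add: r_def)
  have "(1 - cos (t * x)) / cos_defect p t \<le> \<epsilon> * (x\<^sup>2 / (1 + x\<^sup>2 * t\<^sup>2)) + 2 / r"
    if t: "0 \<le> t" "t \<le> pi" for t x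
  proof (cases "t \<le> t0")
    case True
    show ?thesis
    proof (cases "t = 0")
      case False
      with t have tp: "0 < t" by simp
      have "(1 - cos (t * x)) / cos_defect p t \<le> (1 - cos (t * x)) / (5 / (2 * \<epsilon>) * t\<^sup>2)"
        by (rule divide_left_mono) (use le[OF t(1) True] tp assms cos_defect_pos[OF tp t(2)] in auto)
      also have "\<dots> \<le> ((5 / 2) * ((t * x)\<^sup>2 / (1 + (t * x)\<^sup>2))) / (5 / (2 * \<epsilon>) * t\<^sup>2)"
        by (rule divide_right_mono[OF one_minus_cos_le_rational]) (use assms in auto)
      also have "\<dots> = \<epsilon> * (x\<^sup>2 / (1 + x\<^sup>2 * t\<^sup>2))"
      proof -
        define d where "d = 1 + x\<^sup>2 * t\<^sup>2"
        have "d > 0" "1 + (t * x)\<^sup>2 = d" by (simp_all add: d_def add_pos_nonneg power_mult_distrib)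
        then show ?thesis using tp assms unfolding d_def[symmetric]
          by (simp add: power_mult_distrib field_simps)
      qed
      also have "\<dots> \<le> \<dots> + 2 / r" using r by simp
      finally show ?thesis .
    qed (use r assms in auto)
  next
    case False
    have "(1 - cos (t * x)) / cos_defect p t \<le> 2 / r"
      by (rule frac_le) (use False t s(2)[of t] r one_minus_cos_le_2 in \<open>auto simp: r_def\<close>)
    also have "\<dots> \<le> \<epsilon> * (x\<^sup>2 / (1 + x\<^sup>2 * t\<^sup>2)) + 2 / r" using assms by simp
    finally show ?thesis .
  qed
  then show ?thesis using r by (intro exI[of _ "2 / r"]) simp
qed


definition re_kernel :: "real \<Rightarrow> real" where
  "re_kernel t = cos_defect p t / ((cos_defect p t)\<^sup>2 + (sin_mean p t)\<^sup>2)"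

definition sym_sum :: "nat \<Rightarrow> int \<Rightarrow> real" where
  "sym_sum N x = (\<Sum>n<N. walk_prob p n 0 - (walk_prob p n x + walk_prob p n (- x)) / 2)"

lemma Re_inverse_one_minus_charfun: "Re (1 / (1 - \<psi> t)) = re_kernel t"
proof -
  have "1 - \<psi> t = Complex (cos_defect p t) (- sin_mean p t)"
    by (simp add: complex_eq_iff Re_charfun Im_charfun)
  then show ?thesis by (simp add: re_kernel_def Re_divide power2_eq_square)
qed

lemma re_kernel_nonneg: "0 \<le> re_kernel t"
  unfolding re_kernel_def using cos_defect_nonneg by simp

lemma re_kernel_le: "re_kernel t \<le> 1 / cos_defect p t"
proof (cases "cos_defect p t = 0")
  case False
  then have pos: "0 < cos_defect p t" using cos_defect_nonneg[of p t] by linarith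
  then have "cos_defect p t / ((cos_defect p t)\<^sup>2 + (sin_mean p t)\<^sup>2) \<le> cos_defect p t / (cos_defect p t)\<^sup>2"
    by (intro divide_left_mono) (auto intro!: mult_pos_pos add_pos_nonneg)
  then show ?thesis using pos by (simp add: re_kernel_def power2_eq_square)
qed (simp add: re_kernel_def)

lemma sym_sum_integral:
  "sym_sum N x = integral {0..pi} (\<lambda>t. Re (\<Sum>n<N. \<psi> t ^ n) * (1 - cos (t * real_of_int x))) / pi"
proof -
  let ?g = "\<lambda>n y t. Re (\<psi> t ^ n * cis (- (t * real_of_int y)))"
  have i: "?g n y integrable_on {0..pi}" for n y
    by (intro integrable_continuous_real continuous_intros continuous_on_charfun)
  have "walk_prob p n 0 - (walk_prob p n x + walk_prob p n (- x)) / 2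
      = integral {0..pi} (\<lambda>t. Re (\<psi> t ^ n) * (1 - cos (t * real_of_int x))) / pi" for n
  proof -
    have "walk_prob p n 0 - (walk_prob p n x + walk_prob p n (- x)) / 2
       = (integral {0..pi} (?g n 0) - (integral {0..pi} (?g n x) + integral {0..pi} (?g n (- x))) / 2) / pi"
      unfolding walk_prob_fourier by (simp add: diff_divide_distrib add_divide_distrib)
    also have "integral {0..pi} (?g n 0) - (integral {0..pi} (?g n x) + integral {0..pi} (?g n (- x))) / 2
       = integral {0..pi} (\<lambda>t. ?g n 0 t - (?g n x t + ?g n (- x) t) / 2)"
      by (rule integral_unique[symmetric], intro has_integral_diff has_integral_divide has_integral_add
          integrable_integral i)
    also have "(\<lambda>t. ?g n 0 t - (?g n x t + ?g n (- x) t) / 2) = (\<lambda>t. Re (\<psi> t ^ n) * (1 - cos (t * real_of_int x)))"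
      by (auto simp: algebra_simps)
    finally show ?thesis .
  qed
  then have "sym_sum N x = (\<Sum>n<N. integral {0..pi} (\<lambda>t. Re (\<psi> t ^ n) * (1 - cos (t * real_of_int x)))) / pi"
    unfolding sym_sum_def by (simp add: sum_divide_distrib)
  also have "(\<Sum>n<N. integral {0..pi} (\<lambda>t. Re (\<psi> t ^ n) * (1 - cos (t * real_of_int x))))
      = integral {0..pi} (\<lambda>t. \<Sum>n<N. Re (\<psi> t ^ n) * (1 - cos (t * real_of_int x)))"
    by (intro integral_sum[symmetric] integrable_continuous_real continuous_intros continuous_on_charfun) auto
  finally show ?thesis by (simp add: sum_distrib_right)
qed

text \<open>The factor \<open>2\<close> comes from \<open>|1 - \<psi>^N| \<le> 2\<close>, so the bound does not depend on \<open>N\<close>.\<close>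

lemma geometric_factor_le:
  assumes t: "0 \<le> t" "t \<le> pi"
  shows "\<bar>Re (\<Sum>n<N. \<psi> t ^ n) * (1 - cos (t * x))\<bar> \<le> 2 * ((1 - cos (t * x)) / cos_defect p t)"
proof (cases "t = 0")
  case False
  with t have R: "0 < cos_defect p t" using cos_defect_pos[of t] by simp
  have "cos_defect p t = Re (1 - \<psi> t)" by (simp add: Re_charfun)
  also have "\<dots> \<le> norm (1 - \<psi> t)" by (rule complex_Re_le_cmod)
  finally have R_le: "cos_defect p t \<le> norm (1 - \<psi> t)" .
  then have ne: "\<psi> t \<noteq> 1" using R by auto
  have "\<bar>Re (\<Sum>n<N. \<psi> t ^ n)\<bar> \<le> norm (\<Sum>n<N. \<psi> t ^ n)" by (rule abs_Re_le_cmod)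
  also have "\<dots> = norm (1 - \<psi> t ^ N) / norm (1 - \<psi> t)"
    using ne by (simp add: sum_gp_strict norm_divide)
  also have "\<dots> \<le> 2 / cos_defect p t"
  proof (rule frac_le)
    have "norm (1 - \<psi> t ^ N) \<le> norm (1::complex) + norm (\<psi> t ^ N)" by (rule norm_triangle_ineq4)
    then show "norm (1 - \<psi> t ^ N) \<le> 2"
      using power_le_one[OF norm_ge_zero norm_charfun_le_1[of p t], of N] by (simp add: norm_power)
  qed (use R R_le in auto)
  finally have "\<bar>Re (\<Sum>n<N. \<psi> t ^ n)\<bar> * (1 - cos (t * x)) \<le> 2 / cos_defect p t * (1 - cos (t * x))"
    by (rule mult_right_mono) simp
  then show ?thesis by (simp add: abs_mult)
qed simp

lemma integral_majorant:
  "integral {0..pi} (\<lambda>t. x\<^sup>2 / (1 + x\<^sup>2 * t\<^sup>2)) \<le> \<bar>x\<bar> * (pi / 2)" for x :: real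
proof -
  have "((\<lambda>t. x\<^sup>2 / (1 + x\<^sup>2 * t\<^sup>2)) has_integral (x * arctan (x * pi) - x * arctan (x * 0))) {0..pi}"
  proof (rule fundamental_theorem_of_calculus)
    fix t :: real
    have "((\<lambda>t. x * arctan (x * t)) has_real_derivative x\<^sup>2 / (1 + x\<^sup>2 * t\<^sup>2)) (at t within {0..pi})"
      by (auto intro!: derivative_eq_intros simp: power_mult_distrib power2_eq_square field_simps)
    then show "((\<lambda>t. x * arctan (x * t)) has_vector_derivative x\<^sup>2 / (1 + x\<^sup>2 * t\<^sup>2)) (at t within {0..pi})"
      by (simp add: has_real_derivative_iff_has_vector_derivative)
  qed simp
  then have "integral {0..pi} (\<lambda>t. x\<^sup>2 / (1 + x\<^sup>2 * t\<^sup>2)) = x * arctan (x * pi)"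
    by (simp add: integral_unique)
  also have "\<dots> \<le> \<bar>x\<bar> * \<bar>arctan (x * pi)\<bar>" by (metis abs_ge_self abs_mult)
  also have "\<dots> \<le> \<bar>x\<bar> * (pi / 2)"
    by (rule mult_left_mono) (use arctan_bounded[of "x * pi"] in auto)
  finally show ?thesis .
qed

lemma sym_sum_sublinear:
  assumes "0 < \<epsilon>"
  shows "\<exists>C\<ge>0. \<forall>N x. \<bar>sym_sum N x\<bar> \<le> \<epsilon> * \<bar>real_of_int x\<bar> + C"
proof -
  obtain C where C: "0 \<le> C"
    "\<And>x t. 0 \<le> t \<Longrightarrow> t \<le> pi \<Longrightarrow> (1 - cos (t * x)) / cos_defect p t \<le> \<epsilon> * (x\<^sup>2 / (1 + x\<^sup>2 * t\<^sup>2)) + C"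
    using kernel_majorant[OF assms] by metis
  have "\<bar>sym_sum N x\<bar> \<le> \<epsilon> * \<bar>real_of_int x\<bar> + 2 * C" for N x
  proof -
    let ?x = "real_of_int x"
    let ?f = "\<lambda>t. Re (\<Sum>n<N. \<psi> t ^ n) * (1 - cos (t * ?x))"
    let ?h = "\<lambda>t. 2 * \<epsilon> * (?x\<^sup>2 / (1 + ?x\<^sup>2 * t\<^sup>2)) + 2 * C"
    have pos: "1 + ?x\<^sup>2 * t\<^sup>2 > 0" for t :: real by (simp add: add_pos_nonneg)
    have ic: "(\<lambda>t. ?x\<^sup>2 / (1 + ?x\<^sup>2 * t\<^sup>2)) integrable_on {0..pi}"
      by (intro integrable_continuous_real continuous_intros) (metis pos less_irrefl)
    have hi: "(?h has_integral (2 * \<epsilon> * integral {0..pi} (\<lambda>t. ?x\<^sup>2 / (1 + ?x\<^sup>2 * t\<^sup>2)) + 2 * C * pi)) {0..pi}"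
      using has_integral_add[OF has_integral_mult_right[OF integrable_integral[OF ic], of "2 * \<epsilon>"]
          has_integral_const_real[of "2 * C" 0 pi]] by (simp add: mult.commute[of pi])
    have "norm (integral {0..pi} ?f) \<le> integral {0..pi} ?h"
    proof (rule integral_norm_bound_integral)
      show "?f integrable_on {0..pi}"
        by (intro integrable_continuous_real continuous_intros continuous_on_charfun)
      show "?h integrable_on {0..pi}"
        by (rule has_integral_integrable[OF hi])
      show "norm (?f t) \<le> ?h t" if "t \<in> {0..pi}" for t
      proof -
        have "norm (?f t) \<le> 2 * ((1 - cos (t * ?x)) / cos_defect p t)"
          unfolding real_norm_def by (rule geometric_factor_le) (use that in auto)
        also have "\<dots> \<le> 2 * (\<epsilon> * (?x\<^sup>2 / (1 + ?x\<^sup>2 * t\<^sup>2)) + C)"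
          by (rule mult_left_mono) (use C(2)[of t ?x] that in auto)
        finally show ?thesis by (simp only: distrib_left mult.assoc)
      qed
    qed
    also have "integral {0..pi} ?h = 2 * \<epsilon> * integral {0..pi} (\<lambda>t. ?x\<^sup>2 / (1 + ?x\<^sup>2 * t\<^sup>2)) + 2 * C * pi"
      by (rule integral_unique[OF hi])
    also have "\<dots> \<le> 2 * \<epsilon> * (\<bar>?x\<bar> * (pi / 2)) + 2 * C * pi"
      using integral_majorant[of ?x] assms by simp
    also have "\<dots> = (\<epsilon> * \<bar>?x\<bar> + 2 * C) * pi" by (simp add: algebra_simps)
    finally show ?thesis
      unfolding sym_sum_integral by (simp add: field_simps)
  qed
  then show ?thesis using C(1) by (intro exI[of _ "2 * C"]) simp
qed

lemma sym_sum_tendsto: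
  "set_integrable lborel {0..pi} (\<lambda>t. re_kernel t * (1 - cos (t * real_of_int x)))" (is ?A)
  "(\<lambda>N. sym_sum N x) \<longlonglongrightarrow> (LBINT t:{0..pi}. re_kernel t * (1 - cos (t * real_of_int x))) / pi" (is ?B)
proof -
  let ?x = "real_of_int x"
  obtain C where C: "0 \<le> C"
    "\<And>x t. 0 \<le> t \<Longrightarrow> t \<le> pi \<Longrightarrow> (1 - cos (t * x)) / cos_defect p t \<le> 1 * (x\<^sup>2 / (1 + x\<^sup>2 * t\<^sup>2)) + C"
    using kernel_majorant[OF zero_less_one] by metis
  define D where "D = ?x\<^sup>2 + C"
  have bound: "(1 - cos (t * ?x)) / cos_defect p t \<le> D" if "0 \<le> t" "t \<le> pi" for t
  proof -
    have "?x\<^sup>2 / (1 + ?x\<^sup>2 * t\<^sup>2) \<le> ?x\<^sup>2 / 1" by (rule divide_left_mono) (auto simp: add_pos_nonneg)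
    with C(2)[OF that, of ?x] show ?thesis by (simp add: D_def)
  qed
  have D: "0 \<le> D" using C(1) by (simp add: D_def)
  have [measurable]: "cos_defect p \<in> borel_measurable borel" "sin_mean p \<in> borel_measurable borel" "\<psi> \<in> borel_measurable borel"
    by (rule borel_measurable_continuous_onI continuous_on_cos_defect continuous_on_sin_mean continuous_on_charfun)+
  have [measurable]: "re_kernel \<in> borel_measurable borel" unfolding re_kernel_def by measurable
  let ?s = "\<lambda>N t. indicator {0..pi} t * (Re (\<Sum>n<N. \<psi> t ^ n) * (1 - cos (t * ?x)))"
  let ?f = "\<lambda>t. indicator {0..pi} t * (re_kernel t * (1 - cos (t * ?x)))"
  obtain z1 z2 where z: "z1 \<in> set_pmf p" "z2 \<in> set_pmf p" "z1 \<noteq> z2" by (rule support_not_singleton)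
  have lim: "AE t in lborel. (\<lambda>N. ?s N t) \<longlonglongrightarrow> ?f t"
    using AE_norm_charfun_less_1[OF z]
  proof eventually_elim
    case (elim t)
    then have "\<psi> t \<noteq> 1" by auto
    then have "(\<lambda>N. \<Sum>n<N. \<psi> t ^ n) = (\<lambda>N. (1 - \<psi> t ^ N) / (1 - \<psi> t))"
      by (auto simp: sum_gp_strict)
    moreover have "(\<lambda>N. (1 - \<psi> t ^ N) / (1 - \<psi> t)) \<longlonglongrightarrow> (1 - 0) / (1 - \<psi> t)"
      using elim by (intro tendsto_intros LIMSEQ_power_zero) auto
    ultimately have "(\<lambda>N. Re (\<Sum>n<N. \<psi> t ^ n)) \<longlonglongrightarrow> Re (1 / (1 - \<psi> t))"
      by (intro tendsto_Re) simp
    then show ?case unfolding Re_inverse_one_minus_charfun by (intro tendsto_intros)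
  qed
  have dom: "AE t in lborel. norm (?s N t) \<le> indicator {0..pi} t * (2 * D)" for N
  proof (rule AE_I2)
    fix t
    show "norm (?s N t) \<le> indicator {0..pi} t * (2 * D)"
    proof (cases "t \<in> {0..pi}")
      case True
      then have "\<bar>Re (\<Sum>n<N. \<psi> t ^ n) * (1 - cos (t * ?x))\<bar> \<le> 2 * ((1 - cos (t * ?x)) / cos_defect p t)"
        by (intro geometric_factor_le) auto
      also have "\<dots> \<le> 2 * D" using bound[of t] True by (intro mult_left_mono) auto
      finally show ?thesis using True by (simp only: real_norm_def abs_mult abs_of_nonneg indicator_simps)
    qed simp
  qed
  have int: "integrable lborel (\<lambda>t::real. indicator {0..pi} t * (2 * D))"
    by (intro integrable_mult_left integrable_real_indicator) auto
  have "integrable lborel ?f"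
    by (rule Bochner_Integration.integrable_dominated_convergence[OF _ _ int lim dom]) measurable
  then show ?A by (simp add: set_integrable_def)
  have "(\<lambda>N. integral\<^sup>L lborel (?s N)) \<longlonglongrightarrow> integral\<^sup>L lborel ?f"
    by (rule Bochner_Integration.integral_dominated_convergence[OF _ _ int lim dom]) measurable
  moreover have "integral\<^sup>L lborel (?s N) = integral {0..pi} (\<lambda>t. Re (\<Sum>n<N. \<psi> t ^ n) * (1 - cos (t * ?x)))" for N
  proof -
    have "set_integrable lborel {0..pi} (\<lambda>t. Re (\<Sum>n<N. \<psi> t ^ n) * (1 - cos (t * ?x)))"
      by (intro borel_integrable_atLeastAtMost' continuous_intros continuous_on_charfun)
    from set_borel_integral_eq_integral(2)[OF this] show ?thesis
      by (simp add: set_lebesgue_integral_def)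
  qed
  ultimately show ?B
    unfolding sym_sum_integral set_lebesgue_integral_def by (intro tendsto_divide) auto
qed

text \<open>The Green function of the walk stopped at time \<open>N\<close>, that is, the expected number of visits.\<close>

definition green_sum :: "nat \<Rightarrow> int \<Rightarrow> real" where
  "green_sum N x = (\<Sum>n<N. walk_prob p n x)"

definition potential_sum :: "nat \<Rightarrow> int \<Rightarrow> real" where
  "potential_sum N x = green_sum N 0 - green_sum N x"

lemma integrable_green_sum: "integrable p (\<lambda>k. green_sum N (f k))"
  unfolding green_sum_def
  by (intro Bochner_Integration.integrable_sum integrable_pmf_bounded[where B = 1])
    (use walk_prob_bounds in auto)

lemma green_sum_Suc: "green_sum (Suc N) x = of_bool (x = 0) + (\<integral>k. green_sum N (x - k) \<partial>p)"
proof -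
  have i: "integrable p (\<lambda>k. walk_prob p n (x - k))" for n
    by (rule integrable_pmf_bounded[where B = 1]) (use walk_prob_bounds in auto)
  have "green_sum (Suc N) x = walk_prob p 0 x + (\<Sum>n<N. walk_prob p (Suc n) x)"
    unfolding green_sum_def by (rule sum.lessThan_Suc_shift)
  also have "(\<Sum>n<N. walk_prob p (Suc n) x) = (\<integral>k. green_sum N (x - k) \<partial>p)"
    unfolding green_sum_def by (simp add: i)
  finally show ?thesis by simp
qed

lemma green_sum_mono: "green_sum N x \<le> green_sum (Suc N) x"
  unfolding green_sum_def using walk_prob_bounds by simp

text \<open>Maximum principle: away from \<open>0\<close> the function is an average of its predecessor.\<close>

lemma green_sum_le_at_0: "green_sum N x \<le> green_sum N 0"
proof (induction N arbitrary: x)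
  case 0 then show ?case by (simp add: green_sum_def)
next
  case (Suc N)
  show ?case
  proof (cases "x = 0")
    case False
    then have "green_sum (Suc N) x = (\<integral>k. green_sum N (x - k) \<partial>p)" by (simp add: green_sum_Suc)
    also have "\<dots> \<le> green_sum N 0"
      by (rule expectation_le_bound[OF integrable_green_sum]) (rule Suc)
    also have "\<dots> \<le> green_sum (Suc N) 0" by (rule green_sum_mono)
    finally show ?thesis .
  qed simp
qed

lemma potential_sum_nonneg: "0 \<le> potential_sum N x"
  unfolding potential_sum_def using green_sum_le_at_0[of N x] by simp

lemma potential_sum_symmetrized: "potential_sum N x + potential_sum N (- x) = 2 * sym_sum N x"
  unfolding potential_sum_def green_sum_def sym_sum_def
  by (induction N) (simp_all add: field_simps)

text \<open>Non-negativity lets the even part, which Fourier analysis controls, dominate the whole.\<close>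

lemma potential_sum_le: "potential_sum N x \<le> 2 * sym_sum N x"
  using potential_sum_symmetrized[of N x] potential_sum_nonneg[of N "- x"] by linarith

text \<open>Maximum principle for the increment, whose only positive source is at \<open>x = 0\<close>, where it equals a
  value of the partial sums of the potential.\<close>

lemma green_sum_increment_le:
  assumes "\<And>N. 2 * sym_sum N z \<le> C"
  shows "green_sum N x - green_sum N (x + z) \<le> C"
proof (induction N arbitrary: x)
  case 0
  have "0 \<le> C" using assms[of 0] by (simp add: sym_sum_def)
  then show ?case by (simp add: green_sum_def)
next
  case (Suc N)
  show ?case
  proof (cases "x = 0")
    case True
    then show ?thesis using potential_sum_le[of "Suc N" z] assms[of "Suc N"] by (simp add: potential_sum_def)
  next
    case False
    have "green_sum (Suc N) x - green_sum (Suc N) (x + z)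
        \<le> (\<integral>k. green_sum N (x - k) \<partial>p) - (\<integral>k. green_sum N (x + z - k) \<partial>p)"
      using False by (simp add: green_sum_Suc)
    also have "\<dots> = (\<integral>k. green_sum N (x - k) - green_sum N (x - k + z) \<partial>p)"
      by (subst Bochner_Integration.integral_diff[OF integrable_green_sum integrable_green_sum])
        (simp add: algebra_simps)
    also have "\<dots> \<le> C"
      by (rule expectation_le_bound) (intro Bochner_Integration.integrable_diff integrable_green_sum Suc)+
    finally show ?thesis .
  qed
qed

lemma potential_sum_avg:
  "(\<integral>k. potential_sum N (x - k) \<partial>p) = potential_sum N x + of_bool (x = 0) - walk_prob p N x"
proof -
  have "(\<integral>k. potential_sum N (x - k) \<partial>p) = green_sum N 0 - (\<integral>k. green_sum N (x - k) \<partial>p)"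
    unfolding potential_sum_def
    by (subst Bochner_Integration.integral_diff[OF _ integrable_green_sum]) (simp_all add: measure_pmf.prob_space)
  also have "(\<integral>k. green_sum N (x - k) \<partial>p) = green_sum N x + walk_prob p N x - of_bool (x = 0)"
    using green_sum_Suc[of N x] by (simp add: green_sum_def)
  finally show ?thesis by (simp add: potential_sum_def)
qed

lemma potential_sum_le_double: "sym_sum N x \<le> B \<Longrightarrow> potential_sum N x \<le> 2 * B"
  using potential_sum_le[of N x] by linarith

text \<open>Both limits solve the same Poisson equation, so their difference \<open>h\<close> is harmonic. The increments
  of \<open>h\<close> are bounded and harmonic, hence constant, so \<open>h\<close> is linear; sublinear growth makes it zero.\<close>

lemma subsequential_limits_agree:
  assumes r: "strict_mono (r :: nat \<Rightarrow> nat)" and b: "\<And>x. (\<lambda>n. potential_sum (r n) x) \<longlonglongrightarrow> b x"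
    and r': "strict_mono (r' :: nat \<Rightarrow> nat)" and b': "\<And>x. (\<lambda>n. potential_sum (r' n) x) \<longlonglongrightarrow> b' x"
  shows "b x = b' x"
proof -
  obtain z1 z2 where z: "z1 \<in> set_pmf p" "z2 \<in> set_pmf p" "z1 \<noteq> z2" by (rule support_not_singleton)
  obtain C where C: "0 \<le> C" "\<And>N x. sym_sum N x \<le> \<bar>real_of_int x\<bar> + C"
    using sym_sum_sublinear[OF zero_less_one] by (metis abs_le_D1 mult_1)
  have upper: "potential_sum N x \<le> 2 * (\<bar>real_of_int x\<bar> + C)" for N x
    by (rule potential_sum_le_double[OF C(2)])
  have eq: "(\<integral>k. c (x - k) \<partial>p) = c x + of_bool (x = 0) \<and> integrable p (\<lambda>k. c (x - k))"
    if s: "strict_mono (s :: nat \<Rightarrow> nat)" and c: "\<And>x. (\<lambda>n. potential_sum (s n) x) \<longlonglongrightarrow> c x" for s c x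
  proof -
    let ?w = "\<lambda>k. 2 * (\<bar>real_of_int x\<bar> + \<bar>real_of_int k\<bar> + C)"
    have w: "integrable p ?w"
      using integrable_step by (intro integrable_mult_right Bochner_Integration.integrable_add integrable_abs) auto
    have lim: "AE k in p. (\<lambda>n. potential_sum (s n) (x - k)) \<longlonglongrightarrow> c (x - k)" using c by simp
    have dom: "AE k in p. norm (potential_sum (s n) (x - k)) \<le> ?w k" for n
    proof (rule AE_I2)
      fix k
      show "norm (potential_sum (s n) (x - k)) \<le> ?w k"
        using upper[of "s n" "x - k"] potential_sum_nonneg[of "s n" "x - k"]
          abs_triangle_ineq4[of "real_of_int x" "real_of_int k"] by simp
    qed
    have l1: "(\<lambda>n. \<integral>k. potential_sum (s n) (x - k) \<partial>p) \<longlonglongrightarrow> (\<integral>k. c (x - k) \<partial>p)"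
      by (rule Bochner_Integration.integral_dominated_convergence[OF _ _ w lim dom]) auto
    have "(\<lambda>n. walk_prob p (s n) x) \<longlonglongrightarrow> 0"
      using LIMSEQ_subseq_LIMSEQ[OF walk_prob_tendsto_0[OF z] s] by (simp add: o_def)
    then have "(\<lambda>n. potential_sum (s n) x + of_bool (x = 0) - walk_prob p (s n) x) \<longlonglongrightarrow> c x + of_bool (x = 0) - 0"
      by (intro tendsto_diff tendsto_add tendsto_const c)
    then have "(\<integral>k. c (x - k) \<partial>p) = c x + of_bool (x = 0)"
      using LIMSEQ_unique[OF l1] by (simp add: potential_sum_avg)
    moreover have "integrable p (\<lambda>k. c (x - k))"
      by (rule Bochner_Integration.integrable_dominated_convergence[OF _ _ w lim dom]) auto
    ultimately show ?thesis by blast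
  qed
  define h where "h x = b x - b' x" for x
  have h_harm: "(\<integral>k. h (x - k) \<partial>p) = h x \<and> integrable p (\<lambda>k. h (x - k))" for x
    using eq[OF r b, of x] eq[OF r' b', of x] by (simp add: h_def)
  define g where "g x = h (x + 1) - h x" for x
  have incr: "\<bar>c (x + 1) - c x\<bar> \<le> 2 * (1 + C)"
    if c: "\<And>x. (\<lambda>n. potential_sum (s n) x) \<longlonglongrightarrow> c x" for s c x
  proof -
    have "\<bar>potential_sum N (x + 1) - potential_sum N x\<bar> \<le> 2 * (1 + C)" for N
    proof -
      have "2 * sym_sum N 1 \<le> 2 * (1 + C)" "2 * sym_sum N (- 1) \<le> 2 * (1 + C)" for N
        using C(2)[of N 1] C(2)[of N "- 1"] by simp_all
      from green_sum_increment_le[OF this(1), of N x] green_sum_increment_le[OF this(2), of N "x + 1"]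
      show ?thesis by (simp add: potential_sum_def)
    qed
    moreover have "(\<lambda>n. \<bar>potential_sum (s n) (x + 1) - potential_sum (s n) x\<bar>) \<longlonglongrightarrow> \<bar>c (x + 1) - c x\<bar>"
      by (intro tendsto_intros c)
    ultimately show ?thesis by (intro LIMSEQ_le_const2) auto
  qed
  have g_bound: "\<bar>g x\<bar> \<le> 4 * (1 + C)" for x
    using incr[OF b, of x] incr[OF b', of x] unfolding g_def h_def by linarith
  have g_harm: "avg p g x = g x" for x
    using h_harm[of "x + 1"] h_harm[of x] unfolding avg_def g_def
    by (simp add: algebra_simps)
  have g_const: "g y = g 0" for y
    by (rule bounded_harmonic_constant[OF irreducible g_bound g_harm])
  have pot0: "potential_sum N 0 = 0" for N by (simp add: potential_sum_def)
  have h0: "h 0 = 0"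
    using b[of 0] b'[of 0] by (simp add: h_def pot0 LIMSEQ_const_iff)
  have h_nat: "h (int n) = real n * g 0" for n
  proof (induction n)
    case (Suc n)
    then show ?case using g_const[of "int n"] by (simp add: g_def algebra_simps)
  qed (simp add: h0)
  have h_neg: "h (- int n) = - real n * g 0" for n
  proof (induction n)
    case (Suc n)
    then show ?case using g_const[of "- int (Suc n)"] by (simp add: g_def algebra_simps)
  qed (simp add: h0)
  have "g 0 = 0"
  proof (rule ccontr)
    assume ne: "g 0 \<noteq> 0"
    then have e: "0 < \<bar>g 0\<bar> / 8" by simp
    obtain D where D: "0 \<le> D" "\<And>N x. sym_sum N x \<le> \<bar>g 0\<bar> / 8 * \<bar>real_of_int x\<bar> + D"
      using sym_sum_sublinear[OF e] by (metis abs_le_D1)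
    have bnd: "0 \<le> c x \<and> c x \<le> 2 * (\<bar>g 0\<bar> / 8 * \<bar>real_of_int x\<bar> + D)"
      if c: "\<And>x. (\<lambda>n. potential_sum (s n) x) \<longlonglongrightarrow> c x" for s c x
    proof
      show "0 \<le> c x" by (rule LIMSEQ_le_const[OF c]) (use potential_sum_nonneg in auto)
      have "potential_sum N x \<le> 2 * (\<bar>g 0\<bar> / 8 * \<bar>real_of_int x\<bar> + D)" for N
        by (rule potential_sum_le_double[OF D(2)])
      then show "c x \<le> 2 * (\<bar>g 0\<bar> / 8 * \<bar>real_of_int x\<bar> + D)"
        by (intro LIMSEQ_le_const2[OF c]) auto
    qed
    have "real n * \<bar>g 0\<bar> \<le> real n * (\<bar>g 0\<bar> / 4) + 2 * D" for n
    proof -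
      have "\<bar>h (int n)\<bar> \<le> 2 * (\<bar>g 0\<bar> / 8 * real n + D)"
        using bnd[OF b, of "int n"] bnd[OF b', of "int n"] unfolding h_def by (intro abs_leI) simp_all
      then show ?thesis unfolding h_nat by (simp add: abs_mult algebra_simps)
    qed
    note upper_line = this
    have "0 < 3 / 4 * \<bar>g 0\<bar>" using ne by simp
    then obtain n where "2 * D < real n * (3 / 4 * \<bar>g 0\<bar>)"
      using reals_Archimedean3 by blast
    with upper_line[of n] show False by (simp add: algebra_simps)
  qed
  then have "h x = 0"
    using h_nat[of "nat x"] h_neg[of "nat (- x)"] by (cases "x \<ge> 0") auto
  then show ?thesis by (simp add: h_def)
qed

lemma potential_sum_convergent: "convergent (\<lambda>N. potential_sum N x)"
proof -
  obtain C where C: "0 \<le> C" "\<And>N x. sym_sum N x \<le> \<bar>real_of_int x\<bar> + C"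
    using sym_sum_sublinear[OF zero_less_one] by (metis abs_le_D1 mult_1)
  have bound: "\<bar>potential_sum N x\<bar> \<le> 2 * (\<bar>real_of_int x\<bar> + C)" for N x
    using potential_sum_le_double[OF C(2), of N x] potential_sum_nonneg[of N x] by simp
  obtain b r where r: "strict_mono (r :: nat \<Rightarrow> nat)" and b: "\<And>x. (\<lambda>n. potential_sum (r n) x) \<longlonglongrightarrow> b x"
    using pointwise_convergent_subsequence[of potential_sum, OF bound] by auto
  have "(\<lambda>N. potential_sum N x) \<longlonglongrightarrow> b x"
  proof (rule ccontr)
    assume "\<not> ?thesis"
    then obtain e where e: "0 < e" "\<And>N0. \<exists>N\<ge>N0. e \<le> dist (potential_sum N x) (b x)"
      unfolding lim_sequentially by (auto simp: not_less)
    define Q where "Q N \<longleftrightarrow> e \<le> dist (potential_sum N x) (b x)" for N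
    have inf: "infinite {N. Q N}"
      unfolding infinite_nat_iff_unbounded_le using e(2) by (auto simp: Q_def)
    define s where "s = enumerate {N. Q N}"
    have s: "strict_mono s" "\<And>n. Q (s n)"
      using strict_mono_enumerate[OF inf] enumerate_in_set[OF inf] by (auto simp: s_def)
    obtain b' r' where r': "strict_mono (r' :: nat \<Rightarrow> nat)"
      and b': "\<And>x. (\<lambda>n. potential_sum (s (r' n)) x) \<longlonglongrightarrow> b' x"
      using pointwise_convergent_subsequence[of "\<lambda>n. potential_sum (s n)", OF bound] by auto
    have "b' x = b x"
      by (rule subsequential_limits_agree[where r = "s \<circ> r'", OF strict_mono_o[OF s(1) r'] _ r b])
        (use b' in simp)
    then have "(\<lambda>n. dist (potential_sum (s (r' n)) x) (b x)) \<longlonglongrightarrow> 0"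
      using tendsto_dist[OF b'[of x] tendsto_const[of "b x"]] by simp
    moreover have "e \<le> dist (potential_sum (s (r' n)) x) (b x)" for n
      using s(2)[of "r' n"] by (simp add: Q_def)
    ultimately have "e \<le> 0" by (intro LIMSEQ_le_const) auto
    with e(1) show False by simp
  qed
  then show ?thesis by (rule convergentI)
qed

lemma summable_potential: "summable (\<lambda>n. walk_prob p n 0 - walk_prob p n x)"
  using potential_sum_convergent[of x]
  by (simp add: summable_iff_convergent potential_sum_def green_sum_def sum_subtractf)

definition green_kernel :: "int \<Rightarrow> real" where
  "green_kernel x = (LBINT t:{0..pi}. re_kernel t * (1 - cos (t * real_of_int x))) / pi"

lemma symmetrized_potential_eq:
  "((\<Sum>n. walk_prob p n 0 - walk_prob p n x) + (\<Sum>n. walk_prob p n 0 - walk_prob p n (- x))) / 2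
    = green_kernel x"
proof -
  have "(\<lambda>N. (\<Sum>n<N. walk_prob p n 0 - walk_prob p n y)) \<longlonglongrightarrow> (\<Sum>n. walk_prob p n 0 - walk_prob p n y)" for y
    by (rule summable_LIMSEQ[OF summable_potential])
  then have "(\<lambda>N. potential_sum N y) \<longlonglongrightarrow> (\<Sum>n. walk_prob p n 0 - walk_prob p n y)" for y
    by (simp add: potential_sum_def green_sum_def sum_subtractf)
  then have "(\<lambda>N. (potential_sum N x + potential_sum N (- x)) / 2) \<longlonglongrightarrow>
     ((\<Sum>n. walk_prob p n 0 - walk_prob p n x) + (\<Sum>n. walk_prob p n 0 - walk_prob p n (- x))) / 2"
    by (intro tendsto_intros) auto
  moreover have "(\<lambda>N. (potential_sum N x + potential_sum N (- x)) / 2) \<longlonglongrightarrow> green_kernel x"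
    unfolding potential_sum_symmetrized green_kernel_def using sym_sum_tendsto(2)[of x] by simp
  ultimately show ?thesis by (rule LIMSEQ_unique)
qed

end

section \<open>Concave primitives\<close>

text \<open>The two slope inequalities say that \<open>m\<close> is concave with supergradient \<open>\<eta>\<close>. They are used in place
  of \<open>m' = \<eta>\<close> because they are stable under taking expectations.\<close>

locale concave_primitive =
  fixes m \<eta> :: "real \<Rightarrow> real"
  assumes zero: "m 0 = 0"
    and slope_nonneg: "\<And>x. 0 \<le> x \<Longrightarrow> 0 \<le> \<eta> x"
    and slope_lower: "\<And>a b. 0 \<le> a \<Longrightarrow> a \<le> b \<Longrightarrow> (b - a) * \<eta> b \<le> m b - m a"
    and slope_upper: "\<And>a b. 0 \<le> a \<Longrightarrow> a \<le> b \<Longrightarrow> m b - m a \<le> (b - a) * \<eta> a"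
begin

lemma mono: "0 \<le> a \<Longrightarrow> a \<le> b \<Longrightarrow> m a \<le> m b"
  using slope_lower[of a b] slope_nonneg[of b] mult_nonneg_nonneg[of "b - a" "\<eta> b"] by linarith

lemma nonneg: "0 \<le> x \<Longrightarrow> 0 \<le> m x"
  using mono[of 0 x] zero by simp

lemma slope_le: "0 \<le> x \<Longrightarrow> x * \<eta> x \<le> m x"
  using slope_lower[of 0 x] zero by simp

lemma scale_le: assumes "0 \<le> x" "1 \<le> l" shows "m (l * x) \<le> l * m x"
proof -
  have "x \<le> l * x" using mult_right_mono[OF assms(2,1)] by simp
  then have "m (l * x) - m x \<le> (l * x - x) * \<eta> x" by (rule slope_upper[OF assms(1)])
  also have "\<dots> = (l - 1) * (x * \<eta> x)" by (simp add: algebra_simps)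
  also have "\<dots> \<le> (l - 1) * m x" by (rule mult_left_mono[OF slope_le]) (use assms in auto)
  finally show ?thesis by (simp add: algebra_simps)
qed

text \<open>Forwards, concavity gives \<open>m(2x) - m(x) \<le> x \<eta>(x)\<close>. Backwards, it gives
  \<open>x \<eta>(2x) \<le> m(2x) - m(x)\<close>, and \<open>m(x)\<close> is at least \<open>m(2x) / (2q)\<close>.\<close>

lemma slope_ratio_iff_doubling:
  assumes pos: "eventually (\<lambda>x. 0 < m x) at_top"
  shows "(\<exists>\<theta><1. eventually (\<lambda>x. x * \<eta> x / m x \<le> \<theta>) at_top)
    \<longleftrightarrow> (\<exists>q<1. eventually (\<lambda>x. m (2 * x) \<le> 2 * q * m x) at_top)"
proof
  assume "\<exists>\<theta><1. eventually (\<lambda>x. x * \<eta> x / m x \<le> \<theta>) at_top"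
  then obtain \<theta> where \<theta>: "\<theta> < 1" "eventually (\<lambda>x. x * \<eta> x / m x \<le> \<theta>) at_top" by blast
  have "eventually (\<lambda>x. m (2 * x) \<le> 2 * ((1 + \<theta>) / 2) * m x) at_top"
    using \<theta>(2) pos eventually_ge_at_top[of 0]
  proof eventually_elim
    case (elim x)
    then have "x * \<eta> x \<le> \<theta> * m x" by (simp add: divide_le_eq)
    moreover have "m (2 * x) - m x \<le> (2 * x - x) * \<eta> x" using elim by (intro slope_upper) auto
    ultimately show ?case by (simp add: algebra_simps)
  qed
  then show "\<exists>q<1. eventually (\<lambda>x. m (2 * x) \<le> 2 * q * m x) at_top"
    using \<theta>(1) by (intro exI[of _ "(1 + \<theta>) / 2"]) auto
next
  assume "\<exists>q<1. eventually (\<lambda>x. m (2 * x) \<le> 2 * q * m x) at_top"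
  then obtain q where q: "q < 1" "eventually (\<lambda>x. m (2 * x) \<le> 2 * q * m x) at_top" by blast
  define r where "r = max q (1 / 2)"
  have r: "r < 1" "0 < r" using q(1) by (auto simp: r_def)
  have "eventually (\<lambda>x. 2 * x * \<eta> (2 * x) / m (2 * x) \<le> 2 - 1 / r) at_top"
    using q(2) pos eventually_ge_at_top[of 0]
  proof eventually_elim
    case (elim x)
    have "m (2 * x) \<le> 2 * r * m x"
      by (rule order_trans[OF elim(1)]) (use elim in \<open>simp add: r_def\<close>)
    then have "m (2 * x) / (2 * r) \<le> m x" using r by (simp add: field_simps)
    moreover have "(2 * x - x) * \<eta> (2 * x) \<le> m (2 * x) - m x" using elim by (intro slope_lower) auto
    ultimately have "2 * (x * \<eta> (2 * x)) \<le> 2 * (m (2 * x) - m (2 * x) / (2 * r))" by simp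
    also have "\<dots> = (2 - 1 / r) * m (2 * x)" by (simp add: left_diff_distrib)
    finally have le: "2 * x * \<eta> (2 * x) \<le> (2 - 1 / r) * m (2 * x)" by simp
    moreover have "0 < m (2 * x)" using mono[of x "2 * x"] elim by simp
    ultimately show ?case by (simp add: divide_le_eq)
  qed
  then obtain X where X: "\<And>x. X \<le> x \<Longrightarrow> 2 * x * \<eta> (2 * x) / m (2 * x) \<le> 2 - 1 / r"
    by (auto simp: eventually_at_top_linorder)
  have "eventually (\<lambda>x. x * \<eta> x / m x \<le> 2 - 1 / r) at_top"
    using eventually_ge_at_top[of "2 * X"]
  proof eventually_elim
    case (elim x) then show ?case using X[of "x / 2"] by simp
  qed
  moreover have "2 - 1 / r < 1" using r by (simp add: field_simps)
  ultimately show "\<exists>\<theta><1. eventually (\<lambda>x. x * \<eta> x / m x \<le> \<theta>) at_top" by blast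
qed

end

lemma doubling_transfer:
  fixes m1 m2 :: "real \<Rightarrow> real"
  assumes q: "q < 1" "eventually (\<lambda>x. m1 (2 * x) \<le> 2 * q * m1 x) at_top"
    and pos: "eventually (\<lambda>x. 0 < m1 x) at_top" "eventually (\<lambda>x. 0 < m2 x) at_top"
    and lim: "((\<lambda>x. m1 x / m2 x) \<longlongrightarrow> L) at_top" "0 < L"
  shows "\<exists>q<1. eventually (\<lambda>x. m2 (2 * x) \<le> 2 * q * m2 x) at_top"
proof -
  \<comment> \<open>a positive bound is needed for the slack factor \<open>s > 1\<close> with \<open>r s < 1\<close>\<close>
  define r where "r = max q (1 / 2)"
  have r: "r < 1" "0 < r" "q \<le> r" using q(1) by (auto simp: r_def)
  define s where "s = (1 + 1 / r) / 2"
  have s: "1 < s" "r * s < 1" using r by (auto simp: s_def field_simps)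
  have two: "filterlim (\<lambda>x::real. 2 * x) at_top at_top"
    by (rule filterlim_tendsto_pos_mult_at_top[OF tendsto_const _ filterlim_ident]) auto
  have lim2: "((\<lambda>x. m1 (2 * x) / m2 (2 * x)) \<longlongrightarrow> L) at_top"
    by (rule filterlim_compose[OF lim(1) two])
  have "((\<lambda>x. (m1 x / m2 x) / (m1 (2 * x) / m2 (2 * x))) \<longlongrightarrow> L / L) at_top"
    by (intro tendsto_divide lim(1) lim2) (use lim(2) in auto)
  then have "eventually (\<lambda>x. (m1 x / m2 x) / (m1 (2 * x) / m2 (2 * x)) < s) at_top"
    using lim(2) s(1) by (intro order_tendstoD(2)[of _ 1]) auto
  moreover have "eventually (\<lambda>x. 0 < m1 (2 * x)) at_top" "eventually (\<lambda>x. 0 < m2 (2 * x)) at_top"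
    using pos two by (auto simp: filterlim_iff)
  ultimately have "eventually (\<lambda>x. m2 (2 * x) \<le> 2 * (r * s) * m2 x) at_top"
    using q(2) pos
  proof eventually_elim
    case (elim x)
    have "m1 x * m2 (2 * x) \<le> s * (m2 x * m1 (2 * x))"
      using elim by (simp add: field_simps)
    also have "\<dots> \<le> s * (m2 x * (2 * q * m1 x))"
      using elim s by (intro mult_left_mono) auto
    also have "\<dots> \<le> s * (m2 x * (2 * r * m1 x))"
      using elim s r by (intro mult_left_mono mult_right_mono) auto
    finally have "m1 x * m2 (2 * x) \<le> m1 x * (2 * (r * s) * m2 x)" by (simp add: mult_ac)
    then show ?case using elim by simp
  qed
  with s(2) show ?thesis by blast
qed

lemma slope_ratio_transfer:
  assumes "concave_primitive m1 \<eta>1" "concave_primitive m2 \<eta>2"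
    and pos: "eventually (\<lambda>x. 0 < m1 x) at_top" "eventually (\<lambda>x. 0 < m2 x) at_top"
    and lim: "((\<lambda>x. m1 x / m2 x) \<longlongrightarrow> L) at_top" "0 < L"
  shows "(\<exists>\<theta><1. eventually (\<lambda>x. x * \<eta>1 x / m1 x \<le> \<theta>) at_top)
    \<longleftrightarrow> (\<exists>\<theta><1. eventually (\<lambda>x. x * \<eta>2 x / m2 x \<le> \<theta>) at_top)"
proof -
  have "((\<lambda>x. inverse (m1 x / m2 x)) \<longlongrightarrow> inverse L) at_top"
    by (rule tendsto_inverse[OF lim(1)]) (use lim(2) in auto)
  then have "((\<lambda>x. m2 x / m1 x) \<longlongrightarrow> inverse L) at_top" "0 < inverse L"
    using lim(2) by simp_all
  note lim' = this
  have "\<exists>q<1. eventually (\<lambda>x. m2 (2 * x) \<le> 2 * q * m2 x) at_top"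
    if "q < 1" "eventually (\<lambda>x. m1 (2 * x) \<le> 2 * q * m1 x) at_top" for q
    by (rule doubling_transfer[OF that pos lim])
  moreover have "\<exists>q<1. eventually (\<lambda>x. m1 (2 * x) \<le> 2 * q * m1 x) at_top"
    if "q < 1" "eventually (\<lambda>x. m2 (2 * x) \<le> 2 * q * m2 x) at_top" for q
    by (rule doubling_transfer[OF that pos(2,1) lim'])
  ultimately show ?thesis
    unfolding concave_primitive.slope_ratio_iff_doubling[OF assms(1) pos(1)]
      concave_primitive.slope_ratio_iff_doubling[OF assms(2) pos(2)]
    by (intro iffI; elim exE conjE) assumption+
qed

section \<open>Truncated moments of a non-negative function of the step\<close>

text \<open>The integral of \<open>(y - s)^+\<close> over \<open>s\<close> in \<open>[0, x]\<close>. Its mean is the function \<open>m\<close> of the walk, and the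
  mean of \<open>(y - x)^+\<close> is \<open>\<eta>\<close>.\<close>

definition trunc_half_square :: "real \<Rightarrow> real \<Rightarrow> real" where
  "trunc_half_square x y = (if y \<le> x then y\<^sup>2 / 2 else x * y - x\<^sup>2 / 2)"

definition tail_mean :: "int pmf \<Rightarrow> (int \<Rightarrow> real) \<Rightarrow> real \<Rightarrow> real" where
  "tail_mean p Y x = (\<integral>k. max 0 (Y k - x) \<partial>p)"

definition trunc_moment :: "int pmf \<Rightarrow> (int \<Rightarrow> real) \<Rightarrow> real \<Rightarrow> real" where
  "trunc_moment p Y x = (\<integral>k. trunc_half_square x (Y k) \<partial>p)"

lemma trunc_half_square_zero: "0 \<le> y \<Longrightarrow> trunc_half_square 0 y = 0"
  by (auto simp: trunc_half_square_def)

lemma trunc_half_square_minus: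
  "0 \<le> x \<Longrightarrow> 0 \<le> y \<Longrightarrow> trunc_half_square x y - x * max 0 (y - x) = (min x y)\<^sup>2 / 2"
  by (auto simp: trunc_half_square_def max_def min_def power2_eq_square algebra_simps)

lemma integral_positive_part:
  assumes "0 \<le> x" "0 \<le> y"
  shows "integral {0..x} (\<lambda>s. max 0 (y - s)) = trunc_half_square x y"
proof -
  have lin: "integral {0..z} (\<lambda>s. max 0 (y - s)) = z * y - z\<^sup>2 / 2" if "0 \<le> z" "z \<le> y" for z
  proof -
    have "((\<lambda>s. y - s) has_integral (y * z - z\<^sup>2 / 2 - (y * 0 - 0\<^sup>2 / 2))) {0..z}"
      by (rule fundamental_theorem_of_calculus)
        (use that in \<open>auto intro!: derivative_eq_intros simp flip: has_real_derivative_iff_has_vector_derivative\<close>)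
    then have "((\<lambda>s. max 0 (y - s)) has_integral (y * z - z\<^sup>2 / 2)) {0..z}"
      by (subst has_integral_cong[where g = "\<lambda>s. y - s"]) (use that in auto)
    then show ?thesis by (simp add: integral_unique mult.commute)
  qed
  show ?thesis
  proof (cases "y \<le> x")
    case True
    have "integral {0..x} (\<lambda>s. max 0 (y - s))
        = integral {0..y} (\<lambda>s. max 0 (y - s)) + integral {y..x} (\<lambda>s. max 0 (y - s))"
      by (rule Henstock_Kurzweil_Integration.integral_combine[symmetric])
        (use True assms in \<open>auto intro!: integrable_continuous_real continuous_intros\<close>)
    also have "integral {y..x} (\<lambda>s. max 0 (y - s)) = integral {y..x} (\<lambda>s. 0)"
      by (rule Henstock_Kurzweil_Integration.integral_cong) auto
    finally show ?thesis using lin[of y] True assms by (simp add: trunc_half_square_def power2_eq_square)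
  next
    case False
    then show ?thesis using lin[of x] assms by (simp add: trunc_half_square_def)
  qed
qed

lemma trunc_half_square_slope:
  assumes "0 \<le> a" "a \<le> b" "0 \<le> y"
  shows "(b - a) * max 0 (y - b) \<le> trunc_half_square b y - trunc_half_square a y"
    and "trunc_half_square b y - trunc_half_square a y \<le> (b - a) * max 0 (y - a)"
proof -
  have c: "continuous_on S (\<lambda>s. max 0 (y - s))" for S by (intro continuous_intros)
  have i: "(\<lambda>s. max 0 (y - s)) integrable_on {c..d}" for c d
    by (rule integrable_continuous_real[OF c])
  have "integral {0..b} (\<lambda>s. max 0 (y - s))
      = integral {0..a} (\<lambda>s. max 0 (y - s)) + integral {a..b} (\<lambda>s. max 0 (y - s))"
    by (rule Henstock_Kurzweil_Integration.integral_combine[symmetric]) (use assms i in auto)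
  then have eq: "trunc_half_square b y - trunc_half_square a y = integral {a..b} (\<lambda>s. max 0 (y - s))"
    using assms by (simp add: integral_positive_part)
  have "integral {a..b} (\<lambda>s. max 0 (y - b)) \<le> integral {a..b} (\<lambda>s. max 0 (y - s))"
    by (rule integral_le) (use i in auto)
  then show "(b - a) * max 0 (y - b) \<le> trunc_half_square b y - trunc_half_square a y"
    using assms eq by simp
  have "integral {a..b} (\<lambda>s. max 0 (y - s)) \<le> integral {a..b} (\<lambda>s. max 0 (y - a))"
    by (rule integral_le) (use i in auto)
  then show "trunc_half_square b y - trunc_half_square a y \<le> (b - a) * max 0 (y - a)"
    using assms eq by simp
qed

lemma trunc_half_square_bounds:
  assumes "0 \<le> x" "0 \<le> y" shows "0 \<le> trunc_half_square x y" "trunc_half_square x y \<le> x * y"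
proof -
  have "0 \<le> x * max 0 (y - x)" using assms by simp
  also have "\<dots> \<le> trunc_half_square x y"
    using trunc_half_square_slope(1)[of 0 x y] assms by (simp add: trunc_half_square_zero)
  finally show "0 \<le> trunc_half_square x y" .
  show "trunc_half_square x y \<le> x * y"
    using trunc_half_square_slope(2)[of 0 x y] assms by (simp add: trunc_half_square_zero)
qed

text \<open>For the positive and the negative part of the step this is \<open>\<beta>(t)\<close>.\<close>

abbreviation sin_defect :: "int pmf \<Rightarrow> (int \<Rightarrow> real) \<Rightarrow> real \<Rightarrow> real" where
  "sin_defect p Y t \<equiv> (\<integral>k. Y k - sin (t * Y k) / t \<partial>p)"

text \<open>The instances are the positive part, the negative part and the absolute value of the step.\<close>

locale nonneg_functional =
  fixes p :: "int pmf" and Y :: "int \<Rightarrow> real"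
  assumes Y_nonneg: "\<And>k. 0 \<le> Y k" and Y_int: "integrable p Y"
begin

lemma integrable_positive_part: "integrable p (\<lambda>k. max 0 (Y k - x))"
  by (intro integrable_max Bochner_Integration.integrable_diff Y_int) auto

lemma integrable_trunc: assumes "0 \<le> x" shows "integrable p (\<lambda>k. trunc_half_square x (Y k))"
proof (rule Bochner_Integration.integrable_bound[where f = "\<lambda>k. x * Y k"])
  show "AE k in p. norm (trunc_half_square x (Y k)) \<le> norm (x * Y k)"
    using trunc_half_square_bounds[OF assms Y_nonneg] Y_nonneg assms by simp
qed (use Y_int in auto)

sublocale concave_primitive "trunc_moment p Y" "tail_mean p Y"
proof
  show "trunc_moment p Y 0 = 0" by (simp add: trunc_moment_def trunc_half_square_zero Y_nonneg)
  show "0 \<le> tail_mean p Y x" for x unfolding tail_mean_def by (rule integral_nonneg_AE) auto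
  fix a b :: real assume ab: "0 \<le> a" "a \<le> b"
  have i: "integrable p (\<lambda>k. trunc_half_square a (Y k))" "integrable p (\<lambda>k. trunc_half_square b (Y k))"
    using integrable_trunc ab by auto
  have diff: "trunc_moment p Y b - trunc_moment p Y a = (\<integral>k. trunc_half_square b (Y k) - trunc_half_square a (Y k) \<partial>p)"
    unfolding trunc_moment_def using i by simp
  have "(b - a) * tail_mean p Y b = (\<integral>k. (b - a) * max 0 (Y k - b) \<partial>p)" by (simp add: tail_mean_def)
  also have "\<dots> \<le> (\<integral>k. trunc_half_square b (Y k) - trunc_half_square a (Y k) \<partial>p)"
    by (rule integral_mono)
      (use trunc_half_square_slope(1)[OF ab Y_nonneg] i integrable_positive_part in auto)
  finally show "(b - a) * tail_mean p Y b \<le> trunc_moment p Y b - trunc_moment p Y a" unfolding diff .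
  have "(\<integral>k. trunc_half_square b (Y k) - trunc_half_square a (Y k) \<partial>p) \<le> (\<integral>k. (b - a) * max 0 (Y k - a) \<partial>p)"
    by (rule integral_mono)
      (use trunc_half_square_slope(2)[OF ab Y_nonneg] i integrable_positive_part in auto)
  also have "\<dots> = (b - a) * tail_mean p Y a" by (simp add: tail_mean_def)
  finally show "trunc_moment p Y b - trunc_moment p Y a \<le> (b - a) * tail_mean p Y a" unfolding diff .
qed

lemma integral_tail_mean:
  assumes "0 \<le> x" shows "integral {0..x} (tail_mean p Y) = trunc_moment p Y x"
proof -
  have "integral {0..x} (\<lambda>s. \<integral>k. max 0 (Y k - s) \<partial>p) = (\<integral>k. integral {0..x} (\<lambda>s. max 0 (Y k - s)) \<partial>p)"
    by (rule expectation_integral_swap[where B = Y])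
      (use assms Y_nonneg Y_int in \<open>auto intro!: continuous_intros\<close>)
  then show ?thesis unfolding tail_mean_def trunc_moment_def
    using assms by (simp add: integral_positive_part Y_nonneg)
qed

lemma continuous_on_tail_mean: "continuous_on {0..} (tail_mean p Y)"
  unfolding tail_mean_def
  by (rule continuous_on_expectation[where B = Y])
    (use Y_nonneg Y_int in \<open>auto intro!: continuous_intros\<close>)

lemma trunc_moment_minus_tail:
  assumes "0 \<le> x"
  shows "trunc_moment p Y x - x * tail_mean p Y x = (\<integral>k. (min x (Y k))\<^sup>2 \<partial>p) / 2"
proof -
  have "trunc_moment p Y x - x * tail_mean p Y x = (\<integral>k. trunc_half_square x (Y k) - x * max 0 (Y k - x) \<partial>p)"
    unfolding trunc_moment_def tail_mean_def
    using integrable_trunc[OF assms] integrable_positive_part by simp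
  also have "\<dots> = (\<integral>k. (min x (Y k))\<^sup>2 / 2 \<partial>p)"
    using assms Y_nonneg by (simp add: trunc_half_square_minus)
  finally show ?thesis by simp
qed

lemma trunc_moment_over_x: "((\<lambda>x. trunc_moment p Y x / x) \<longlongrightarrow> 0) at_top"
proof -
  have "((\<lambda>x. \<integral>k. trunc_half_square x (Y k) / x \<partial>p) \<longlongrightarrow> (\<integral>k. 0 \<partial>p)) at_top"
  proof (rule integral_dominated_convergence_at_top[where w = Y])
    show "AE k in p. ((\<lambda>x. trunc_half_square x (Y k) / x) \<longlongrightarrow> 0) at_top"
    proof (rule AE_I2)
      fix k
      have "((\<lambda>x. ((Y k)\<^sup>2 / 2) / x) \<longlongrightarrow> 0) at_top"
        by (rule real_tendsto_divide_at_top[OF tendsto_const filterlim_ident])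
      moreover have "eventually (\<lambda>x. ((Y k)\<^sup>2 / 2) / x = trunc_half_square x (Y k) / x) at_top"
        using eventually_ge_at_top[of "Y k"] by eventually_elim (simp add: trunc_half_square_def)
      ultimately show "((\<lambda>x. trunc_half_square x (Y k) / x) \<longlongrightarrow> 0) at_top"
        by (rule Lim_transform_eventually)
    qed
    show "eventually (\<lambda>x. AE k in p. norm (trunc_half_square x (Y k) / x) \<le> Y k) at_top"
      using eventually_gt_at_top[of 0]
    proof eventually_elim
      case (elim x)
      then show ?case
        using trunc_half_square_bounds[of x] Y_nonneg by (intro AE_I2) (simp add: pos_divide_le_eq mult.commute[of _ x])
    qed
  qed (use Y_int in auto)
  then show ?thesis by (simp add: trunc_moment_def)
qed

end

section \<open>The sine transform of the tail difference\<close>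

lemma trunc_half_square_eq: "trunc_half_square x y = (y\<^sup>2 - (max 0 (y - x))\<^sup>2) / 2"
  by (auto simp: trunc_half_square_def max_def power2_eq_square algebra_simps)

lemma trunc_half_square_below: "s \<le> y \<Longrightarrow> trunc_half_square s y = s * y - s\<^sup>2 / 2"
  unfolding trunc_half_square_eq by (simp add: power2_diff field_simps)

text \<open>Two integrations by parts of \<open>1 - cos ty\<close> against the tail. The choice \<open>cos tx = 0\<close> removes the
  boundary term \<open>(y - x)^+\<close>, which is not small compared with \<open>m(x) / x\<close>. What is left over lives on \<open>y \<ge> x\<close>
  and is at most \<open>2/t\<close>.\<close>

lemma integral_cos_trunc_half_square:
  fixes t x y :: real
  assumes t: "0 < t" and x: "0 < x" "cos (t * x) = 0" "sin (t * x) = 1" and y: "0 \<le> y"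
  shows "y - sin (t * y) / t = t * trunc_half_square x y
     - t\<^sup>2 * integral {0..x} (\<lambda>s. cos (t * s) * trunc_half_square s y)
     + (if x \<le> y then (1 - sin (t * y)) / t else 0)"
proof -
  define A where "A s = sin (t * s) / t * (s * y - s\<^sup>2 / 2) + cos (t * s) / t\<^sup>2 * (y - s) + sin (t * s) / t ^ 3" for s
  have lin: "integral {0..z} (\<lambda>s. cos (t * s) * trunc_half_square s y) = A z - y / t\<^sup>2"
    if "0 \<le> z" "z \<le> y" for z
  proof -
    have "(A has_real_derivative cos (t * s) * (s * y - s\<^sup>2 / 2)) (at s within S)" for s S
      unfolding A_def using t
      by (auto intro!: derivative_eq_intros simp: field_simps power2_eq_square power3_eq_cube)
    then have "((\<lambda>s. cos (t * s) * (s * y - s\<^sup>2 / 2)) has_integral (A z - A 0)) {0..z}"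
      by (intro fundamental_theorem_of_calculus)
        (use that in \<open>auto simp flip: has_real_derivative_iff_has_vector_derivative\<close>)
    then have "((\<lambda>s. cos (t * s) * trunc_half_square s y) has_integral (A z - A 0)) {0..z}"
      by (subst has_integral_cong[where g = "\<lambda>s. cos (t * s) * (s * y - s\<^sup>2 / 2)"])
        (use that in \<open>auto simp: trunc_half_square_below\<close>)
    then show ?thesis by (simp add: integral_unique A_def)
  qed
  show ?thesis
  proof (cases "x \<le> y")
    case True
    have I: "integral {0..x} (\<lambda>s. cos (t * s) * trunc_half_square s y) = (x * y - x\<^sup>2 / 2) / t + 1 / t ^ 3 - y / t\<^sup>2"
      using lin[of x] True x by (simp add: A_def)
    show ?thesis unfolding I trunc_half_square_below[OF True] using True t
      by (simp add: field_simps power2_eq_square power3_eq_cube)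
  next
    case False
    have c: "continuous_on S (\<lambda>s. cos (t * s) * trunc_half_square s y)" for S
      unfolding trunc_half_square_eq by (intro continuous_intros) auto
    have "integral {0..x} (\<lambda>s. cos (t * s) * trunc_half_square s y)
       = integral {0..y} (\<lambda>s. cos (t * s) * trunc_half_square s y) + integral {y..x} (\<lambda>s. cos (t * s) * trunc_half_square s y)"
      by (rule Henstock_Kurzweil_Integration.integral_combine[symmetric])
        (use False y in \<open>auto intro!: integrable_continuous_real c\<close>)
    also have "integral {0..y} (\<lambda>s. cos (t * s) * trunc_half_square s y) = A y - y / t\<^sup>2"
      by (rule lin) (use y in auto)
    also have "integral {y..x} (\<lambda>s. cos (t * s) * trunc_half_square s y) = y\<^sup>2 / 2 * (1 - sin (t * y)) / t"
    proof -
      have "((\<lambda>s. cos (t * s) * (y\<^sup>2 / 2)) has_integral (sin (t * x) / t * (y\<^sup>2 / 2) - sin (t * y) / t * (y\<^sup>2 / 2))) {y..x}"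
        by (rule fundamental_theorem_of_calculus)
          (use False t in \<open>auto intro!: derivative_eq_intros simp flip: has_real_derivative_iff_has_vector_derivative\<close>)
      then have "((\<lambda>s. cos (t * s) * trunc_half_square s y) has_integral (sin (t * x) / t * (y\<^sup>2 / 2) - sin (t * y) / t * (y\<^sup>2 / 2))) {y..x}"
        by (subst has_integral_cong[where g = "\<lambda>s. cos (t * s) * (y\<^sup>2 / 2)"])
          (auto simp: trunc_half_square_def)
      then show ?thesis using x t by (simp add: integral_unique field_simps)
    qed
    also have "A y = sin (t * y) / t * (y\<^sup>2 / 2) + sin (t * y) / t ^ 3"
      by (simp add: A_def power2_eq_square)
    finally have I: "integral {0..x} (\<lambda>s. cos (t * s) * trunc_half_square s y)
      = sin (t * y) / t * (y\<^sup>2 / 2) + sin (t * y) / t ^ 3 - y / t\<^sup>2 + y\<^sup>2 / 2 * (1 - sin (t * y)) / t" .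
    have G: "trunc_half_square x y = y\<^sup>2 / 2" using False by (simp add: trunc_half_square_def)
    show ?thesis unfolding I G using False t
      by (simp add: field_simps power2_eq_square power3_eq_cube)
  qed
qed

context nonneg_functional
begin

lemma integrable_sin_defect: "integrable p (\<lambda>k. Y k - sin (t * Y k) / t)"
  by (intro Bochner_Integration.integrable_diff Y_int integrable_divide integrable_sin)

lemma continuous_on_trunc_moment: "continuous_on {0..x} (trunc_moment p Y)"
proof (cases "0 \<le> x")
  case True
  show ?thesis unfolding trunc_moment_def
  proof (rule continuous_on_expectation[where B = "\<lambda>k. x * Y k"])
    show "continuous_on {0..x} (\<lambda>s. trunc_half_square s (Y k))" for k
      unfolding trunc_half_square_eq by (intro continuous_intros) auto
    show "norm (trunc_half_square s (Y k)) \<le> x * Y k" if "s \<in> {0..x}" for k s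
    proof -
      have "trunc_half_square s (Y k) \<le> s * Y k" "0 \<le> trunc_half_square s (Y k)"
        using trunc_half_square_bounds[of s "Y k"] that Y_nonneg by auto
      moreover have "s * Y k \<le> x * Y k" using that Y_nonneg by (intro mult_right_mono) auto
      ultimately show ?thesis by simp
    qed
  qed (use Y_int in auto)
qed simp

text \<open>The remainder is at most \<open>2/t\<close> times the probability that \<open>Y \<ge> x\<close>, and by truncation
  \<open>m(x) \<ge> P[Y \<ge> x] x^2 / 2\<close>.\<close>

lemma sin_defect_approx:
  assumes t: "0 < t" and x: "0 < x" "cos (t * x) = 0" "sin (t * x) = 1"
  shows "\<bar>sin_defect p Y t
    - (t * trunc_moment p Y x - t\<^sup>2 * integral {0..x} (\<lambda>s. cos (t * s) * trunc_moment p Y s))\<bar>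
    \<le> 4 / (t * x\<^sup>2) * trunc_moment p Y x"
proof -
  let ?r = "\<lambda>k. if x \<le> Y k then (1 - sin (t * Y k)) / t else 0"
  let ?J = "\<lambda>k. integral {0..x} (\<lambda>s. cos (t * s) * trunc_half_square s (Y k))"
  have swap: "integral {0..x} (\<lambda>s. \<integral>k. cos (t * s) * trunc_half_square s (Y k) \<partial>p) = (\<integral>k. ?J k \<partial>p)"
  proof (rule expectation_integral_swap[where B = "\<lambda>k. x * Y k"])
    show "continuous_on {0..x} (\<lambda>s. cos (t * s) * trunc_half_square s (Y k))" for k
      unfolding trunc_half_square_eq by (intro continuous_intros) auto
    show "norm (cos (t * s) * trunc_half_square s (Y k)) \<le> x * Y k" if "s \<in> {0..x}" for k s
    proof -
      have b: "trunc_half_square s (Y k) \<le> s * Y k" "0 \<le> trunc_half_square s (Y k)"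
        using trunc_half_square_bounds[of s "Y k"] that Y_nonneg by auto
      have "norm (cos (t * s) * trunc_half_square s (Y k)) \<le> 1 * trunc_half_square s (Y k)"
        unfolding norm_mult using b(2) by (intro mult_mono) auto
      also have "\<dots> \<le> x * Y k"
        using b(1) mult_right_mono[of s x "Y k"] that Y_nonneg by auto
      finally show ?thesis .
    qed
  qed (use Y_int x in auto)
  have swap': "integral {0..x} (\<lambda>s. cos (t * s) * trunc_moment p Y s) = (\<integral>k. ?J k \<partial>p)"
    using swap by (simp add: trunc_moment_def)
  have r_bound: "0 \<le> ?r k" "?r k \<le> 2 / t" "?r k \<le> 4 / (t * x\<^sup>2) * trunc_half_square x (Y k)" for k
  proof -
    have s: "0 \<le> 1 - sin (t * Y k)" "1 - sin (t * Y k) \<le> 2"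
      using sin_le_one[of "t * Y k"] sin_ge_minus_one[of "t * Y k"] by linarith+
    show "0 \<le> ?r k" "?r k \<le> 2 / t" using s t by (auto simp: divide_right_mono)
    have G0: "0 \<le> trunc_half_square x (Y k)" using trunc_half_square_bounds x Y_nonneg by simp
    show "?r k \<le> 4 / (t * x\<^sup>2) * trunc_half_square x (Y k)"
    proof (cases "x \<le> Y k")
      case True
      have "x\<^sup>2 / 2 \<le> trunc_half_square x (Y k)"
        using True x mult_left_mono[OF True, of x] by (auto simp: trunc_half_square_def power2_eq_square)
      then have "4 / (t * x\<^sup>2) * (x\<^sup>2 / 2) \<le> 4 / (t * x\<^sup>2) * trunc_half_square x (Y k)"
        using t by (intro mult_left_mono) auto
      moreover have "4 / (t * x\<^sup>2) * (x\<^sup>2 / 2) = 2 / t" using x t by (simp add: field_simps)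
      ultimately show ?thesis using \<open>?r k \<le> 2 / t\<close> by linarith
    qed (use G0 t in auto)
  qed
  have ir: "integrable p ?r"
  proof (rule integrable_pmf_bounded[where B = "2 / t"])
    show "norm (?r k) \<le> 2 / t" for k using r_bound(1,2)[of k] by simp
  qed
  have id: "Y k - sin (t * Y k) / t = t * trunc_half_square x (Y k) - t\<^sup>2 * ?J k + ?r k" for k
    by (rule integral_cos_trunc_half_square[OF t x Y_nonneg])
  have iG: "integrable p (\<lambda>k. trunc_half_square x (Y k))" using x by (intro integrable_trunc) auto
  have iJ: "integrable p (\<lambda>k. t\<^sup>2 * ?J k)"
  proof -
    have "(\<lambda>k. t\<^sup>2 * ?J k) = (\<lambda>k. t * trunc_half_square x (Y k) + ?r k - (Y k - sin (t * Y k) / t))"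
      unfolding id by auto
    moreover have "integrable p \<dots>"
      by (intro Bochner_Integration.integrable_diff Bochner_Integration.integrable_add ir
          integrable_sin_defect integrable_mult_right iG)
    ultimately show ?thesis by simp
  qed
  have "sin_defect p Y t = (\<integral>k. t * trunc_half_square x (Y k) - t\<^sup>2 * ?J k + ?r k \<partial>p)"
    by (subst id) (rule refl)
  also have "\<dots> = t * trunc_moment p Y x - t\<^sup>2 * (\<integral>k. ?J k \<partial>p) + (\<integral>k. ?r k \<partial>p)"
    unfolding trunc_moment_def
    by (subst Bochner_Integration.integral_add[OF _ ir], intro Bochner_Integration.integrable_diff iJ integrable_mult_right iG)
      (subst Bochner_Integration.integral_diff[OF _ iJ], use iG in auto)
  finally have eq: "sin_defect p Y t
    - (t * trunc_moment p Y x - t\<^sup>2 * integral {0..x} (\<lambda>s. cos (t * s) * trunc_moment p Y s)) = (\<integral>k. ?r k \<partial>p)"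
    unfolding swap' by simp
  have "0 \<le> (\<integral>k. ?r k \<partial>p)" by (rule integral_nonneg_AE) (use r_bound in auto)
  moreover have "(\<integral>k. ?r k \<partial>p) \<le> (\<integral>k. 4 / (t * x\<^sup>2) * trunc_half_square x (Y k) \<partial>p)"
    by (rule integral_mono[OF ir _ r_bound(3)]) (intro integrable_mult_right iG)
  moreover have "(\<integral>k. 4 / (t * x\<^sup>2) * trunc_half_square x (Y k) \<partial>p) = 4 / (t * x\<^sup>2) * trunc_moment p Y x"
    unfolding trunc_moment_def by (rule integral_mult_right_zero)
  ultimately show ?thesis unfolding eq by linarith
qed

end


lemma abs_diff_le_of_approx:
  fixes a a' :: real
  assumes "\<bar>a - (u - v)\<bar> \<le> e" "\<bar>a' - (u' - v')\<bar> \<le> e'"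
  shows "\<bar>a - a'\<bar> \<le> \<bar>u - u'\<bar> + \<bar>v - v'\<bar> + (e + e')"
  using assms by linarith

text \<open>Apply the preceding approximation with \<open>x = R/t\<close> for a fixed large \<open>R\<close>. The error is of order
  \<open>t m(1/t) / R\<close>. For fixed \<open>R\<close>, the difference \<open>D\<close> of the two truncated moments is at most \<open>\<delta> M\<close> beyond some
  \<open>X0\<close>, and the interval \<open>[0, X0]\<close> contributes only \<open>t^2 X0 M(X0)\<close>, which is negligible as \<open>t\<close> tends to \<open>0\<close>.\<close>

lemma sin_defect_difference_negligible:
  assumes Y: "nonneg_functional p Y" and Z: "nonneg_functional p Z"
    and lim: "((\<lambda>x. trunc_moment p Z x / trunc_moment p Y x) \<longlongrightarrow> 1) at_top"
  shows "((\<lambda>t. (sin_defect p Y t - sin_defect p Z t)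
      / (t * (trunc_moment p Y (1 / t) + trunc_moment p Z (1 / t)))) \<longlongrightarrow> 0) (at_right 0)"
proof (rule tendstoI)
  fix \<epsilon> :: real assume eps: "0 < \<epsilon>"
  interpret Y: nonneg_functional p Y by fact
  interpret Z: nonneg_functional p Z by fact
  define M where "M x = trunc_moment p Y x + trunc_moment p Z x" for x
  define D where "D x = trunc_moment p Y x - trunc_moment p Z x" for x
  have M_mono: "M a \<le> M b" if "0 \<le> a" "a \<le> b" for a b
    using Y.mono[OF that] Z.mono[OF that] by (simp add: M_def)
  have M_scale: "M (l * x) \<le> l * M x" if "0 \<le> x" "1 \<le> l" for l x
    using Y.scale_le[OF that] Z.scale_le[OF that] by (simp add: M_def distrib_left)
  have D_le: "\<bar>D x\<bar> \<le> M x" if "0 \<le> x" for x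
    using Y.nonneg[OF that] Z.nonneg[OF that] by (simp add: M_def D_def abs_le_iff)
  obtain N :: nat where N: "16 / \<epsilon> < real N" using reals_Archimedean2 by blast
  \<comment> \<open>\<open>R\<close> is large, with \<open>cos R = 0\<close> and \<open>sin R = 1\<close>\<close>
  define R where "R = pi / 2 + 2 * real N * pi"
  have R1: "1 \<le> R" using pi_ge_two by (simp add: R_def add_increasing2)
  have "real N * 1 \<le> real N * (2 * pi)" using pi_ge_two by (intro mult_left_mono) auto
  then have RN: "real N \<le> R" using pi_ge_zero by (simp add: R_def algebra_simps add_increasing)
  with N have "16 / \<epsilon> \<le> R" by linarith
  then have R4: "4 / R \<le> \<epsilon> / 4" using eps R1 by (simp add: field_simps)
  have cR: "cos R = 0" and sR: "sin R = 1"
    by (simp_all add: R_def cos_add sin_add cos_2npi sin_2npi)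
  define Q where "Q = R + R\<^sup>2"
  define \<delta> where "\<delta> = \<epsilon> / 4 / Q"
  have Rpos: "0 < R + R\<^sup>2" using R1 by (simp add: add_pos_nonneg)
  have d: "0 < \<delta>" "\<delta> * (R + R\<^sup>2) = \<epsilon> / 4" using eps Rpos unfolding Q_def[symmetric] by (simp_all add: \<delta>_def)
  have "eventually (\<lambda>x. dist (trunc_moment p Z x / trunc_moment p Y x) 1 < min \<delta> (1 / 2)) at_top"
    using tendstoD[OF lim, of "min \<delta> (1 / 2)"] d by simp
  then have "eventually (\<lambda>x. 0 < M x \<and> \<bar>D x\<bar> \<le> \<delta> * M x) at_top"
    using eventually_ge_at_top[of 0]
  proof eventually_elim
    case (elim x)
    let ?y = "trunc_moment p Y x" and ?z = "trunc_moment p Z x"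
    have ne: "?y \<noteq> 0"
    proof
      assume "?y = 0" then show False using elim(1) by (simp add: dist_real_def)
    qed
    then have y: "0 < ?y" using Y.nonneg[OF elim(2)] by linarith
    have "\<bar>?z / ?y - 1\<bar> * ?y \<le> \<delta> * ?y"
      using elim(1) y by (intro mult_right_mono) (auto simp: dist_real_def)
    moreover have "\<bar>?z / ?y - 1\<bar> * ?y = \<bar>D x\<bar>"
    proof -
      have "\<bar>?z / ?y - 1\<bar> * ?y = \<bar>(?z / ?y - 1) * ?y\<bar>" using y by (simp add: abs_mult)
      also have "(?z / ?y - 1) * ?y = - D x" using ne by (simp add: D_def field_simps)
      finally show ?thesis by simp
    qed
    moreover have "\<delta> * ?y \<le> \<delta> * M x" using Z.nonneg[OF elim(2)] d by (intro mult_left_mono) (auto simp: M_def)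
    ultimately show ?case using y Z.nonneg[OF elim(2)] by (simp add: M_def)
  qed
  then obtain X1 where X1: "\<And>x. X1 \<le> x \<Longrightarrow> 0 < M x \<and> \<bar>D x\<bar> \<le> \<delta> * M x"
    by (auto simp: eventually_at_top_linorder)
  define X0 where "X0 = max X1 1"
  have X0: "0 < X0" "\<And>x. X0 \<le> x \<Longrightarrow> 0 < M x" "\<And>x. X0 \<le> x \<Longrightarrow> \<bar>D x\<bar> \<le> \<delta> * M x"
    using X1 by (auto simp: X0_def)
  \<comment> \<open>for \<open>t < b\<close> both \<open>X0 \<le> 1/t\<close> and \<open>t X0 \<le> \<epsilon>/4\<close>\<close>
  define b where "b = min (1 / X0) (\<epsilon> / (4 * X0))"
  have b: "0 < b" using X0 eps by (simp add: b_def)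
  have main: "\<bar>sin_defect p Y t - sin_defect p Z t\<bar> \<le> t * M (1 / t) * (3 / 4 * \<epsilon>)"
    and Mpos: "0 < M (1 / t)" if t: "0 < t" "t < b" for t
  proof -
    have tX: "t * X0 \<le> 1" "t * X0 \<le> \<epsilon> / 4"
      using t X0(1) by (auto simp: b_def field_simps)
    then have X0t: "X0 \<le> 1 / t" using t by (simp add: field_simps)
    define W where "W = M (1 / t)"
    show "0 < M (1 / t)" using X0(2)[OF X0t] .
    then have W: "0 < W" by (simp add: W_def)
    define x where "x = R / t"
    have x: "0 < x" "t * x = R" using t R1 by (auto simp: x_def)
    have xx: "1 / t \<le> x" using t R1 by (simp add: x_def divide_right_mono)
    have X0x: "X0 \<le> x" using X0t xx by linarith
    have cs: "cos (t * x) = 0" "sin (t * x) = 1" using cR sR x by simp_all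
    have Mx: "M x \<le> R * W"
      using M_scale[of "1 / t" R] t R1 by (simp add: W_def x_def)
    have MX: "M X0 \<le> W" using M_mono[OF _ X0t] X0(1) by (simp add: W_def)
    let ?I = "\<lambda>U. integral {0..x} (\<lambda>s. cos (t * s) * trunc_moment p U s)"
    have c: "continuous_on {0..x} (\<lambda>s. cos (t * s) * trunc_moment p U s)" if "nonneg_functional p U" for U
      by (intro continuous_intros nonneg_functional.continuous_on_trunc_moment[OF that])
    have cD: "continuous_on {0..x} (\<lambda>s. cos (t * s) * D s)"
      unfolding D_def by (intro continuous_intros Y.continuous_on_trunc_moment Z.continuous_on_trunc_moment)
    have ID: "?I Y - ?I Z = integral {0..x} (\<lambda>s. cos (t * s) * D s)"
      unfolding D_def right_diff_distrib
      by (intro Henstock_Kurzweil_Integration.integral_diff[symmetric] integrable_continuous_real c Y Z)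
    have iD: "(\<lambda>s. cos (t * s) * D s) integrable_on {u..v}" if "0 \<le> u" "v \<le> x" for u v
      by (intro integrable_continuous_real continuous_on_subset[OF cD]) (use that in auto)
    have piece: "\<bar>integral {u..v} (\<lambda>s. cos (t * s) * D s)\<bar> \<le> B * (v - u)"
      if "0 \<le> u" "u \<le> v" "v \<le> x" "\<And>s. u \<le> s \<Longrightarrow> s \<le> v \<Longrightarrow> \<bar>D s\<bar> \<le> B" for u v B
    proof -
      have "norm (integral {u..v} (\<lambda>s. cos (t * s) * D s)) \<le> integral {u..v} (\<lambda>s. B)"
      proof (rule integral_norm_bound_integral)
        fix s assume "s \<in> {u..v}"
        then have "\<bar>cos (t * s)\<bar> * \<bar>D s\<bar> \<le> 1 * B" using that(4)[of s] by (intro mult_mono) auto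
        then show "norm (cos (t * s) * D s) \<le> B" by (simp add: abs_mult)
      qed (use iD that in auto)
      then show ?thesis using that by (simp add: mult.commute)
    qed
    have p1: "\<bar>integral {0..X0} (\<lambda>s. cos (t * s) * D s)\<bar> \<le> W * (X0 - 0)"
    proof (rule piece)
      fix s assume s: "0 \<le> s" "s \<le> X0"
      show "\<bar>D s\<bar> \<le> W" using D_le[OF s(1)] M_mono[OF s] MX by linarith
    qed (use X0 X0x in auto)
    have p2: "\<bar>integral {X0..x} (\<lambda>s. cos (t * s) * D s)\<bar> \<le> \<delta> * (R * W) * (x - X0)"
    proof (rule piece)
      fix s assume s: "X0 \<le> s" "s \<le> x"
      have "\<delta> * M s \<le> \<delta> * (R * W)" using M_mono[of s x] s X0(1) Mx d by (intro mult_left_mono) auto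
      then show "\<bar>D s\<bar> \<le> \<delta> * (R * W)" using X0(3)[OF s(1)] by linarith
    qed (use X0 X0x in auto)
    have "integral {0..x} (\<lambda>s. cos (t * s) * D s)
        = integral {0..X0} (\<lambda>s. cos (t * s) * D s) + integral {X0..x} (\<lambda>s. cos (t * s) * D s)"
      by (rule Henstock_Kurzweil_Integration.integral_combine[symmetric]) (use iD X0 X0x in auto)
    moreover have "\<delta> * (R * W) * (x - X0) \<le> \<delta> * (R * W) * x"
      using d R1 W X0 by (intro mult_left_mono) auto
    ultimately have I: "\<bar>?I Y - ?I Z\<bar> \<le> W * X0 + \<delta> * (R * W) * x"
      unfolding ID using p1 p2 by simp
    let ?e = "4 / (t * x\<^sup>2)"
    have "\<bar>t * trunc_moment p Y x - t * trunc_moment p Z x\<bar> = t * \<bar>D x\<bar>"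
      using t by (simp add: D_def abs_mult flip: right_diff_distrib)
    also have "\<dots> \<le> t * (\<delta> * (R * W))"
    proof (rule mult_left_mono)
      have "\<delta> * M x \<le> \<delta> * (R * W)" using Mx d by (intro mult_left_mono) auto
      then show "\<bar>D x\<bar> \<le> \<delta> * (R * W)" using X0(3)[OF X0x] by linarith
    qed (use t in auto)
    finally have A1: "\<bar>t * trunc_moment p Y x - t * trunc_moment p Z x\<bar> \<le> t * (\<delta> * (R * W))" .
    have "\<bar>t\<^sup>2 * ?I Y - t\<^sup>2 * ?I Z\<bar> = t\<^sup>2 * \<bar>?I Y - ?I Z\<bar>"
      by (simp add: abs_mult flip: right_diff_distrib)
    also have "\<dots> \<le> t\<^sup>2 * (W * X0 + \<delta> * (R * W) * x)"
      by (rule mult_left_mono[OF I]) auto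
    also have "\<dots> = t * W * (t * X0) + t * W * (\<delta> * R * (t * x))" by (simp add: power2_eq_square algebra_simps)
    also have "\<dots> \<le> t * W * (\<epsilon> / 4) + t * W * (\<delta> * R * R)"
      using tX(2) t W unfolding x(2) by (intro add_right_mono mult_left_mono) auto
    finally have A2: "\<bar>t\<^sup>2 * ?I Y - t\<^sup>2 * ?I Z\<bar> \<le> t * W * (\<epsilon> / 4) + t * W * (\<delta> * R * R)" .
    have "?e * trunc_moment p Y x + ?e * trunc_moment p Z x = ?e * M x" by (simp add: M_def distrib_left)
    also have "\<dots> \<le> ?e * (R * W)" using Mx t by (intro mult_left_mono) auto
    also have "\<dots> = t * W * (4 / R)"
      using t R1 by (simp add: x_def field_simps power2_eq_square)
    also have "\<dots> \<le> t * W * (\<epsilon> / 4)" using R4 t W by (intro mult_left_mono) auto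
    finally have A3: "?e * trunc_moment p Y x + ?e * trunc_moment p Z x \<le> t * W * (\<epsilon> / 4)" .
    have "\<bar>sin_defect p Y t - sin_defect p Z t\<bar>
      \<le> t * (\<delta> * (R * W)) + (t * W * (\<epsilon> / 4) + t * W * (\<delta> * R * R)) + t * W * (\<epsilon> / 4)"
      by (rule order_trans[OF abs_diff_le_of_approx[OF Y.sin_defect_approx[OF t(1) x(1) cs]
            Z.sin_defect_approx[OF t(1) x(1) cs]]]) (intro add_mono A1 A2 A3)
    also have "\<dots> = t * W * (\<delta> * (R + R\<^sup>2) + \<epsilon> / 2)" by (simp add: algebra_simps power2_eq_square)
    also have "\<dots> = t * M (1 / t) * (3 / 4 * \<epsilon>)" unfolding d(2) by (simp add: W_def)
    finally show "\<bar>sin_defect p Y t - sin_defect p Z t\<bar> \<le> t * M (1 / t) * (3 / 4 * \<epsilon>)" .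
  qed
  have "eventually (\<lambda>t. t \<in> {0<..<b}) (at_right 0)" by (rule eventually_at_right_real[OF b])
  then show "eventually (\<lambda>t. dist ((sin_defect p Y t - sin_defect p Z t)
      / (t * (trunc_moment p Y (1 / t) + trunc_moment p Z (1 / t)))) 0 < \<epsilon>) (at_right 0)"
  proof eventually_elim
    case (elim t)
    then have t: "0 < t" "t < b" by auto
    have pos: "0 < t * M (1 / t)" using Mpos[OF t] t by simp
    have "\<bar>sin_defect p Y t - sin_defect p Z t\<bar> / (t * M (1 / t)) \<le> 3 / 4 * \<epsilon>"
      using main[OF t] pos by (simp add: pos_divide_le_eq mult.commute)
    also have "\<dots> < \<epsilon>" using eps by simp
    finally show ?case using pos by (simp add: dist_real_def abs_divide M_def)
  qed
qed

section \<open>Truncated second moments of the walk\<close>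

definition abs_step :: "int \<Rightarrow> real" where "abs_step k = \<bar>real_of_int k\<bar>"

text \<open>Twice \<open>c(x) = m(x) - x \<eta>(x)\<close>.\<close>

definition trunc_var :: "int pmf \<Rightarrow> real \<Rightarrow> real" where
  "trunc_var p x = (\<integral>k. (min x (abs_step k))\<^sup>2 \<partial>p)"

context walk_law
begin

sublocale nonneg_functional p abs_step
  by unfold_locales (use integrable_step in \<open>auto simp: abs_step_def[abs_def]\<close>)

abbreviation "m \<equiv> trunc_moment p abs_step"
abbreviation "\<eta> \<equiv> tail_mean p abs_step"

lemma integrable_min_square: "0 \<le> x \<Longrightarrow> integrable p (\<lambda>k. (min x (abs_step k))\<^sup>2)"
proof (rule integrable_pmf_bounded[where B = "x\<^sup>2"])
  show "norm ((min x (abs_step k))\<^sup>2) \<le> x\<^sup>2" if "0 \<le> x" for k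
    using that Y_nonneg[of k] by (auto intro!: power_mono)
qed

lemma half_trunc_var: "0 \<le> x \<Longrightarrow> m x - x * \<eta> x = trunc_var p x / 2"
  by (simp add: trunc_moment_minus_tail trunc_var_def)

lemma trunc_var_nonneg: "0 \<le> trunc_var p x"
  unfolding trunc_var_def by (rule integral_nonneg_AE) auto

lemma trunc_var_le: "0 \<le> x \<Longrightarrow> trunc_var p x \<le> 2 * m x"
  using half_trunc_var[of x] slope_nonneg[of x] mult_nonneg_nonneg[of x "\<eta> x"] by linarith

lemma trunc_var_mono: assumes "0 \<le> x" "x \<le> y" shows "trunc_var p x \<le> trunc_var p y"
  unfolding trunc_var_def
  by (rule integral_mono) (use assms Y_nonneg integrable_min_square in \<open>auto intro!: power_mono\<close>)

lemma trunc_var_scale: assumes "0 \<le> x" "1 \<le> l" shows "trunc_var p (l * x) \<le> l\<^sup>2 * trunc_var p x"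
proof -
  have "(\<integral>k. (min (l * x) (abs_step k))\<^sup>2 \<partial>p) \<le> (\<integral>k. l\<^sup>2 * (min x (abs_step k))\<^sup>2 \<partial>p)"
  proof (rule integral_mono)
    show "(min (l * x) (abs_step k))\<^sup>2 \<le> l\<^sup>2 * (min x (abs_step k))\<^sup>2" for k
    proof -
      have "abs_step k \<le> l * abs_step k" using mult_right_mono[OF assms(2) Y_nonneg[of k]] by simp
      then have "min (l * x) (abs_step k) \<le> l * min x (abs_step k)"
        by (cases "x \<le> abs_step k") (simp_all add: min_absorb1 min_absorb2 min.coboundedI2)
      then have "(min (l * x) (abs_step k))\<^sup>2 \<le> (l * min x (abs_step k))\<^sup>2"
        using assms Y_nonneg[of k] by (intro power_mono) auto
      then show ?thesis by (simp add: power_mult_distrib)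
    qed
  qed (use assms integrable_min_square in auto)
  then show ?thesis by (simp add: trunc_var_def)
qed

lemma trunc_var_pos: assumes "0 < x" shows "0 < trunc_var p x"
proof (rule ccontr)
  assume "\<not> 0 < trunc_var p x"
  then have 0: "(\<integral>k. (min x (abs_step k))\<^sup>2 \<partial>p) = 0"
    using trunc_var_nonneg[of x] unfolding trunc_var_def by linarith
  have "AE k in p. (min x (abs_step k))\<^sup>2 = 0"
    by (rule integral_nonneg_eq_0_iff_AE[THEN iffD1, OF _ _ 0]) (use assms integrable_min_square in auto)
  then have "k = 0" if "k \<in> set_pmf p" for k
    using that assms by (auto simp: AE_measure_pmf_iff min_def abs_step_def split: if_splits)
  moreover obtain z1 z2 where "z1 \<in> set_pmf p" "z2 \<in> set_pmf p" "z1 \<noteq> z2"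
    by (rule support_not_singleton)
  ultimately show False by blast
qed

lemma m_pos: "0 < x \<Longrightarrow> 0 < m x"
  using trunc_var_pos[of x] trunc_var_le[of x] by simp

lemma cos_defect_le:
  assumes t: "0 < t" shows "cos_defect p t \<le> t\<^sup>2 / 2 * trunc_var p (2 / t)"
proof -
  have "(\<integral>k. 1 - cos (t * real_of_int k) \<partial>p) \<le> (\<integral>k. t\<^sup>2 / 2 * (min (2 / t) (abs_step k))\<^sup>2 \<partial>p)"
  proof (rule integral_mono)
    show "1 - cos (t * real_of_int k) \<le> t\<^sup>2 / 2 * (min (2 / t) (abs_step k))\<^sup>2" for k
    proof (cases "abs_step k \<le> 2 / t")
      case True
      then have "t\<^sup>2 / 2 * (min (2 / t) (abs_step k))\<^sup>2 = (t * real_of_int k)\<^sup>2 / 2"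
        by (simp add: min_absorb2 abs_step_def power_mult_distrib)
      then show ?thesis using one_minus_cos_le[of "t * real_of_int k"] by simp
    next
      case False
      then have "t\<^sup>2 / 2 * (min (2 / t) (abs_step k))\<^sup>2 = 2"
        using t by (simp add: min_absorb1 power_divide)
      then show ?thesis using one_minus_cos_le_2[of "t * real_of_int k"] by simp
    qed
  qed (use t integrable_min_square in auto)
  then show ?thesis by (simp add: cos_defect_def trunc_var_def)
qed

lemma m_has_derivative:
  assumes "0 < u" shows "(m has_real_derivative \<eta> u) (at u)"
proof -
  have "((\<lambda>x. integral {0..x} \<eta>) has_real_derivative \<eta> u) (at u within {0..u + 1})"
    by (rule integral_has_real_derivative)
      (use assms in \<open>auto intro: continuous_on_subset[OF continuous_on_tail_mean]\<close>)
  then have "(m has_real_derivative \<eta> u) (at u within {0..u + 1})"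
    by (rule has_field_derivative_transform_within[where d = 1])
      (use assms in \<open>auto simp: integral_tail_mean\<close>)
  moreover have "at u within {0..u + 1} = at u" using assms by (intro at_within_interior) auto
  ultimately show ?thesis by simp
qed

section \<open>Upper bound for the symmetrized potential\<close>

text \<open>The lower bound for \<open>R\<close> sees only the second moment restricted to \<open>|X| \<le> K x\<close>. This loses little
  if \<open>K\<close> is large: pointwise it dominates \<open>min(x, |X|)^2 - min(K x, |X|)^2 / K^2\<close>, whose mean is at least
  \<open>2 d m(x) - 2 m(K x) / K^2 \<ge> 2 d m(x) - 2 m(x) / K\<close>, and \<open>K = 2/d\<close> leaves \<open>d m(x)\<close>.\<close>

lemma cos_defect_ge_trunc_moment:
  assumes \<theta>: "\<theta> < 1" and ratio: "eventually (\<lambda>x. x * \<eta> x / m x \<le> \<theta>) at_top"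
  shows "\<exists>\<kappa>>0. \<exists>t1>0. t1 \<le> pi \<and> (\<forall>t. 0 < t \<longrightarrow> t \<le> t1 \<longrightarrow> \<kappa> * (t\<^sup>2 * m (1 / t)) \<le> cos_defect p t)"
proof -
  obtain X0 where X0: "\<And>x. X0 \<le> x \<Longrightarrow> x * \<eta> x / m x \<le> \<theta>"
    using ratio by (auto simp: eventually_at_top_linorder)
  \<comment> \<open>the minimum keeps \<open>d \<le> 1\<close> in case \<open>\<theta>\<close> is negative\<close>
  define d where "d = min (1 - \<theta>) 1"
  have d: "0 < d" "d \<le> 1" "d \<le> 1 - \<theta>" using \<theta> by (auto simp: d_def)
  define K where "K = 2 / d"
  have K: "2 \<le> K" using d by (simp add: K_def field_simps)
  define X where "X = max X0 1"
  have X: "0 < X" "X0 \<le> X" by (auto simp: X_def)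
  have tv: "2 * d * m x \<le> trunc_var p x" if "X \<le> x" for x
  proof -
    have x: "0 < x" using that X by linarith
    have "x * \<eta> x \<le> \<theta> * m x" using X0[of x] that X m_pos[OF x] by (simp add: divide_le_eq)
    moreover have "(1 - \<theta>) * m x = m x - \<theta> * m x" by (simp add: left_diff_distrib)
    ultimately have "(1 - \<theta>) * m x \<le> trunc_var p x / 2" using half_trunc_var[of x] x by linarith
    moreover have "d * m x \<le> (1 - \<theta>) * m x" using d m_pos[OF x] by (intro mult_right_mono) auto
    ultimately show ?thesis by linarith
  qed
  have V: "d * m x \<le> (\<integral>k. (real_of_int k)\<^sup>2 * of_bool (\<bar>real_of_int k\<bar> \<le> K * x) \<partial>p)" if x: "X \<le> x" for x
  proof -
    have x0: "0 < x" using that X by linarith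
    have Kx: "x \<le> K * x" "0 \<le> K * x" using K x0 by (auto simp: mult_left_mono)
    have iV: "integrable p (\<lambda>k. (real_of_int k)\<^sup>2 * of_bool (\<bar>real_of_int k\<bar> \<le> K * x))"
    proof (rule integrable_pmf_bounded[where B = "(K * x)\<^sup>2"])
      show "norm ((real_of_int k)\<^sup>2 * of_bool (\<bar>real_of_int k\<bar> \<le> K * x)) \<le> (K * x)\<^sup>2" for k
        by (auto simp: abs_le_square_iff[symmetric])
    qed
    have "trunc_var p x - trunc_var p (K * x) / K\<^sup>2
        = (\<integral>k. (min x (abs_step k))\<^sup>2 - (min (K * x) (abs_step k))\<^sup>2 / K\<^sup>2 \<partial>p)"
      unfolding trunc_var_def using integrable_min_square x0 Kx by simp
    also have "\<dots> \<le> (\<integral>k. (real_of_int k)\<^sup>2 * of_bool (\<bar>real_of_int k\<bar> \<le> K * x) \<partial>p)"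
    proof (rule integral_mono[OF _ iV])
      show "integrable p (\<lambda>k. (min x (abs_step k))\<^sup>2 - (min (K * x) (abs_step k))\<^sup>2 / K\<^sup>2)"
        using integrable_min_square x0 Kx by simp
      show "(min x (abs_step k))\<^sup>2 - (min (K * x) (abs_step k))\<^sup>2 / K\<^sup>2
          \<le> (real_of_int k)\<^sup>2 * of_bool (\<bar>real_of_int k\<bar> \<le> K * x)" for k
      proof (cases "\<bar>real_of_int k\<bar> \<le> K * x")
        case True
        have "(min x (abs_step k))\<^sup>2 \<le> (abs_step k)\<^sup>2" using x0 Y_nonneg[of k] by (intro power_mono) auto
        moreover have "0 \<le> (min (K * x) (abs_step k))\<^sup>2 / K\<^sup>2" by simp
        ultimately have "(min x (abs_step k))\<^sup>2 - (min (K * x) (abs_step k))\<^sup>2 / K\<^sup>2 \<le> (abs_step k)\<^sup>2" by linarith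
        also have "\<dots> = (real_of_int k)\<^sup>2 * of_bool (\<bar>real_of_int k\<bar> \<le> K * x)" using True by (simp add: abs_step_def)
        finally show ?thesis .
      next
        case False
        then have "min x (abs_step k) = x" "min (K * x) (abs_step k) = K * x"
          using Kx by (auto simp: abs_step_def)
        then show ?thesis using False K by (simp add: power_mult_distrib)
      qed
    qed
    finally have le: "trunc_var p x - trunc_var p (K * x) / K\<^sup>2
      \<le> (\<integral>k. (real_of_int k)\<^sup>2 * of_bool (\<bar>real_of_int k\<bar> \<le> K * x) \<partial>p)" .
    have "trunc_var p (K * x) \<le> 2 * (K * m x)"
      using trunc_var_le[of "K * x"] scale_le[of x K] Kx K x0 by simp
    then have "trunc_var p (K * x) / K\<^sup>2 \<le> 2 * (K * m x) / K\<^sup>2" by (rule divide_right_mono) simp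
    also have "\<dots> = d * m x" using d by (simp add: K_def field_simps power2_eq_square)
    finally show ?thesis using le tv[OF x] by linarith
  qed
  define \<kappa> where "\<kappa> = 2 / pi\<^sup>2 * (d / K)"
  define t1 where "t1 = min pi (1 / (K * X))"
  have "\<kappa> * (t\<^sup>2 * m (1 / t)) \<le> cos_defect p t" if t: "0 < t" "t \<le> t1" for t
  proof -
    define x where "x = 1 / (K * t)"
    have "t * (K * X) \<le> 1" using t K X by (simp add: t1_def field_simps)
    then have x: "X \<le> x" using t K by (simp add: x_def field_simps)
    have Kx: "K * x = 1 / t" using K by (simp add: x_def)
    have "m (1 / t) \<le> K * m x" using scale_le[of x K] K x X by (simp add: Kx)
    then have "m (1 / t) / K \<le> m x" using K by (simp add: divide_le_eq mult.commute)
    then have "d * (m (1 / t) / K) \<le> d * m x" using d by (intro mult_left_mono) auto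
    also note V[OF x]
    finally have "d * (m (1 / t) / K) \<le> (\<integral>k. (real_of_int k)\<^sup>2 * of_bool (\<bar>real_of_int k\<bar> \<le> 1 / t) \<partial>p)"
      by (simp only: Kx)
    then have "2 / pi\<^sup>2 * t\<^sup>2 * (d * (m (1 / t) / K))
        \<le> 2 / pi\<^sup>2 * t\<^sup>2 * (\<integral>k. (real_of_int k)\<^sup>2 * of_bool (\<bar>real_of_int k\<bar> \<le> 1 / t) \<partial>p)"
      by (rule mult_left_mono) simp
    also have "\<dots> \<le> cos_defect p t"
      by (rule cos_defect_ge_truncated) (use t pi_ge_two in auto)
    finally show ?thesis by (simp add: \<kappa>_def mult_ac)
  qed
  moreover have "0 < \<kappa>" "0 < t1" "t1 \<le> pi" using d K X by (auto simp: \<kappa>_def t1_def)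
  ultimately show ?thesis by blast
qed

text \<open>With \<open>f(u) = u / m(u)\<close>, the function \<open>- f(1/t)\<close> has the derivative \<open>c(1/t) / (t m(1/t))^2\<close>, which is
  at least \<open>d\<close> times the integrand.\<close>

lemma integral_inverse_square_trunc_moment:
  assumes d: "0 < d" and X: "0 < X" and ratio: "\<And>u. X \<le> u \<Longrightarrow> u * \<eta> u \<le> (1 - d) * m u"
    and x: "X \<le> x"
  shows "integral {1 / x..1 / X} (\<lambda>t. 1 / (t\<^sup>2 * m (1 / t))) \<le> x / m x / d"
    and "(\<lambda>t. 1 / (t\<^sup>2 * m (1 / t))) integrable_on {1 / x..1 / X}"
proof -
  have x0: "0 < x" using x X by linarith
  define G where "G t = - (1 / t) / m (1 / t)" for t
  define G' where "G' t = (m (1 / t) - (1 / t) * \<eta> (1 / t)) / (m (1 / t))\<^sup>2 / t\<^sup>2" for t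
  have le: "1 / x \<le> 1 / X" using x X by (simp add: field_simps)
  have pos: "0 < t" if "t \<in> {1 / x..1 / X}" for t using that x0 by (auto intro: less_le_trans[of 0 "1 / x"])
  have G: "(G' has_integral (G (1 / X) - G (1 / x))) {1 / x..1 / X}"
  proof (rule fundamental_theorem_of_calculus[OF le])
    fix t assume "t \<in> {1 / x..1 / X}"
    then have t: "0 < t" by (rule pos)
    have i: "((\<lambda>t. 1 / t) has_real_derivative - (1 / t\<^sup>2)) (at t)"
      using t by (auto intro!: derivative_eq_intros simp: power2_eq_square)
    have m: "((\<lambda>t. m (1 / t)) has_real_derivative \<eta> (1 / t) * (- (1 / t\<^sup>2))) (at t)"
      by (rule DERIV_chain2[OF m_has_derivative i]) (use t in simp)
    have mp: "0 < m (1 / t)" using t by (intro m_pos) simp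
    have "(G has_real_derivative ((1 / t\<^sup>2) * m (1 / t) - (- (1 / t)) * (\<eta> (1 / t) * (- (1 / t\<^sup>2)))) / (m (1 / t) * m (1 / t))) (at t)"
      unfolding G_def by (rule DERIV_divide[OF _ m]) (use DERIV_minus[OF i] mp in auto)
    moreover have "((1 / t\<^sup>2) * m (1 / t) - (- (1 / t)) * (\<eta> (1 / t) * (- (1 / t\<^sup>2)))) / (m (1 / t) * m (1 / t)) = G' t"
    proof -
      have "((1 / t\<^sup>2) * M - (- (1 / t)) * (E * (- (1 / t\<^sup>2)))) / (M * M) = (M - (1 / t) * E) / M\<^sup>2 / t\<^sup>2"
        if "0 < M" for M E :: real
        using t that by (simp add: power2_eq_square field_simps)
      from this[OF mp] show ?thesis by (simp only: G'_def)
    qed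
    ultimately have "(G has_real_derivative G' t) (at t)" by simp
    from has_field_derivative_at_within[OF this]
    show "(G has_vector_derivative G' t) (at t within {1 / x..1 / X})"
      unfolding has_real_derivative_iff_has_vector_derivative .
  qed
  have c: "continuous_on {1 / x..1 / X} (\<lambda>t. m (1 / t))"
  proof (rule continuous_on_compose2[of "{0..x}" m])
    show "continuous_on {0..x} m" by (rule continuous_on_trunc_moment)
    show "continuous_on {1 / x..1 / X} (\<lambda>t. 1 / t)"
    proof (intro continuous_intros ballI)
      show "t \<noteq> 0" if "t \<in> {1 / x..1 / X}" for t using pos[OF that] by simp
    qed
    show "(\<lambda>t. 1 / t) ` {1 / x..1 / X} \<subseteq> {0..x}"
    proof safe
      fix t assume t: "t \<in> {1 / x..1 / X}"
      have "1 \<le> t * x" using t x0 by (simp add: pos_divide_le_eq)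
      with pos[OF t] show "1 / t \<in> {0..x}" by (simp add: pos_divide_le_eq mult.commute)
    qed
  qed
  have ne: "t\<^sup>2 * m (1 / t) \<noteq> 0" if "t \<in> {1 / x..1 / X}" for t
    using pos[OF that] m_pos[of "1 / t"] by simp
  show int: "(\<lambda>t. 1 / (t\<^sup>2 * m (1 / t))) integrable_on {1 / x..1 / X}"
    by (intro integrable_continuous_real continuous_intros c) (use ne in blast)
  have "integral {1 / x..1 / X} (\<lambda>t. d * (1 / (t\<^sup>2 * m (1 / t)))) \<le> integral {1 / x..1 / X} G'"
  proof (rule integral_le)
    show "(\<lambda>t. d * (1 / (t\<^sup>2 * m (1 / t)))) integrable_on {1 / x..1 / X}"
      using integrable_on_cmult_left[OF int, of d] by simp
    show "G' integrable_on {1 / x..1 / X}" by (rule has_integral_integrable[OF G])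
    fix t assume t: "t \<in> {1 / x..1 / X}"
    have t0: "0 < t" by (rule pos[OF t])
    have mp: "0 < m (1 / t)" using t0 by (intro m_pos) simp
    have "X \<le> 1 / t" using t t0 X by (auto simp: field_simps)
    from ratio[OF this] have "d * m (1 / t) \<le> m (1 / t) - (1 / t) * \<eta> (1 / t)" by (simp add: algebra_simps)
    then have "d * m (1 / t) / (m (1 / t))\<^sup>2 / t\<^sup>2 \<le> G' t"
      unfolding G'_def by (intro divide_right_mono) auto
    moreover have "d * m (1 / t) / (m (1 / t))\<^sup>2 / t\<^sup>2 = d * (1 / (t\<^sup>2 * m (1 / t)))"
      using mp t0 by (simp add: power2_eq_square)
    ultimately show "d * (1 / (t\<^sup>2 * m (1 / t))) \<le> G' t" by simp
  qed
  also have "integral {1 / x..1 / X} G' = x / m x - X / m X"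
    using integral_unique[OF G] by (simp add: G_def)
  also have "\<dots> \<le> x / m x" using m_pos[OF X] X by simp
  finally have "d * integral {1 / x..1 / X} (\<lambda>t. 1 / (t\<^sup>2 * m (1 / t))) \<le> x / m x"
    by (simp only: Henstock_Kurzweil_Integration.integral_mult_right)
  then show "integral {1 / x..1 / X} (\<lambda>t. 1 / (t\<^sup>2 * m (1 / t))) \<le> x / m x / d"
    using pos_le_divide_eq[OF d] by (simp only: mult.commute[of d])
qed


lemma green_kernel_eq_integral:
  "(\<lambda>t. re_kernel t * (1 - cos (t * real_of_int x))) integrable_on {0..pi}"
  "pi * green_kernel x = integral {0..pi} (\<lambda>t. re_kernel t * (1 - cos (t * real_of_int x)))"
  using set_borel_integral_eq_integral[OF sym_sum_tendsto(1)[of x]] by (simp_all add: green_kernel_def)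

text \<open>The range of integration is cut at \<open>1/x\<close>, where \<open>(1 - cos tx)\<close> stops being of order \<open>(tx)^2\<close>, and at a
  fixed \<open>1/X\<close>. Each of the three pieces is at most a constant times \<open>x / m(x)\<close>; for the last one this is so
  because \<open>m\<close> grows at most linearly.\<close>

lemma green_kernel_upper:
  assumes \<theta>: "\<theta> < 1" and ratio: "eventually (\<lambda>x. x * \<eta> x / m x \<le> \<theta>) at_top"
  shows "\<exists>C. eventually (\<lambda>x::int. green_kernel x * m (real_of_int x) / real_of_int x \<le> C) at_top"
proof -
  obtain \<kappa> t1 where \<kappa>: "0 < \<kappa>" and t1: "0 < t1" "t1 \<le> pi"
    and low: "\<And>t. 0 < t \<Longrightarrow> t \<le> t1 \<Longrightarrow> \<kappa> * (t\<^sup>2 * m (1 / t)) \<le> cos_defect p t"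
    using cos_defect_ge_trunc_moment[OF assms] by metis
  obtain X1 where X1: "\<And>x. X1 \<le> x \<Longrightarrow> x * \<eta> x / m x \<le> \<theta>"
    using ratio by (auto simp: eventually_at_top_linorder)
  define X where "X = max X1 (1 / t1)"
  have X: "0 < X" "1 / t1 \<le> X" using t1 by (auto simp: X_def intro: less_le_trans[of 0 "1 / t1"])
  have Xt: "1 / X \<le> t1" using X t1 by (simp add: field_simps)
  define d where "d = 1 - \<theta>"
  have d: "0 < d" using \<theta> by (simp add: d_def)
  have slope: "u * \<eta> u \<le> (1 - d) * m u" if "X \<le> u" for u
    using X1[of u] that m_pos[of u] X by (simp add: d_def X_def divide_le_eq)
  obtain s where s: "s \<in> {1 / X..pi}" "\<And>t. t \<in> {1 / X..pi} \<Longrightarrow> cos_defect p s \<le> cos_defect p t"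
    using continuous_attains_inf[of "{1 / X..pi}" "cos_defect p"] Xt t1 continuous_on_cos_defect by auto
  define r where "r = cos_defect p s"
  have "0 < 1 / X" using X by simp
  then have "0 < s" "s \<le> pi" using s(1) by (auto simp del: zero_less_divide_1_iff)
  then have r: "0 < r" unfolding r_def by (rule cos_defect_pos)
  define C where "C = 1 / (2 * \<kappa>) + 2 / \<kappa> / d + 2 * pi / r * m 1"
  have "eventually (\<lambda>x::int. max X 1 \<le> real_of_int x) at_top"
    using eventually_ge_at_top[of "\<lceil>max X 1\<rceil>"] by eventually_elim linarith
  then have "eventually (\<lambda>x::int. green_kernel x * m (real_of_int x) / real_of_int x \<le> C / pi) at_top"
  proof eventually_elim
    case (elim x)
    define y where "y = real_of_int x"
    have y: "X \<le> y" "1 \<le> y" "0 < y" using elim by (auto simp: y_def)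
    have my: "0 < m y" by (rule m_pos[OF y(3)])
    define F where "F t = re_kernel t * (1 - cos (t * y))" for t
    have F: "F integrable_on {0..pi}" "pi * green_kernel x = integral {0..pi} F"
      using green_kernel_eq_integral[of x] by (simp_all add: F_def[abs_def] y_def)
    have Fi: "F integrable_on {a..b}" if "0 \<le> a" "b \<le> pi" for a b
      by (rule integrable_on_subinterval[OF F(1)]) (use that in auto)
    have "1 / y \<le> 1 / X" using y X by (intro divide_left_mono) auto
    then have order: "0 \<le> 1 / y" "1 / y \<le> 1 / X" "1 / X \<le> pi"
      using y Xt t1 by auto
    have F_le: "F t \<le> (1 - cos (t * y)) / cos_defect p t" for t
      using mult_right_mono[OF re_kernel_le[of t], of "1 - cos (t * y)"] by (simp add: F_def)
    have I1: "integral {0..1 / y} F \<le> y / m y * (1 / (2 * \<kappa>))"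
    proof -
      have "integral {0..1 / y} F \<le> integral {0..1 / y} (\<lambda>t. y\<^sup>2 / (2 * \<kappa> * m y))"
      proof (rule integral_le)
        fix t assume t: "t \<in> {0..1 / y}"
        show "F t \<le> y\<^sup>2 / (2 * \<kappa> * m y)"
        proof (cases "t = 0")
          case True then show ?thesis using \<kappa> my by (simp add: F_def)
        next
          case False
          with t have t0: "0 < t" by auto
          have yt: "y \<le> 1 / t" using t t0 y by (simp add: field_simps)
          have mt: "m y \<le> m (1 / t)" using mono[of y "1 / t"] y yt by auto
          have tt: "t \<le> t1" using t order Xt by auto
          have "F t \<le> ((t * y)\<^sup>2 / 2) / (\<kappa> * (t\<^sup>2 * m y))"
          proof (rule order_trans[OF F_le frac_le])
            show "1 - cos (t * y) \<le> (t * y)\<^sup>2 / 2" by (rule one_minus_cos_le)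
            have "\<kappa> * (t\<^sup>2 * m y) \<le> \<kappa> * (t\<^sup>2 * m (1 / t))" using \<kappa> mt by (intro mult_left_mono) auto
            then show "\<kappa> * (t\<^sup>2 * m y) \<le> cos_defect p t" using low[OF t0 tt] by linarith
          qed (use \<kappa> t0 my in auto)
          also have "\<dots> = y\<^sup>2 / (2 * \<kappa> * m y)" using t0 by (simp add: power_mult_distrib)
          finally show ?thesis .
        qed
      qed (use Fi order in auto)
      also have "\<dots> = y / m y * (1 / (2 * \<kappa>))" using y by (simp add: power2_eq_square)
      finally show ?thesis .
    qed
    have I2: "integral {1 / y..1 / X} F \<le> y / m y * (2 / \<kappa> / d)"
    proof -
      note J = integral_inverse_square_trunc_moment[OF d X(1) slope y(1)]
      have "integral {1 / y..1 / X} F \<le> integral {1 / y..1 / X} (\<lambda>t. 2 / \<kappa> * (1 / (t\<^sup>2 * m (1 / t))))"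
      proof (rule integral_le)
        show "(\<lambda>t. 2 / \<kappa> * (1 / (t\<^sup>2 * m (1 / t)))) integrable_on {1 / y..1 / X}"
          using integrable_on_cmult_left[OF J(2), of "2 / \<kappa>"] by simp
        fix t assume t: "t \<in> {1 / y..1 / X}"
        have t0: "0 < t" using t y by (auto intro: less_le_trans[of 0 "1 / y"])
        have mt: "0 < m (1 / t)" using t0 by (intro m_pos) simp
        have "F t \<le> 2 / (\<kappa> * (t\<^sup>2 * m (1 / t)))"
        proof (rule order_trans[OF F_le frac_le])
          show "\<kappa> * (t\<^sup>2 * m (1 / t)) \<le> cos_defect p t" by (rule low[OF t0]) (use t Xt in auto)
        qed (use \<kappa> t0 mt one_minus_cos_le_2 in auto)
        then show "F t \<le> 2 / \<kappa> * (1 / (t\<^sup>2 * m (1 / t)))" by simp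
      qed (use Fi order in auto)
      also have "\<dots> = 2 / \<kappa> * integral {1 / y..1 / X} (\<lambda>t. 1 / (t\<^sup>2 * m (1 / t)))"
        by (rule Henstock_Kurzweil_Integration.integral_mult_right)
      also have "\<dots> \<le> 2 / \<kappa> * (y / m y / d)" by (rule mult_left_mono[OF J(1)]) (use \<kappa> in auto)
      finally show ?thesis by (simp add: mult_ac)
    qed
    have I3: "integral {1 / X..pi} F \<le> y / m y * (2 * pi / r * m 1)"
    proof -
      have "integral {1 / X..pi} F \<le> integral {1 / X..pi} (\<lambda>t. 2 / r)"
      proof (rule integral_le)
        fix t assume t: "t \<in> {1 / X..pi}"
        show "F t \<le> 2 / r"
          by (rule order_trans[OF F_le frac_le]) (use s(2)[OF t] r one_minus_cos_le_2 in \<open>auto simp: r_def\<close>)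
      qed (use Fi order X in auto)
      also have "\<dots> = (pi - 1 / X) * (2 / r)" using order by simp
      also have "\<dots> \<le> pi * (2 / r)" using r X by (intro mult_right_mono) auto
      also have "\<dots> = 2 * pi / r * 1" by simp
      also have "\<dots> \<le> 2 * pi / r * (y / m y * m 1)"
      proof (rule mult_left_mono)
        have "m y \<le> y * m 1" using scale_le[of 1 y] y by simp
        then show "1 \<le> y / m y * m 1" using my by simp
      qed (use r in auto)
      finally show ?thesis by (simp add: mult_ac)
    qed
    have "pi * green_kernel x = integral {0..1 / y} F + integral {1 / y..1 / X} F + integral {1 / X..pi} F"
    proof -
      have "integral {0..pi} F = integral {0..1 / X} F + integral {1 / X..pi} F"
        by (rule Henstock_Kurzweil_Integration.integral_combine[symmetric]) (use F order X in auto)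
      also have "integral {0..1 / X} F = integral {0..1 / y} F + integral {1 / y..1 / X} F"
        by (rule Henstock_Kurzweil_Integration.integral_combine[symmetric]) (use Fi order X in auto)
      finally show ?thesis by (simp add: F(2))
    qed
    also have "\<dots> \<le> y / m y * C"
      using add_mono[OF add_mono[OF I1 I2] I3] by (simp add: C_def distrib_left)
    finally have "pi * green_kernel x * (m y / y) \<le> y / m y * C * (m y / y)"
      by (rule mult_right_mono) (use y my in auto)
    also have "\<dots> = C" using y my by simp
    finally show ?case by (simp add: y_def field_simps)
  qed
  then show ?thesis by blast
qed

end

section \<open>Lower bound for the symmetrized potential\<close>

lemma pi_gt_5_half: "5 / 2 < pi"
proof (rule ccontr)
  assume "\<not> 5 / 2 < pi"
  then have "cos (5 / 4) \<le> cos (pi / 2)" using pi_ge_two by (intro cos_monotone_0_pi_le) auto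
  moreover have "1 - cos (5 / 4) \<le> (5 / 4)\<^sup>2 / (2::real)" by (rule one_minus_cos_le)
  ultimately show False by (simp add: power2_eq_square)
qed

text \<open>On average over a frequency interval \<open>[\<pi>/2b, 3\<pi>/2b]\<close>, the zeros of \<open>1 - cos ty\<close> do no harm: for \<open>y \<ge> b\<close> the
  cosine is integrated over long enough an interval to cancel, and for \<open>y < b\<close> the first half of the interval
  stays in \<open>ty \<le> \<pi>\<close>.\<close>

lemma integral_one_minus_cos_ge:
  fixes b y :: real
  assumes b: "0 < b" and y: "0 \<le> y"
  shows "(min b y)\<^sup>2 / (2 * b ^ 3) \<le> integral {pi / (2 * b)..3 * pi / (2 * b)} (\<lambda>t. 1 - cos (t * y))"
proof (cases "b \<le> y")
  case True
  then have y0: "0 < y" using b by simp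
  have le: "pi / (2 * b) \<le> 3 * pi / (2 * b)" using b by (simp add: divide_right_mono)
  have "((\<lambda>t. 1 - cos (t * y)) has_integral
      ((3 * pi / (2 * b) - sin (3 * pi / (2 * b) * y) / y) - (pi / (2 * b) - sin (pi / (2 * b) * y) / y)))
      {pi / (2 * b)..3 * pi / (2 * b)}"
    by (rule fundamental_theorem_of_calculus[OF le])
      (use y0 in \<open>auto intro!: derivative_eq_intros simp flip: has_real_derivative_iff_has_vector_derivative\<close>)
  then have "integral {pi / (2 * b)..3 * pi / (2 * b)} (\<lambda>t. 1 - cos (t * y))
      = (3 * pi / (2 * b) - pi / (2 * b)) - (sin (3 * pi / (2 * b) * y) - sin (pi / (2 * b) * y)) / y"
    by (simp add: integral_unique diff_divide_distrib)
  also have "3 * pi / (2 * b) - pi / (2 * b) = pi / b" by (simp add: field_simps)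
  also have "pi / b - (sin (3 * pi / (2 * b) * y) - sin (pi / (2 * b) * y)) / y \<ge> pi / b - 2 / b"
  proof -
    have "sin (3 * pi / (2 * b) * y) - sin (pi / (2 * b) * y) \<le> 2"
      using sin_le_one[of "3 * pi / (2 * b) * y"] sin_ge_minus_one[of "pi / (2 * b) * y"] by linarith
    then have "(sin (3 * pi / (2 * b) * y) - sin (pi / (2 * b) * y)) / y \<le> 2 / y"
      using y0 by (intro divide_right_mono) auto
    also have "\<dots> \<le> 2 / b" using True b by (intro divide_left_mono) auto
    finally show ?thesis by linarith
  qed
  finally have "(pi - 2) / b \<le> integral {pi / (2 * b)..3 * pi / (2 * b)} (\<lambda>t. 1 - cos (t * y))"
    by (simp add: diff_divide_distrib)
  moreover have "(min b y)\<^sup>2 / (2 * b ^ 3) = (1 / 2) / b"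
    using True b by (simp add: min_absorb1 power2_eq_square power3_eq_cube)
  moreover have "(1 / 2) / b \<le> (pi - 2) / b" using pi_gt_5_half b by (intro divide_right_mono) auto
  ultimately show ?thesis by linarith
next
  case False
  have i: "(\<lambda>t. 1 - cos (t * y)) integrable_on {u..v}" for u v
    by (intro integrable_continuous_real continuous_intros)
  have le: "pi / (2 * b) \<le> pi / b" "pi / b \<le> 3 * pi / (2 * b)" using b by (simp_all add: field_simps)
  have "(pi / b - pi / (2 * b)) * (y\<^sup>2 / (2 * b\<^sup>2)) = integral {pi / (2 * b)..pi / b} (\<lambda>t. y\<^sup>2 / (2 * b\<^sup>2))"
    using le by simp
  also have "\<dots> \<le> integral {pi / (2 * b)..pi / b} (\<lambda>t. 1 - cos (t * y))"
  proof (rule integral_le)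
    fix t assume t: "t \<in> {pi / (2 * b)..pi / b}"
    have t0: "0 \<le> pi / (2 * b)" using b by simp
    then have t0': "0 \<le> t" using t by auto
    have "t * y \<le> pi / b * b" using t t0' False b y by (intro mult_mono) auto
    then have "\<bar>t * y\<bar> \<le> pi" using b y t0' by simp
    then have "2 / pi\<^sup>2 * (t * y)\<^sup>2 \<le> 1 - cos (t * y)" by (rule one_minus_cos_ge)
    moreover have "2 / pi\<^sup>2 * (pi / (2 * b) * y)\<^sup>2 \<le> 2 / pi\<^sup>2 * (t * y)\<^sup>2"
      using t t0 y b by (intro mult_left_mono power_mono mult_right_mono) auto
    moreover have "2 / pi\<^sup>2 * (pi / (2 * b) * y)\<^sup>2 = y\<^sup>2 / (2 * b\<^sup>2)"
      by (simp add: power_mult_distrib power_divide)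
    ultimately show "y\<^sup>2 / (2 * b\<^sup>2) \<le> 1 - cos (t * y)" by linarith
  qed (use i in auto)
  also have "\<dots> \<le> \<dots> + integral {pi / b..3 * pi / (2 * b)} (\<lambda>t. 1 - cos (t * y))"
    using integral_nonneg[OF i[of "pi / b" "3 * pi / (2 * b)"]] by simp
  also have "\<dots> = integral {pi / (2 * b)..3 * pi / (2 * b)} (\<lambda>t. 1 - cos (t * y))"
    by (rule Henstock_Kurzweil_Integration.integral_combine) (use le i in auto)
  finally have "(pi / b - pi / (2 * b)) * (y\<^sup>2 / (2 * b\<^sup>2)) \<le> integral {pi / (2 * b)..3 * pi / (2 * b)} (\<lambda>t. 1 - cos (t * y))" .
  moreover have "1 / b \<le> pi / b - pi / (2 * b)" using b pi_ge_two by (simp add: field_simps)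
  then have "1 / b * (y\<^sup>2 / (2 * b\<^sup>2)) \<le> (pi / b - pi / (2 * b)) * (y\<^sup>2 / (2 * b\<^sup>2))"
    by (rule mult_right_mono) simp
  moreover have "(min b y)\<^sup>2 / (2 * b ^ 3) = 1 / b * (y\<^sup>2 / (2 * b\<^sup>2))"
    using False b by (simp add: min_absorb2 power2_eq_square power3_eq_cube)
  ultimately show ?thesis by linarith
qed

text \<open>The Dirichlet kernel at \<open>t \<ge> 2\<pi>/A\<close> is at most \<open>1 / sin(t/2) \<le> \<pi>/t \<le> A/2\<close>.\<close>

lemma sum_one_minus_cos_ge:
  fixes t :: real and A :: nat
  assumes A: "0 < A" and t: "2 * pi / real A \<le> t" "t \<le> pi"
  shows "real A / 2 \<le> (\<Sum>a=A+1..2*A. 1 - cos (t * real a))"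
proof -
  have t0: "0 < t" using t(1) A by (auto intro: less_le_trans[of 0 "2 * pi / real A"])
  have tel: "2 * sin (t / 2) * (\<Sum>a=A+1..A+n. cos (t * real a)) = sin (t * (real (A + n) + 1 / 2)) - sin (t * (real A + 1 / 2))" for n
  proof (induction n)
    case (Suc n)
    have "2 * sin (t / 2) * cos (t * real (A + Suc n)) = sin (t * (real (A + Suc n) + 1 / 2)) - sin (t * (real (A + n) + 1 / 2))"
    proof -
      define u where "u = t * real (A + Suc n)"
      have e: "t * (real (A + Suc n) + 1 / 2) = u + t / 2" "t * (real (A + n) + 1 / 2) = u - t / 2"
        by (simp_all add: u_def algebra_simps)
      show ?thesis unfolding e u_def[symmetric] by (simp add: sin_add sin_diff)
    qed
    moreover have "(\<Sum>a=A+1..A+Suc n. cos (t * real a)) = (\<Sum>a=A+1..A+n. cos (t * real a)) + cos (t * real (A + Suc n))"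
      by simp
    ultimately show ?case using Suc.IH by (simp only: distrib_left)
  qed simp
  have s: "t / pi \<le> sin (t / 2)" using jordan_inequality[of "t / 2"] t t0 by simp
  have sp: "0 < t / pi" using t0 by simp
  have "2 * sin (t / 2) * (\<Sum>a=A+1..A+A. cos (t * real a)) \<le> 2"
    using tel[of A] sin_le_one[of "t * (real (A + A) + 1 / 2)"] sin_ge_minus_one[of "t * (real A + 1 / 2)"]
    by linarith
  then have "2 * sin (t / 2) * (\<Sum>a=A+1..2*A. cos (t * real a)) \<le> 2" by (simp only: mult_2)
  then have "(\<Sum>a=A+1..2*A. cos (t * real a)) \<le> 1 / sin (t / 2)"
    using order_less_le_trans[OF sp s] by (simp add: pos_le_divide_eq mult.commute)
  also have "\<dots> \<le> 1 / (t / pi)" by (rule frac_le[OF _ _ sp s]) simp_all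
  also have "\<dots> \<le> real A / 2" using t(1) t0 A by (simp add: field_simps)
  finally show ?thesis by (simp add: sum_subtractf)
qed

context walk_law
begin

lemma integral_cos_defect_ge:
  assumes b: "0 < b"
  shows "trunc_var p b / (2 * b ^ 3) \<le> integral {pi / (2 * b)..3 * pi / (2 * b)} (cos_defect p)"
proof -
  have le: "pi / (2 * b) \<le> 3 * pi / (2 * b)" using b by (simp add: divide_right_mono)
  have cos_abs: "1 - cos (t * real_of_int k) = 1 - cos (t * abs_step k)" for t k
    by (cases "0 \<le> k") (simp_all add: abs_step_def)
  have bnd: "norm (1 - cos (t * abs_step k)) \<le> 2" for t k
    using one_minus_cos_le_2[of "t * abs_step k"] cos_le_one[of "t * abs_step k"] by simp
  have "integral {pi / (2 * b)..3 * pi / (2 * b)} (cos_defect p)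
      = (\<integral>k. integral {pi / (2 * b)..3 * pi / (2 * b)} (\<lambda>t. 1 - cos (t * abs_step k)) \<partial>p)"
    unfolding cos_defect_def[abs_def] cos_abs
    by (rule expectation_integral_swap[where B = "\<lambda>_. 2"])
      (use le bnd in \<open>auto intro!: continuous_intros\<close>)
  also have "\<dots> \<ge> (\<integral>k. (min b (abs_step k))\<^sup>2 / (2 * b ^ 3) \<partial>p)"
  proof (rule integral_mono)
    show "integrable p (\<lambda>k. (min b (abs_step k))\<^sup>2 / (2 * b ^ 3))"
      using integrable_min_square[of b] b by simp
    show "integrable p (\<lambda>k. integral {pi / (2 * b)..3 * pi / (2 * b)} (\<lambda>t. 1 - cos (t * abs_step k)))"
    proof (rule integrable_pmf_bounded)
      show "norm (integral {pi / (2 * b)..3 * pi / (2 * b)} (\<lambda>t. 1 - cos (t * abs_step k)))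
          \<le> integral {pi / (2 * b)..3 * pi / (2 * b)} (\<lambda>t. 2)" for k
        by (rule integral_norm_bound_integral)
          (use bnd in \<open>auto intro!: integrable_continuous_real continuous_intros\<close>)
    qed
    show "(min b (abs_step k))\<^sup>2 / (2 * b ^ 3)
        \<le> integral {pi / (2 * b)..3 * pi / (2 * b)} (\<lambda>t. 1 - cos (t * abs_step k))" for k
      by (rule integral_one_minus_cos_ge[OF b Y_nonneg])
  qed
  finally show ?thesis by (simp add: trunc_var_def)
qed

lemma continuous_on_re_kernel: "0 < u \<Longrightarrow> v \<le> pi \<Longrightarrow> continuous_on {u..v} re_kernel"
  unfolding re_kernel_def[abs_def]
proof (intro continuous_intros continuous_on_cos_defect continuous_on_sin_mean ballI)
  fix t assume "0 < u" "v \<le> pi" "t \<in> {u..v}"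
  then have "0 < cos_defect p t" by (intro cos_defect_pos) auto
  then have "0 < (cos_defect p t)\<^sup>2 + (sin_mean p t)\<^sup>2" by (simp add: add_pos_nonneg)
  then show "(cos_defect p t)\<^sup>2 + (sin_mean p t)\<^sup>2 \<noteq> 0" by linarith
qed

lemma integrable_re_kernel: "0 < u \<Longrightarrow> v \<le> pi \<Longrightarrow> re_kernel integrable_on {u..v}"
  by (intro integrable_continuous_real continuous_on_re_kernel)

text \<open>The weight \<open>1 - cos ta\<close> vanishes at some frequencies for each single \<open>a\<close>. Its average over
  \<open>A < a \<le> 2A\<close> is bounded below, so that the weight can be removed from the integral.\<close>

lemma integral_re_kernel_le:
  assumes A: "2 \<le> A" and up: "\<And>a. A \<le> a \<Longrightarrow> green_kernel (int a) * m (real a) / real a \<le> B"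
  shows "integral {2 * pi / real A..pi} re_kernel \<le> 4 * pi * B * (real A / m (real A))"
proof -
  let ?l = "2 * pi / real A"
  have l: "0 < ?l" "?l \<le> pi" using A by (simp_all add: field_simps)
  have mA: "0 < m (real A)" using A by (intro m_pos) simp
  have B: "0 \<le> B"
  proof -
    have "0 \<le> green_kernel (int A)"
      unfolding green_kernel_def set_lebesgue_integral_def
      by (intro divide_nonneg_pos integral_nonneg_AE) (auto simp: re_kernel_nonneg)
    then have "0 \<le> green_kernel (int A) * m (real A) / real A" using mA by simp
    with up[of A] show ?thesis by simp
  qed
  have i: "(\<lambda>t. re_kernel t * (1 - cos (t * real a))) integrable_on {?l..pi}" for a
    by (intro integrable_continuous_real continuous_intros continuous_on_re_kernel l) simp
  have gk: "integral {?l..pi} (\<lambda>t. re_kernel t * (1 - cos (t * real a))) \<le> pi * green_kernel (int a)" for a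
  proof -
    have "integral {?l..pi} (\<lambda>t. re_kernel t * (1 - cos (t * real a))) \<le> integral {0..pi} (\<lambda>t. re_kernel t * (1 - cos (t * real a)))"
      by (rule integral_subset_le) (use l i green_kernel_eq_integral(1)[of "int a"] re_kernel_nonneg in auto)
    then show ?thesis using green_kernel_eq_integral(2)[of "int a"] by simp
  qed
  have "real A / 2 * integral {?l..pi} re_kernel = integral {?l..pi} (\<lambda>t. re_kernel t * (real A / 2))"
    by (simp add: mult.commute)
  also have "\<dots> \<le> integral {?l..pi} (\<lambda>t. \<Sum>a=A+1..2*A. re_kernel t * (1 - cos (t * real a)))"
  proof (rule integral_le)
    show "(\<lambda>t. re_kernel t * (real A / 2)) integrable_on {?l..pi}"
      by (intro integrable_continuous_real continuous_intros continuous_on_re_kernel l) simp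
    show "(\<lambda>t. \<Sum>a=A+1..2*A. re_kernel t * (1 - cos (t * real a))) integrable_on {?l..pi}"
      by (intro integrable_sum i) auto
    show "re_kernel t * (real A / 2) \<le> (\<Sum>a=A+1..2*A. re_kernel t * (1 - cos (t * real a)))" if "t \<in> {?l..pi}" for t
      unfolding sum_distrib_left[symmetric]
      by (rule mult_left_mono[OF sum_one_minus_cos_ge re_kernel_nonneg]) (use A that in auto)
  qed
  also have "\<dots> = (\<Sum>a=A+1..2*A. integral {?l..pi} (\<lambda>t. re_kernel t * (1 - cos (t * real a))))"
    by (rule integral_sum) (use i in auto)
  also have "\<dots> \<le> (\<Sum>a=A+1..2*A. pi * (B * (2 * real A / m (real A))))"
  proof (rule sum_mono)
    fix a assume a: "a \<in> {A+1..2*A}"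
    have ma: "m (real A) \<le> m (real a)" using a by (intro mono) auto
    have "green_kernel (int a) \<le> B * (real a / m (real a))"
      using up[of a] a mA ma by (simp add: field_simps)
    also have "\<dots> \<le> B * (2 * real A / m (real A))"
      using a mA ma B by (intro mult_left_mono frac_le) auto
    finally show "integral {?l..pi} (\<lambda>t. re_kernel t * (1 - cos (t * real a))) \<le> pi * (B * (2 * real A / m (real A)))"
      by (intro order_trans[OF gk mult_left_mono]) simp_all
  qed
  also have "\<dots> = real A * (pi * (B * (2 * real A / m (real A))))"
  proof -
    have "card {A+1..2*A} = A" by simp
    then show ?thesis by (simp only: sum_constant)
  qed
  also have "\<dots> = real A / 2 * (4 * pi * B * (real A / m (real A)))" by simp
  finally show ?thesis by (rule mult_left_le_imp_le) (use A in simp)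
qed

text \<open>On the interval \<open>t b\<close> lies between \<open>\<pi>/2\<close> and \<open>6\<close>. There both \<open>R\<close> and \<open>J\<close> are of order \<open>e m(b) / b^2\<close>, so that
  \<open>K \<ge> q R\<close> with \<open>q\<close> of order \<open>b^4 / (e m(b))^2\<close>, and \<open>R\<close> has a mean of order \<open>c(b) / b^2\<close>.\<close>

lemma integral_re_kernel_scale_ge:
  assumes b: "2 \<le> b" and e: "0 < e" and var: "trunc_var p b \<le> 2 * e * m b"
    and im: "\<And>t. 0 < t \<Longrightarrow> t \<le> 6 / b \<Longrightarrow> \<bar>sin_mean p t\<bar> \<le> e * (t\<^sup>2 * m (1 / t))"
  shows "b * trunc_var p b / (45000 * e\<^sup>2 * (m b)\<^sup>2) \<le> integral {pi / (2 * b)..3 * pi / (2 * b)} re_kernel"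
proof -
  have b0: "0 < b" using b by simp
  have m: "0 < m b" by (rule m_pos[OF b0])
  let ?I = "{pi / (2 * b)..3 * pi / (2 * b)}"
  have up: "3 * pi / (2 * b) \<le> pi" using b by (simp add: field_simps)
  have lo: "0 < pi / (2 * b)" using b0 by simp
  define q where "q = b ^ 4 / (22500 * e\<^sup>2 * (m b)\<^sup>2)"
  have q: "0 < q" using b0 e m by (simp add: q_def)
  have point: "q * cos_defect p t \<le> re_kernel t" if t: "t \<in> ?I" for t
  proof -
    have t0: "0 < t" using t lo by auto
    have "3 * pi / (2 * b) \<le> 6 / b" using pi_less_4 b0 by (simp add: field_simps)
    then have t6: "t \<le> 6 / b" using t by auto
    have t1: "1 / t \<le> b"
    proof -
      have "1 / t \<le> 1 / (pi / (2 * b))" by (rule frac_le) (use t lo in auto)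
      also have "\<dots> \<le> b" using b0 pi_ge_two by (simp add: field_simps)
      finally show ?thesis .
    qed
    have tp: "t \<le> pi" using t up by auto
    have sq: "t\<^sup>2 \<le> 36 / b\<^sup>2"
      using power_mono[OF t6, of 2] t0 by (simp add: power_divide)
    have "trunc_var p (2 / t) \<le> trunc_var p (2 * b)" using t0 t1 by (intro trunc_var_mono) auto
    also have "\<dots> \<le> 2\<^sup>2 * trunc_var p b" using b0 by (intro trunc_var_scale) auto
    also have "\<dots> \<le> 8 * e * m b" using var by simp
    finally have "t\<^sup>2 / 2 * trunc_var p (2 / t) \<le> (36 / b\<^sup>2) / 2 * (8 * e * m b)"
      using sq trunc_var_nonneg by (intro mult_mono) auto
    then have R: "cos_defect p t \<le> 144 * e * m b / b\<^sup>2"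
      using cos_defect_le[OF t0] by simp
    have "t\<^sup>2 * m (1 / t) \<le> 36 / b\<^sup>2 * m b"
      using sq t0 t1 mono[of "1 / t" b] nonneg[of "1 / t"] by (intro mult_mono) auto
    then have "e * (t\<^sup>2 * m (1 / t)) \<le> e * (36 / b\<^sup>2 * m b)" using e by (intro mult_left_mono) auto
    then have J: "\<bar>sin_mean p t\<bar> \<le> 36 * e * m b / b\<^sup>2" using im[OF t0 t6] by (simp add: mult_ac)
    have "(cos_defect p t)\<^sup>2 + (sin_mean p t)\<^sup>2 \<le> (144 * e * m b / b\<^sup>2)\<^sup>2 + (36 * e * m b / b\<^sup>2)\<^sup>2"
    proof (rule add_mono)
      show "(cos_defect p t)\<^sup>2 \<le> (144 * e * m b / b\<^sup>2)\<^sup>2" by (rule power_mono[OF R cos_defect_nonneg])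
      show "(sin_mean p t)\<^sup>2 \<le> (36 * e * m b / b\<^sup>2)\<^sup>2" using power_mono[OF J, of 2] by simp
    qed
    also have "\<dots> = 22032 * (e * m b / b\<^sup>2)\<^sup>2" by (simp add: power_divide power_mult_distrib)
    also have "\<dots> \<le> 22500 * (e * m b / b\<^sup>2)\<^sup>2" by (intro mult_right_mono) auto
    also have "\<dots> = 1 / q" using b0 by (simp add: q_def power_divide power_mult_distrib flip: power_mult)
    finally have den: "(cos_defect p t)\<^sup>2 + (sin_mean p t)\<^sup>2 \<le> 1 / q" .
    have R0: "0 < cos_defect p t" by (rule cos_defect_pos[OF t0 tp])
    have "cos_defect p t / (1 / q) \<le> re_kernel t"
      unfolding re_kernel_def by (rule frac_le[OF _ _ _ den]) (use R0 in \<open>auto intro!: add_pos_nonneg\<close>)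
    then show ?thesis by (simp add: mult.commute)
  qed
  have "q * (trunc_var p b / (2 * b ^ 3)) \<le> q * integral ?I (cos_defect p)"
    by (rule mult_left_mono[OF integral_cos_defect_ge[OF b0]]) (use q in auto)
  also have "\<dots> = integral ?I (\<lambda>t. q * cos_defect p t)" by simp
  also have "\<dots> \<le> integral ?I re_kernel"
    by (rule integral_le)
      (use point in \<open>auto intro!: integrable_continuous_real continuous_intros continuous_on_cos_defect
        continuous_on_re_kernel[OF lo up]\<close>)
  finally have "q * (trunc_var p b / (2 * b ^ 3)) \<le> integral ?I re_kernel" .
  moreover have "q * (trunc_var p b / (2 * b ^ 3)) = b * trunc_var p b / (45000 * e\<^sup>2 * (m b)\<^sup>2)"
    using b0 by (simp add: q_def power3_eq_cube power4_eq_xxxx)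
  ultimately show ?thesis by simp
qed

text \<open>A discrete form of \<open>f' = c / m^2\<close> for \<open>f(x) = x / m(x)\<close>.\<close>

lemma ratio_increment_le:
  assumes b: "0 < b" shows "b / m b - (b / 4) / m (b / 4) \<le> (3 / 2) * (b * trunc_var p b / (m b)\<^sup>2)"
proof -
  have m: "0 < m b" "0 < m (b / 4)" using b by (auto intro: m_pos)
  have le: "m (b / 4) \<le> m b" using b by (intro mono) auto
  have "(b - b / 4) * \<eta> b \<le> m b - m (b / 4)" using b by (intro slope_lower) auto
  then have num: "4 * m (b / 4) - m b \<le> 3 / 2 * trunc_var p b"
    using half_trunc_var[of b] b by (simp add: algebra_simps)
  have "b / m b - (b / 4) / m (b / 4) = b / 4 * (4 * m (b / 4) - m b) / (m b * m (b / 4))"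
    using m by (simp add: field_simps)
  also have "\<dots> \<le> b / 4 * (3 / 2 * trunc_var p b) / (m b * m (b / 4))"
    using num m b by (intro divide_right_mono mult_left_mono) auto
  also have "\<dots> \<le> b / 4 * (3 / 2 * trunc_var p b) / (m b * (m b / 4))"
  proof (rule divide_left_mono)
    have "m b \<le> 4 * m (b / 4)" using scale_le[of "b / 4" 4] b by simp
    then show "m b * (m b / 4) \<le> m b * m (b / 4)" using m by (intro mult_left_mono) auto
  qed (use m b trunc_var_nonneg in auto)
  also have "\<dots> = (3 / 2) * (b * trunc_var p b / (m b)\<^sup>2)" by (simp add: power2_eq_square)
  finally show ?thesis .
qed

lemma ratio_mono: assumes "0 < a" "a \<le> b" shows "a / m a \<le> b / m b"
proof -
  have "m (b / a * a) \<le> b / a * m a" by (rule scale_le) (use assms in auto)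
  then have "m b \<le> b / a * m a" using assms by simp
  then show ?thesis using m_pos[of a] m_pos[of b] assms by (simp add: field_simps)
qed

text \<open>By contradiction: the ratio \<open>c/m\<close> is then at most \<open>e\<close> at arbitrarily large scales, for any \<open>e\<close>. The
  bound on the potential forbids it to lie in \<open>[e/4, e]\<close> (fact \<open>gap\<close>). Dividing the scale by \<open>4\<close> multiplies the ratio
  by at most \<open>4\<close>, so it never leaves \<open>[0, e/4]\<close> on the way down, and the contributions of all the scales
  add up to a multiple of \<open>e^{-2}\<close> times the increment of \<open>f\<close> (fact \<open>multi\<close>).\<close>

lemma slope_ratio_of_green_kernel_bound:
  assumes bound: "eventually (\<lambda>x::int. green_kernel x * m (real_of_int x) / real_of_int x \<le> B) at_top"
    and gamma: "((\<lambda>t. sin_mean p t / (t\<^sup>2 * m (1 / t))) \<longlongrightarrow> 0) (at_right 0)"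
  shows "\<exists>\<theta><1. eventually (\<lambda>x. x * \<eta> x / m x \<le> \<theta>) at_top"
proof (rule ccontr)
  assume contra: "\<not> ?thesis"
  define B' where "B' = max B 1"
  have B': "1 \<le> B'" "B \<le> B'" by (auto simp: B'_def)
  \<comment> \<open>small enough for the numerical constants in \<open>gap\<close> and in the final estimate\<close>
  define e where "e = 1 / (10 ^ 7 * B')"
  have e: "0 < e" "e \<le> 1 / 10 ^ 7" using B' by (auto simp: e_def field_simps)
  have eB: "e * B' = 1 / 10 ^ 7" using B' by (simp add: e_def)
  obtain A0 :: int where A0: "\<And>x. A0 \<le> x \<Longrightarrow> green_kernel x * m (real_of_int x) / real_of_int x \<le> B"
    using bound by (auto simp: eventually_at_top_linorder)
  have "eventually (\<lambda>t. dist (sin_mean p t / (t\<^sup>2 * m (1 / t))) 0 < e) (at_right 0)"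
    by (rule tendstoD[OF gamma e(1)])
  then obtain t0 where t0: "0 < t0" "\<And>t. 0 < t \<Longrightarrow> t < t0 \<Longrightarrow> dist (sin_mean p t / (t\<^sup>2 * m (1 / t))) 0 < e"
    by (auto simp: eventually_at_right_field)
  \<comment> \<open>beyond \<open>X0\<close> the assumed bound holds, and \<open>t \<le> 6/b\<close> implies \<open>t < t0\<close>\<close>
  define X0 where "X0 = max 2 (max (real_of_int A0) (7 / t0))"
  have X0: "2 \<le> X0" "real_of_int A0 \<le> X0" "7 / t0 \<le> X0" by (auto simp: X0_def)
  have im: "\<bar>sin_mean p t\<bar> \<le> e * (t\<^sup>2 * m (1 / t))" if b: "X0 \<le> b" and t: "0 < t" "t \<le> 6 / b" for b t
  proof -
    have "7 / t0 \<le> b" using X0 b by linarith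
    then have "7 \<le> b * t0" using t0 by (simp add: pos_divide_le_eq)
    moreover have "t * b \<le> 6" using t b X0 by (simp add: pos_le_divide_eq)
    ultimately have "t * b < t0 * b" by (simp add: mult.commute)
    then have "t < t0" using b X0 by simp
    then have lt: "\<bar>sin_mean p t / (t\<^sup>2 * m (1 / t))\<bar> < e" using t0(2)[OF t(1)] by simp
    have pos: "0 < t\<^sup>2 * m (1 / t)" using t m_pos[of "1 / t"] by simp
    then have "\<bar>sin_mean p t / (t\<^sup>2 * m (1 / t))\<bar> = \<bar>sin_mean p t\<bar> / (t\<^sup>2 * m (1 / t))"
      by (simp only: abs_divide abs_of_pos)
    then have "\<bar>sin_mean p t\<bar> / (t\<^sup>2 * m (1 / t)) < e" using lt by (simp only:)
    then show ?thesis using pos by (simp only: pos_divide_less_eq less_imp_le)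
  qed
  let ?P = "\<lambda>b. integral {pi / (2 * b)..pi} re_kernel"
  have rk: "re_kernel integrable_on {pi / (2 * b)..v}" if "0 < b" "v \<le> pi" for b v
    by (rule integrable_re_kernel) (use that in auto)
  have upper: "?P b \<le> 80 * B' * (b / m b)" if b: "X0 \<le> b" for b
  proof -
    have b2: "2 \<le> b" using b X0 by simp
    \<comment> \<open>the interval \<open>[2\<pi>/A, \<pi>]\<close> contains \<open>[\<pi>/2b, \<pi>]\<close> exactly if \<open>A \<ge> 4b\<close>\<close>
    define A where "A = nat \<lceil>4 * b\<rceil>"
    have A: "4 * b \<le> real A" "real A \<le> 5 * b" using b2 by (auto simp: A_def) linarith+
    have A2: "2 \<le> A" using A b2 by linarith
    have up: "green_kernel (int a) * m (real a) / real a \<le> B'" if "A \<le> a" for a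
    proof -
      have "real_of_int A0 \<le> real_of_int (int a)" using that A b X0 by simp
      then have "A0 \<le> int a" by (simp only: of_int_le_iff)
      from A0[OF this] B' show ?thesis by simp
    qed
    have mb: "0 < m b" using b2 by (intro m_pos) simp
    have le: "m b \<le> m (real A)" using A b2 by (intro mono) auto
    have lo: "2 * pi / real A \<le> pi / (2 * b)"
    proof -
      have "2 * pi / real A \<le> 2 * pi / (4 * b)" using A b2 by (intro divide_left_mono) auto
      then show ?thesis by simp
    qed
    have "?P b \<le> integral {2 * pi / real A..pi} re_kernel"
      by (rule integral_subset_le)
        (use lo A2 b2 re_kernel_nonneg in \<open>auto intro!: integrable_re_kernel\<close>)
    also have "\<dots> \<le> 4 * pi * B' * (real A / m (real A))" by (rule integral_re_kernel_le[OF A2 up])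
    also have "\<dots> \<le> 4 * 4 * B' * (5 * b / m b)"
      using pi_less_4 B' A le mb b2 by (intro mult_mono frac_le) auto
    also have "\<dots> = 80 * B' * (b / m b)" by simp
    finally show ?thesis .
  qed
  have single: "b * trunc_var p b / (45000 * e\<^sup>2 * (m b)\<^sup>2) \<le> integral {pi / (2 * b)..3 * pi / (2 * b)} re_kernel"
    if b: "X0 \<le> b" and var: "trunc_var p b \<le> 2 * e * m b" for b
    by (rule integral_re_kernel_scale_ge[OF _ e(1) var im[OF b]]) (use b X0 in auto)
  have gap: "trunc_var p b < e / 2 * m b" if b: "X0 \<le> b" and var: "trunc_var p b \<le> 2 * e * m b" for b
  proof (rule ccontr)
    assume "\<not> trunc_var p b < e / 2 * m b"
    then have ge: "e / 2 * m b \<le> trunc_var p b" by simp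
    have b2: "2 \<le> b" using b X0 by simp
    have mb: "0 < m b" using b2 by (intro m_pos) simp
    have "b / m b * (1 / (90000 * e)) = b * (e / 2 * m b) / (45000 * e\<^sup>2 * (m b)\<^sup>2)"
      using mb e by (simp add: power2_eq_square)
    also have "\<dots> \<le> b * trunc_var p b / (45000 * e\<^sup>2 * (m b)\<^sup>2)"
      using ge b2 by (intro divide_right_mono mult_left_mono) auto
    also have "\<dots> \<le> integral {pi / (2 * b)..3 * pi / (2 * b)} re_kernel" by (rule single[OF b var])
    also have "\<dots> \<le> ?P b"
      by (rule integral_subset_le)
        (use b2 re_kernel_nonneg in \<open>auto intro!: integrable_re_kernel simp: field_simps\<close>)
    also have "\<dots> \<le> b / m b * (80 * B')" using upper[OF b] by (simp add: mult_ac)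
    finally have "1 / (90000 * e) \<le> 80 * B'"
      by (rule mult_left_le_imp_le) (use b2 mb in auto)
    then have "1 \<le> 80 * B' * (90000 * e)" using e by (simp add: pos_divide_le_eq)
    also have "\<dots> = 7200000 * (e * B')" by simp
    finally show False using eB by simp
  qed
  have multi: "1 / (67500 * e\<^sup>2) * (b / m b - 4 * X0 / m (4 * X0)) \<le> ?P b"
    if "X0 \<le> b" "trunc_var p b \<le> 2 * e * m b" "b < 4 ^ n * (4 * X0)" for b and n :: nat
    using that
  proof (induction n arbitrary: b)
    case 0
    then have "b / m b - 4 * X0 / m (4 * X0) \<le> 0" using ratio_mono[of b "4 * X0"] X0 by simp
    then have "1 / (67500 * e\<^sup>2) * (b / m b - 4 * X0 / m (4 * X0)) \<le> 0"
      by (intro mult_nonneg_nonpos) auto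
    also have "0 \<le> ?P b" by (rule integral_nonneg[OF rk]) (use 0 X0 re_kernel_nonneg in auto)
    finally show ?case .
  next
    case (Suc n)
    have b0: "0 < b" "2 \<le> b" using Suc.prems X0 by auto
    show ?case
    proof (cases "b / 4 < X0")
      case True
      then have "b / m b - 4 * X0 / m (4 * X0) \<le> 0" using ratio_mono[of b "4 * X0"] b0 by simp
      then have "1 / (67500 * e\<^sup>2) * (b / m b - 4 * X0 / m (4 * X0)) \<le> 0"
        by (intro mult_nonneg_nonpos) auto
      also have "0 \<le> ?P b" by (rule integral_nonneg[OF rk]) (use b0 re_kernel_nonneg in auto)
      finally show ?thesis .
    next
      case False
      then have b4: "X0 \<le> b / 4" by simp
      have "trunc_var p (b / 4) \<le> trunc_var p b" using b0 by (intro trunc_var_mono) auto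
      also have "\<dots> \<le> e / 2 * m b" using gap[OF Suc.prems(1,2)] by simp
      also have "\<dots> \<le> e / 2 * (4 * m (b / 4))"
        using scale_le[of "b / 4" 4] b0 e by (intro mult_left_mono) auto
      finally have var4: "trunc_var p (b / 4) \<le> 2 * e * m (b / 4)" by simp
      have IH: "1 / (67500 * e\<^sup>2) * (b / 4 / m (b / 4) - 4 * X0 / m (4 * X0)) \<le> ?P (b / 4)"
        by (rule Suc.IH[OF b4 var4]) (use Suc.prems(3) in simp)
      have "1 / (67500 * e\<^sup>2) * (b / m b - b / 4 / m (b / 4))
          \<le> 1 / (67500 * e\<^sup>2) * ((3 / 2) * (b * trunc_var p b / (m b)\<^sup>2))"
        by (rule mult_left_mono[OF ratio_increment_le[OF b0(1)]]) simp
      also have "\<dots> = b * trunc_var p b / (45000 * e\<^sup>2 * (m b)\<^sup>2)" by simp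
      also have "\<dots> \<le> integral {pi / (2 * b)..3 * pi / (2 * b)} re_kernel"
        by (rule single[OF Suc.prems(1,2)])
      also have "\<dots> \<le> integral {pi / (2 * b)..pi / (2 * (b / 4))} re_kernel"
        by (rule integral_subset_le)
          (use b0 b4 X0 re_kernel_nonneg in \<open>auto intro!: integrable_re_kernel simp: field_simps\<close>)
      finally have inc: "1 / (67500 * e\<^sup>2) * (b / m b - b / 4 / m (b / 4))
          \<le> integral {pi / (2 * b)..pi / (2 * (b / 4))} re_kernel" .
      have "?P b = integral {pi / (2 * b)..pi / (2 * (b / 4))} re_kernel + ?P (b / 4)"
        by (rule Henstock_Kurzweil_Integration.integral_combine[symmetric])
          (use b0 b4 X0 rk[of b pi] in \<open>auto simp: field_simps\<close>)
      moreover have "1 / (67500 * e\<^sup>2) * (b / m b - 4 * X0 / m (4 * X0))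
          = 1 / (67500 * e\<^sup>2) * (b / m b - b / 4 / m (b / 4))
            + 1 / (67500 * e\<^sup>2) * (b / 4 / m (b / 4) - 4 * X0 / m (4 * X0))"
        by (simp only: right_diff_distrib)
      ultimately show ?thesis using inc IH by linarith
    qed
  qed
  define f0 where "f0 = 4 * X0 / m (4 * X0)"
  have f0: "0 < f0" using X0 m_pos[of "4 * X0"] by (simp add: f0_def)
  have "eventually (\<lambda>x. m x / x < 1 / (2 * f0)) at_top"
    by (rule order_tendstoD(2)[OF trunc_moment_over_x]) (use f0 in simp)
  then obtain Z where Z: "\<And>x. Z \<le> x \<Longrightarrow> m x / x < 1 / (2 * f0)"
    by (auto simp: eventually_at_top_linorder)
  have "\<not> eventually (\<lambda>x. x * \<eta> x / m x \<le> 1 - e) at_top" using contra e(1) by auto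
  \<comment> \<open>a large scale where the ratio \<open>c/m\<close> is below \<open>e\<close>\<close>
  then obtain x where x: "max X0 Z \<le> x" "1 - e < x * \<eta> x / m x"
    unfolding eventually_at_top_linorder by (meson not_le)
  have x0: "X0 \<le> x" "0 < x" using x X0 by auto
  have mx: "0 < m x" by (rule m_pos[OF x0(2)])
  have "(1 - e) * m x < x * \<eta> x" using x(2) mx by (simp add: pos_less_divide_eq)
  then have var: "trunc_var p x \<le> 2 * e * m x"
    using half_trunc_var[of x] x0 by (simp only: left_diff_distrib) linarith
  obtain n :: nat where "x / (4 * X0) < 4 ^ n" using real_arch_pow[of 4 "x / (4 * X0)"] by auto
  then have "x < 4 ^ n * (4 * X0)" using X0 by (simp add: pos_divide_less_eq)
  from multi[OF x0(1) var this] upper[OF x0(1)]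
  have le: "1 / (67500 * e\<^sup>2) * (x / m x - f0) \<le> 80 * B' * (x / m x)" by (simp add: f0_def)
  have "m x * (2 * f0) < x" using Z[of x] x f0 x0 by (simp add: field_simps)
  then have half: "f0 \<le> x / m x / 2" using mx by (simp add: field_simps)
  have "x / m x * (1 / (135000 * e\<^sup>2)) = 1 / (67500 * e\<^sup>2) * (x / m x / 2)" by simp
  also have "\<dots> \<le> 1 / (67500 * e\<^sup>2) * (x / m x - f0)" using half by (intro mult_left_mono) auto
  also have "\<dots> \<le> x / m x * (80 * B')" using le by (simp add: mult_ac)
  finally have "1 / (135000 * e\<^sup>2) \<le> 80 * B'" by (rule mult_left_le_imp_le) (use x0 mx in auto)
  then have "1 \<le> 80 * B' * (135000 * e\<^sup>2)" using e by (simp add: pos_divide_le_eq)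
  also have "\<dots> = 10800000 * (e * B') * e" by (simp add: power2_eq_square)
  finally show False using eB e by simp
qed

end

section \<open>From the probability space to the law of a step\<close>

text \<open>On a countable type the atoms of measure zero together form a null set.\<close>

lemma pmf_of_discrete_measure:
  assumes N: "prob_space N" "sets N = UNIV"
  shows "\<exists>p :: int pmf. measure_pmf p = N"
proof -
  interpret prob_space N by fact
  have sets: "A \<in> sets N" for A using N(2) by simp
  let ?Z = "{x. measure N {x} = 0}"
  have "(\<Union>x\<in>?Z. {x}) \<in> null_sets N"
  proof (rule null_sets_UN')
    show "{x} \<in> null_sets N" if "x \<in> ?Z" for x
      using that sets by (simp add: null_sets_def emeasure_eq_measure)
  qed simp
  then have "AE x in N. x \<notin> ?Z" using AE_not_in by force
  then have "N \<in> {M. prob_space M \<and> sets M = UNIV \<and> (AE x in M. measure M {x} \<noteq> 0)}"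
    using N by simp
  then have "measure_pmf (Abs_pmf N) = N" by (rule Abs_pmf_inverse)
  then show ?thesis by blast
qed

locale step_of_walk = prob_space M for M :: "'a measure" +
  fixes Y :: "'a \<Rightarrow> int" and p :: "int pmf"
  assumes Y_meas: "Y \<in> measurable M (count_space UNIV)"
    and law: "measure_pmf p = distr M (count_space UNIV) Y"
begin

lemma prob_eq_expectation: "\<P>(w in M. Q (Y w)) = (\<integral>k. of_bool (Q k) \<partial>p)"
proof -
  have "\<P>(w in M. Q (Y w)) = measure (distr M (count_space UNIV) Y) {k. Q k}"
    by (subst measure_distr[OF Y_meas]) (auto intro!: arg_cong[where f = "measure M"])
  also have "\<dots> = measure p {k. Q k}" by (simp only: law)
  also have "\<dots> = (\<integral>k. indicator {k. Q k} k \<partial>p)" by simp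
  finally show ?thesis by (simp add: indicator_def of_bool_def)
qed

lemma expectation_eq: "(\<integral>k. f k \<partial>p) = (LINT w|M. f (Y w))" for f :: "int \<Rightarrow> real"
  unfolding law by (rule integral_distr[OF Y_meas]) simp

lemma integrable_iff: "integrable p f \<longleftrightarrow> integrable M (\<lambda>w. f (Y w))" for f :: "int \<Rightarrow> real"
  unfolding law by (rule integrable_distr_eq[OF Y_meas]) simp

lemma nn_expectation_eq: "(\<integral>\<^sup>+k. f k \<partial>p) = (\<integral>\<^sup>+w. f (Y w) \<partial>M)"
  unfolding law by (rule nn_integral_distr[OF Y_meas]) simp

end

lemma lborel_Ico:
  "emeasure lborel {a..<b::real} < \<infinity>" "measure lborel {a..<b::real} = max 0 (b - a)"
  by (cases "a \<le> b"; simp)+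

lemma (in nonneg_functional) concave_trunc_moment:
  "concave_primitive (trunc_moment p Y) (tail_mean p Y)"
  by (rule concave_primitive_axioms)

text \<open>The tail probability is the mean of the indicator of \<open>y < Y\<close>; interchanging the mean with the
  integral leaves an integral up to \<open>Y\<close>.\<close>

lemma (in nonneg_functional) tail_probability_integral:
  assumes x: "0 \<le> x" and g: "g \<in> borel_measurable borel" "\<And>y. \<bar>g y\<bar> \<le> (B :: real)"
  shows "(LBINT y:{x..}. (\<integral>k. of_bool (y < Y k) \<partial>p) * g y) = (\<integral>k. (LBINT y:{x..<Y k}. g y) \<partial>p)"
proof -
  define f where "f k y = indicator {x..<Y k} y * g y" for k y
  have fin: "integrable lborel (\<lambda>y. B * indicator {x..<Y k} y)" for k
    by (intro integrable_mult_right integrable_real_indicator lborel_Ico(1)) simp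
  have fi: "integrable lborel (f k)" for k
  proof (rule Bochner_Integration.integrable_bound[OF fin])
    show "f k \<in> borel_measurable lborel" unfolding f_def[abs_def] using g(1) by measurable
    show "AE y in lborel. norm (f k y) \<le> norm (B * indicator {x..<Y k} y)"
      using g(2) by (intro AE_I2) (auto simp: f_def indicator_def intro: order_trans[OF _ abs_ge_self])
  qed
  have B: "0 \<le> B" using g(2)[of 0] by linarith
  have norm_le: "(LINT y|lborel. norm (f k y)) \<le> B * Y k" for k
  proof -
    have "(LINT y|lborel. norm (f k y)) \<le> (LINT y|lborel. B * indicator {x..<Y k} y)"
      by (rule integral_mono[OF integrable_norm[OF fi] fin]) (use g(2) in \<open>auto simp: f_def indicator_def\<close>)
    also have "\<dots> = B * measure lborel {x..<Y k}" by simp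
    also have "\<dots> \<le> B * Y k" using x B Y_nonneg[of k] by (intro mult_left_mono) (auto simp: lborel_Ico(2))
    finally show ?thesis .
  qed
  have "integrable p (\<lambda>k. LINT y|lborel. norm (f k y))"
  proof (rule Bochner_Integration.integrable_bound[where f = "\<lambda>k. B * Y k"])
    show "AE k in p. norm (LINT y|lborel. norm (f k y)) \<le> norm (B * Y k)"
      using norm_le B Y_nonneg by (intro AE_I2) (simp add: integral_nonneg_AE)
  qed (use Y_int in auto)
  from expectation_lborel_swap(1)[OF fi this]
  have "(LINT y|lborel. (\<integral>k. f k y \<partial>p)) = (\<integral>k. (LINT y|lborel. f k y) \<partial>p)" .
  moreover have "(\<integral>k. f k y \<partial>p) = indicator {x..} y *\<^sub>R ((\<integral>k. of_bool (y < Y k) \<partial>p) * g y)" for y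
  proof -
    have "f k y = indicator {x..} y * g y * of_bool (y < Y k)" for k
      by (auto simp: f_def indicator_def)
    then show ?thesis by (simp add: mult_ac)
  qed
  moreover have "(LINT y|lborel. f k y) = (LBINT y:{x..<Y k}. g y)" for k
    by (simp add: f_def set_lebesgue_integral_def)
  ultimately show ?thesis by (simp add: set_lebesgue_integral_def)
qed

lemma (in nonneg_functional) tail_integral_eq_tail_mean:
  assumes x: "0 \<le> x"
  shows "(LBINT y:{x..}. (\<integral>k. of_bool (y < Y k) \<partial>p)) = tail_mean p Y x"
proof -
  have "(LBINT y:{x..<Y k}. 1) = max 0 (Y k - x)" for k
    by (simp add: set_lebesgue_integral_def lborel_Ico(2))
  with tail_probability_integral[OF x, of "\<lambda>_. 1" 1] show ?thesis by (simp add: tail_mean_def)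
qed

lemma (in nonneg_functional) tail_integral_one_minus_cos:
  assumes t: "0 < t"
  shows "(LBINT y:{0..}. (\<integral>k. of_bool (y < Y k) \<partial>p) * (1 - cos (t * y))) = sin_defect p Y t"
proof -
  have "(LBINT y:{0..<Y k}. 1 - cos (t * y)) = Y k - sin (t * Y k) / t" for k
  proof -
    have "(LBINT y:{0..<Y k}. 1 - cos (t * y)) = (LBINT y:{0..Y k}. 1 - cos (t * y))"
    proof (unfold set_lebesgue_integral_def, rule integral_cong_AE)
      show "AE y in lborel. indicator {0..<Y k} y *\<^sub>R (1 - cos (t * y)) = indicator {0..Y k} y *\<^sub>R (1 - cos (t * y))"
        using AE_lborel_singleton[of "Y k"] by eventually_elim (auto simp: indicator_def)
    qed measurable
    also have "\<dots> = integral {0..Y k} (\<lambda>y. 1 - cos (t * y))"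
      by (rule set_borel_integral_eq_integral(2)) (intro borel_integrable_atLeastAtMost' continuous_intros)
    also have "\<dots> = Y k - sin (t * Y k) / t"
    proof -
      have "((\<lambda>y. 1 - cos (t * y)) has_integral ((Y k - sin (t * Y k) / t) - (0 - sin (t * 0) / t))) {0..Y k}"
        by (rule fundamental_theorem_of_calculus[OF Y_nonneg])
          (use t in \<open>auto intro!: derivative_eq_intros simp flip: has_real_derivative_iff_has_vector_derivative\<close>)
      then show ?thesis by (simp add: integral_unique)
    qed
    finally show ?thesis .
  qed
  moreover have "\<bar>1 - cos (t * y)\<bar> \<le> 2" for y
    using one_minus_cos_le_2[of "t * y"] cos_le_one[of "t * y"] by simp
  ultimately show ?thesis
    using tail_probability_integral[of 0 "\<lambda>y. 1 - cos (t * y)" 2] by simp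
qed

definition pos_step :: "int \<Rightarrow> real" where "pos_step k = max 0 (real_of_int k)"
definition neg_step :: "int \<Rightarrow> real" where "neg_step k = max 0 (- real_of_int k)"

context step_of_walk
begin

context
  assumes int: "integrable p real_of_int"
begin

lemma nonneg_functional_parts: "nonneg_functional p pos_step" "nonneg_functional p neg_step"
  using int by (auto simp: pos_step_def[abs_def] neg_step_def[abs_def] intro!: nonneg_functional.intro)

lemma mu_plus_eq: "0 \<le> x \<Longrightarrow> mu_plus M Y x = (\<integral>k. of_bool (x < pos_step k) \<partial>p)"
  unfolding mu_plus_def using prob_eq_expectation[of "\<lambda>k. x < real_of_int k"]
  by (auto simp: pos_step_def intro!: Bochner_Integration.integral_cong)

lemma mu_minus_eq: "0 \<le> x \<Longrightarrow> mu_minus M Y x = (\<integral>k. of_bool (x < neg_step k) \<partial>p)"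
  unfolding mu_minus_def using prob_eq_expectation[of "\<lambda>k. real_of_int k < - x"]
  by (auto simp: neg_step_def less_minus_iff intro!: Bochner_Integration.integral_cong)

lemma eta_plus_eq: "0 \<le> x \<Longrightarrow> eta_plus M Y x = tail_mean p pos_step x"
  unfolding eta_plus_def
  by (subst nonneg_functional.tail_integral_eq_tail_mean[OF nonneg_functional_parts(1), symmetric])
    (auto intro!: set_lebesgue_integral_cong simp: mu_plus_eq)

lemma eta_minus_eq: "0 \<le> x \<Longrightarrow> eta_minus M Y x = tail_mean p neg_step x"
  unfolding eta_minus_def
  by (subst nonneg_functional.tail_integral_eq_tail_mean[OF nonneg_functional_parts(2), symmetric])
    (auto intro!: set_lebesgue_integral_cong simp: mu_minus_eq)

lemma set_integral_tail_mean:
  assumes "nonneg_functional p Z" "0 \<le> x"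
  shows "(LBINT s:{0..x}. tail_mean p Z s) = trunc_moment p Z x"
proof -
  interpret nonneg_functional p Z by fact
  have "set_integrable lborel {0..x} (tail_mean p Z)"
    by (rule borel_integrable_atLeastAtMost') (rule continuous_on_subset[OF continuous_on_tail_mean], auto)
  from set_borel_integral_eq_integral(2)[OF this] show ?thesis
    using integral_tail_mean[OF assms(2)] by simp
qed

lemma m_plus_eq: "0 \<le> x \<Longrightarrow> m_plus M Y x = trunc_moment p pos_step x"
  unfolding m_plus_def
  by (subst set_integral_tail_mean[OF nonneg_functional_parts(1), symmetric])
    (auto intro!: set_lebesgue_integral_cong simp: eta_plus_eq)

lemma m_minus_eq: "0 \<le> x \<Longrightarrow> m_minus M Y x = trunc_moment p neg_step x"
  unfolding m_minus_def
  by (subst set_integral_tail_mean[OF nonneg_functional_parts(2), symmetric])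
    (auto intro!: set_lebesgue_integral_cong simp: eta_minus_eq)

lemma eta_eq: assumes "0 \<le> x" shows "eta M Y x = tail_mean p abs_step x"
proof -
  have "tail_mean p pos_step x + tail_mean p neg_step x
      = (\<integral>k. max 0 (pos_step k - x) + max 0 (neg_step k - x) \<partial>p)"
    unfolding tail_mean_def
    by (rule Bochner_Integration.integral_add[symmetric])
      (rule nonneg_functional.integrable_positive_part nonneg_functional_parts)+
  also have "\<dots> = tail_mean p abs_step x"
    unfolding tail_mean_def using assms
    by (auto simp: pos_step_def neg_step_def abs_step_def max_def intro!: Bochner_Integration.integral_cong)
  finally show ?thesis unfolding eta_def using assms by (simp add: eta_plus_eq eta_minus_eq)
qed

lemma m_total_eq: assumes "0 \<le> x" shows "m_total M Y x = trunc_moment p abs_step x"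
proof -
  have "trunc_moment p pos_step x + trunc_moment p neg_step x
      = (\<integral>k. trunc_half_square x (pos_step k) + trunc_half_square x (neg_step k) \<partial>p)"
    unfolding trunc_moment_def
    by (rule Bochner_Integration.integral_add[symmetric])
      (rule nonneg_functional.integrable_trunc nonneg_functional_parts assms)+
  also have "\<dots> = trunc_moment p abs_step x"
    unfolding trunc_moment_def using assms
    by (auto simp: pos_step_def neg_step_def abs_step_def max_def trunc_half_square_def
        intro!: Bochner_Integration.integral_cong)
  finally show ?thesis unfolding m_total_def using assms by (simp add: m_plus_eq m_minus_eq)
qed

lemma gamma_diff_eq:
  assumes t: "0 < t"
  shows "gamma_diff M Y t = sin_defect p pos_step t - sin_defect p neg_step t"
proof -
  have "beta_plus M Y t = sin_defect p pos_step t"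
    unfolding beta_plus_def
    by (subst nonneg_functional.tail_integral_one_minus_cos[OF nonneg_functional_parts(1) t, symmetric])
      (auto intro!: set_lebesgue_integral_cong simp: mu_plus_eq)
  moreover have "beta_minus M Y t = sin_defect p neg_step t"
    unfolding beta_minus_def
    by (subst nonneg_functional.tail_integral_one_minus_cos[OF nonneg_functional_parts(2) t, symmetric])
      (auto intro!: set_lebesgue_integral_cong simp: mu_minus_eq)
  ultimately show ?thesis by (simp add: gamma_diff_def)
qed

text \<open>The linear terms add up to the mean of the step, which is zero.\<close>

lemma gamma_diff_eq_sin_mean:
  assumes t: "0 < t" and mean: "(\<integral>k. real_of_int k \<partial>p) = 0"
  shows "gamma_diff M Y t = - sin_mean p t / t"
proof -
  note i = nonneg_functional.integrable_sin_defect[OF nonneg_functional_parts(1), of t]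
    nonneg_functional.integrable_sin_defect[OF nonneg_functional_parts(2), of t]
  have "gamma_diff M Y t = (\<integral>k. (pos_step k - sin (t * pos_step k) / t) - (neg_step k - sin (t * neg_step k) / t) \<partial>p)"
    unfolding gamma_diff_eq[OF t] by (rule Bochner_Integration.integral_diff[OF i, symmetric])
  also have "\<dots> = (\<integral>k. real_of_int k - sin (t * real_of_int k) / t \<partial>p)"
    by (intro Bochner_Integration.integral_cong) (auto simp: pos_step_def neg_step_def max_def)
  also have "\<dots> = - sin_mean p t / t"
    using int mean by (simp add: sin_mean_def)
  finally show ?thesis .
qed

end

end

lemma measurable_sum_int:
  fixes f :: "'i \<Rightarrow> 'b \<Rightarrow> int"
  assumes "finite I" "\<And>i. i \<in> I \<Longrightarrow> f i \<in> measurable N (count_space UNIV)"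
  shows "(\<lambda>w. \<Sum>i\<in>I. f i w) \<in> measurable N (count_space UNIV)"
  using assms
proof (induction I rule: finite_induct)
  case (insert j I)
  have "(\<lambda>w. f j w + (\<Sum>i\<in>I. f i w)) \<in> measurable N (count_space UNIV)"
  proof (rule measurable_compose_countable[where f = "\<lambda>k w. k + (\<Sum>i\<in>I. f i w)" and g = "f j"])
    show "(\<lambda>w. k + (\<Sum>i\<in>I. f i w)) \<in> measurable N (count_space UNIV)" for k
      by (rule measurable_compose[OF insert.IH]) (use insert.prems in auto)
  qed (use insert.prems in auto)
  then show ?case using insert.hyps by simp
qed simp

text \<open>The last step is independent of the walk before it, so the joint law is a product measure and
  Fubini's theorem yields the recursion that defines \<open>walk_prob\<close>.\<close>

lemma prob_walk_eq:
  assumes iid: "iid_integer M X" and law: "measure_pmf p = distr M (count_space UNIV) (X 0)"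
  shows "\<P>(w in M. walk X n w = y) = walk_prob p n y"
proof (induction n arbitrary: y)
  case 0
  interpret prob_space M using iid by (simp add: iid_integer_def)
  show ?case by (auto simp: walk_def prob_space)
next
  case (Suc n)
  interpret prob_space M using iid by (simp add: iid_integer_def)
  have indep: "indep_vars (\<lambda>_. count_space UNIV) X UNIV" using iid by (simp add: iid_integer_def)
  have meas[measurable]: "X i \<in> measurable M (count_space UNIV)" for i
    using indep by (simp add: indep_vars_def)
  have walk_meas[measurable]: "walk X n \<in> measurable M (count_space UNIV)"
    unfolding walk_def[abs_def] by (rule measurable_sum_int) auto
  have law_n: "distr M (count_space UNIV) (X i) = measure_pmf p" for i
    using iid law by (simp add: iid_integer_def)
  have pair: "indep_var (count_space UNIV) (walk X n) (count_space UNIV) (X (Suc n))"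
  proof -
    have "indep_var (PiM {1..n} (\<lambda>_. count_space UNIV)) (\<lambda>w. restrict (\<lambda>i. X i w) {1..n})
        (PiM {Suc n} (\<lambda>_. count_space UNIV)) (\<lambda>w. restrict (\<lambda>i. X i w) {Suc n})"
      by (rule indep_var_restrict[OF indep]) auto
    then have "indep_var (count_space UNIV) ((\<lambda>f. \<Sum>i=1..n. f i) \<circ> (\<lambda>w. restrict (\<lambda>i. X i w) {1..n}))
        (count_space UNIV) ((\<lambda>f. f (Suc n)) \<circ> (\<lambda>w. restrict (\<lambda>i. X i w) {Suc n}))"
      by (rule indep_var_compose)
        (auto intro!: measurable_sum_int measurable_component_singleton simp: o_def)
    then show ?thesis by (simp add: o_def walk_def[abs_def])
  qed
  let ?C = "count_space UNIV :: int measure" and ?N = "distr M (count_space UNIV) (walk X n)"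
  let ?A = "{z :: int \<times> int. fst z + snd z = y}"
  have joint: "?N \<Otimes>\<^sub>M measure_pmf p = distr M (?C \<Otimes>\<^sub>M ?C) (\<lambda>w. (walk X n w, X (Suc n) w))"
    using pair unfolding indep_var_distribution_eq by (simp add: law_n)
  have CC: "?C \<Otimes>\<^sub>M ?C = count_space UNIV" by (simp add: pair_measure_countable)
  interpret N: prob_space ?N by (rule prob_space_distr[OF walk_meas])
  interpret pair_sigma_finite ?N "measure_pmf p"
    by (intro pair_sigma_finite.intro N.sigma_finite_measure_axioms measure_pmf.sigma_finite_measure_axioms)
  have fiber: "emeasure ?N ((\<lambda>x. (x, k)) -` ?A) = ennreal (walk_prob p n (y - k))" for k
  proof -
    have "(\<lambda>x. (x, k)) -` ?A = {y - k}" by auto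
    then have "emeasure ?N ((\<lambda>x. (x, k)) -` ?A) = emeasure M {w \<in> space M. walk X n w = y - k}"
      by (simp add: emeasure_distr vimage_def Int_def conj_commute)
    then show ?thesis using Suc.IH[of "y - k"] by (simp add: emeasure_eq_measure)
  qed
  have iw: "integrable p (\<lambda>k. walk_prob p n (y - k))"
    by (rule integrable_pmf_bounded[where B = 1]) (use walk_prob_bounds in auto)
  have "emeasure M {w \<in> space M. walk X (Suc n) w = y} = emeasure (?N \<Otimes>\<^sub>M measure_pmf p) ?A"
  proof -
    have "(\<lambda>w. (walk X n w, X (Suc n) w)) \<in> measurable M (?C \<Otimes>\<^sub>M ?C)" by measurable
    moreover have "?A \<in> sets (?C \<Otimes>\<^sub>M ?C)" unfolding CC by simp
    ultimately have "emeasure (?N \<Otimes>\<^sub>M measure_pmf p) ?A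
        = emeasure M ((\<lambda>w. (walk X n w, X (Suc n) w)) -` ?A \<inter> space M)"
      unfolding joint by (rule emeasure_distr)
    also have "(\<lambda>w. (walk X n w, X (Suc n) w)) -` ?A \<inter> space M = {w \<in> space M. walk X (Suc n) w = y}"
      by (auto simp: walk_def)
    finally show ?thesis by simp
  qed
  also have "\<dots> = (\<integral>\<^sup>+k. emeasure ?N ((\<lambda>x. (x, k)) -` ?A) \<partial>measure_pmf p)"
  proof (rule emeasure_pair_measure_alt2)
    have "sets (?N \<Otimes>\<^sub>M measure_pmf p) = sets (?C \<Otimes>\<^sub>M ?C)" by (intro sets_pair_measure_cong) auto
    then show "?A \<in> sets (?N \<Otimes>\<^sub>M measure_pmf p)" unfolding CC by simp
  qed
  also have "\<dots> = ennreal (\<integral>k. walk_prob p n (y - k) \<partial>p)"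
    unfolding fiber by (rule nn_integral_eq_integral[OF iw]) (use walk_prob_bounds in auto)
  finally have "ennreal (measure M {w \<in> space M. walk X (Suc n) w = y}) = ennreal (walk_prob p (Suc n) y)"
    by (simp add: emeasure_eq_measure)
  then show ?case using walk_prob_bounds[of p "Suc n" y] by (simp del: walk_prob.simps)
qed

section \<open>Limits superior as eventual bounds\<close>

lemma limsup_less_iff_eventually:
  fixes f :: "'a \<Rightarrow> real"
  shows "Limsup F (\<lambda>x. ereal (f x)) < ereal c \<longleftrightarrow> (\<exists>d<c. eventually (\<lambda>x. f x \<le> d) F)"
proof
  assume "Limsup F (\<lambda>x. ereal (f x)) < ereal c"
  then obtain d where d: "Limsup F (\<lambda>x. ereal (f x)) < ereal d" "d < c"
    using ereal_dense2 by (metis ereal_less(1) less_ereal.simps(1))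
  then have "eventually (\<lambda>x. ereal (f x) < ereal d) F"
    using Limsup_lessD by blast
  with d(2) show "\<exists>d<c. eventually (\<lambda>x. f x \<le> d) F"
    by (auto elim!: eventually_mono intro!: exI[of _ d])
next
  assume "\<exists>d<c. eventually (\<lambda>x. f x \<le> d) F"
  then obtain d where d: "d < c" "eventually (\<lambda>x. f x \<le> d) F" by blast
  then have "Limsup F (\<lambda>x. ereal (f x)) \<le> ereal d"
    by (intro Limsup_bounded) (auto elim: eventually_mono)
  with d(1) show "Limsup F (\<lambda>x. ereal (f x)) < ereal c"
    using le_less_trans by fastforce
qed

lemma limsup_finite_iff_eventually:
  fixes f :: "'a \<Rightarrow> real"
  shows "Limsup F (\<lambda>x. ereal (f x)) < \<infinity> \<longleftrightarrow> (\<exists>B. eventually (\<lambda>x. f x \<le> B) F)"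
proof
  assume "Limsup F (\<lambda>x. ereal (f x)) < \<infinity>"
  then obtain d where d: "Limsup F (\<lambda>x. ereal (f x)) < ereal d"
    using ereal_dense2 by blast
  then have "eventually (\<lambda>x. ereal (f x) < ereal d) F"
    using Limsup_lessD by blast
  then show "\<exists>B. eventually (\<lambda>x. f x \<le> B) F"
    by (auto elim!: eventually_mono intro!: exI[of _ d])
next
  assume "\<exists>d. eventually (\<lambda>x. f x \<le> d) F"
  then obtain d where d: "eventually (\<lambda>x. f x \<le> d) F" by blast
  then have "Limsup F (\<lambda>x. ereal (f x)) \<le> ereal d"
    by (intro Limsup_bounded) (auto elim: eventually_mono)
  then show "Limsup F (\<lambda>x. ereal (f x)) < \<infinity>"
    using le_less_trans by fastforce
qed

section \<open>Boundedness of the potential relative to x over m\<close>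

theorem theorem3:
  fixes M :: "'a measure" and X :: "nat \<Rightarrow> 'a \<Rightarrow> int"
  assumes "iid_integer M X"
    and "irreducible_walk M X"
    and "integrable M (\<lambda>w. real_of_int (X 0 w))"
    and "(LINT w|M. real_of_int (X 0 w)) = 0"
    and "(\<integral>\<^sup>+ w. ennreal ((real_of_int (X 0 w))\<^sup>2) \<partial>M) = \<infinity>"
    and "((\<lambda>x. m_minus M (X 0) x / m_plus M (X 0) x) \<longlongrightarrow> 1) at_top"
  shows "((\<lambda>t. gamma_diff M (X 0) t / (t * m_total M (X 0) (1 / t))) \<longlongrightarrow> 0) (at_right 0)
    \<and> (Limsup at_top (\<lambda>x::real. ereal (x * eta_plus M (X 0) x / m_plus M (X 0) x)) < 1
        \<longleftrightarrow> Limsup at_top (\<lambda>x::int. ereal (sym_potential M X x * m_total M (X 0) (real_of_int x) / real_of_int x)) < \<infinity>)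
    \<and> (Limsup at_top (\<lambda>x::real. ereal (x * eta_minus M (X 0) x / m_minus M (X 0) x)) < 1
        \<longleftrightarrow> Limsup at_top (\<lambda>x::int. ereal (sym_potential M X x * m_total M (X 0) (real_of_int x) / real_of_int x)) < \<infinity>)
    \<and> (Limsup at_top (\<lambda>x::real. ereal (x * eta M (X 0) x / m_total M (X 0) x)) < 1
        \<longleftrightarrow> Limsup at_top (\<lambda>x::int. ereal (sym_potential M X x * m_total M (X 0) (real_of_int x) / real_of_int x)) < \<infinity>)"
proof -
  interpret prob_space M using assms(1) by (simp add: iid_integer_def)
  have meas: "X 0 \<in> measurable M (count_space UNIV)"
    using assms(1) by (simp add: iid_integer_def indep_vars_def)
  obtain p where law: "measure_pmf p = distr M (count_space UNIV) (X 0)"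
    using pmf_of_discrete_measure[OF prob_space_distr[OF meas]] by auto
  interpret step_of_walk M "X 0" p by unfold_locales (rule meas, rule law)
  note walk = prob_walk_eq[OF assms(1) law]
  have int: "integrable p real_of_int" using assms(3) by (simp add: integrable_iff)
  have mean: "(\<integral>k. real_of_int k \<partial>p) = 0" using assms(4) by (simp add: expectation_eq)
  interpret walk_law p
  proof
    show "integrable p real_of_int" by (rule int)
    have "\<exists>n. \<P>(w in M. 0 + walk X n w = y) > 0" for y
      using assms(2) unfolding irreducible_walk_def by blast
    then show "irreducible_law p" by (simp add: irreducible_law_def walk)
    show "(\<integral>\<^sup>+k. ennreal ((real_of_int k)\<^sup>2) \<partial>p) = \<infinity>" using assms(5) by (simp add: nn_expectation_eq)
  qed
  note parts = nonneg_functional_parts[OF int]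
  have cP: "concave_primitive (trunc_moment p pos_step) (tail_mean p pos_step)"
    and cN: "concave_primitive (trunc_moment p neg_step) (tail_mean p neg_step)"
    by (intro nonneg_functional.concave_trunc_moment parts)+
  let ?P = "trunc_moment p pos_step" and ?N = "trunc_moment p neg_step"
  have ev0: "eventually (\<lambda>x::real. 0 \<le> x) at_top" by (rule eventually_ge_at_top)
  have m_sum: "?P x + ?N x = m x" if "0 \<le> x" for x
    using m_total_eq[OF int that] m_plus_eq[OF int that] m_minus_eq[OF int that] by (simp add: m_total_def)
  have lim: "((\<lambda>x. ?N x / ?P x) \<longlongrightarrow> 1) at_top"
  proof (rule Lim_transform_eventually[OF assms(6)])
    show "eventually (\<lambda>x. m_minus M (X 0) x / m_plus M (X 0) x = ?N x / ?P x) at_top"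
      using ev0 by eventually_elim (simp add: m_plus_eq[OF int] m_minus_eq[OF int])
  qed
  have "eventually (\<lambda>x. 0 < ?N x / ?P x) at_top" by (rule order_tendstoD(1)[OF lim]) simp
  then have "eventually (\<lambda>x. 0 < ?P x \<and> 0 < ?N x) at_top"
    using ev0
  proof eventually_elim
    case (elim x)
    have "0 \<le> ?P x" "0 \<le> ?N x"
      using concave_primitive.nonneg[OF cP, of x] concave_primitive.nonneg[OF cN, of x] elim by auto
    with elim show ?case by (auto simp: zero_less_divide_iff)
  qed
  then have posP: "eventually (\<lambda>x. 0 < ?P x) at_top" and posN: "eventually (\<lambda>x. 0 < ?N x) at_top"
    by (auto elim: eventually_mono)
  have posM: "eventually (\<lambda>x. 0 < m x) at_top"
    using eventually_gt_at_top[of 0] by eventually_elim (rule m_pos)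
  have limM: "((\<lambda>x. m x / ?P x) \<longlongrightarrow> 1 + 1) at_top"
  proof (rule Lim_transform_eventually)
    show "((\<lambda>x. 1 + ?N x / ?P x) \<longlongrightarrow> 1 + 1) at_top" by (intro tendsto_intros lim)
    show "eventually (\<lambda>x. 1 + ?N x / ?P x = m x / ?P x) at_top"
      using posP ev0 by eventually_elim (simp add: m_sum[symmetric] field_simps)
  qed

  have gamma: "((\<lambda>t. gamma_diff M (X 0) t / (t * m_total M (X 0) (1 / t))) \<longlongrightarrow> 0) (at_right 0)"
  proof (rule Lim_transform_eventually[OF sin_defect_difference_negligible[OF parts lim]])
    have "eventually (\<lambda>t::real. 0 < t) (at_right 0)" by (simp add: eventually_at_right_less)
    then show "eventually (\<lambda>t. (sin_defect p pos_step t - sin_defect p neg_step t)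
        / (t * (?P (1 / t) + ?N (1 / t))) = gamma_diff M (X 0) t / (t * m_total M (X 0) (1 / t))) (at_right 0)"
      by eventually_elim (simp add: gamma_diff_eq[OF int] m_total_eq[OF int] m_sum)
  qed
  have gamma': "((\<lambda>t. sin_mean p t / (t\<^sup>2 * m (1 / t))) \<longlongrightarrow> 0) (at_right 0)"
  proof (rule Lim_transform_eventually)
    show "((\<lambda>t. - (gamma_diff M (X 0) t / (t * m_total M (X 0) (1 / t)))) \<longlongrightarrow> 0) (at_right 0)"
      using tendsto_minus[OF gamma] by simp
    have "eventually (\<lambda>t::real. 0 < t) (at_right 0)" by (simp add: eventually_at_right_less)
    then show "eventually (\<lambda>t. - (gamma_diff M (X 0) t / (t * m_total M (X 0) (1 / t)))
        = sin_mean p t / (t\<^sup>2 * m (1 / t))) (at_right 0)"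
      by eventually_elim (simp add: gamma_diff_eq_sin_mean[OF int _ mean] m_total_eq[OF int] power2_eq_square)
  qed

  have sym: "sym_potential M X x = green_kernel x" for x
    unfolding sym_potential_def potential_def walk
    using symmetrized_potential_eq[of x] by (simp add: add.commute)
  have pot_bound: "Limsup at_top (\<lambda>x::int. ereal (sym_potential M X x * m_total M (X 0) (real_of_int x) / real_of_int x)) < \<infinity>
      \<longleftrightarrow> (\<exists>B. eventually (\<lambda>x::int. green_kernel x * m (real_of_int x) / real_of_int x \<le> B) at_top)"
    unfolding limsup_finite_iff_eventually
  proof (intro ex_cong1 eventually_cong)
    show "eventually (\<lambda>x::int. 0 \<le> x) at_top" by (rule eventually_ge_at_top)
  qed (simp add: sym m_total_eq[OF int])
  have central: "(\<exists>B. eventually (\<lambda>x::int. green_kernel x * m (real_of_int x) / real_of_int x \<le> B) at_top)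
      \<longleftrightarrow> (\<exists>\<theta><1. eventually (\<lambda>x. x * \<eta> x / m x \<le> \<theta>) at_top)"
    using slope_ratio_of_green_kernel_bound[OF _ gamma'] green_kernel_upper by blast

  have L_total: "Limsup at_top (\<lambda>x::real. ereal (x * eta M (X 0) x / m_total M (X 0) x)) < 1
      \<longleftrightarrow> (\<exists>\<theta><1. eventually (\<lambda>x. x * \<eta> x / m x \<le> \<theta>) at_top)"
    unfolding one_ereal_def limsup_less_iff_eventually
    by (intro ex_cong1 conj_cong refl eventually_cong[OF ev0]) (simp add: eta_eq[OF int] m_total_eq[OF int])
  have L_plus: "Limsup at_top (\<lambda>x::real. ereal (x * eta_plus M (X 0) x / m_plus M (X 0) x)) < 1
      \<longleftrightarrow> (\<exists>\<theta><1. eventually (\<lambda>x. x * tail_mean p pos_step x / ?P x \<le> \<theta>) at_top)"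
    unfolding one_ereal_def limsup_less_iff_eventually
    by (intro ex_cong1 conj_cong refl eventually_cong[OF ev0]) (simp add: eta_plus_eq[OF int] m_plus_eq[OF int])
  have L_minus: "Limsup at_top (\<lambda>x::real. ereal (x * eta_minus M (X 0) x / m_minus M (X 0) x)) < 1
      \<longleftrightarrow> (\<exists>\<theta><1. eventually (\<lambda>x. x * tail_mean p neg_step x / ?N x \<le> \<theta>) at_top)"
    unfolding one_ereal_def limsup_less_iff_eventually
    by (intro ex_cong1 conj_cong refl eventually_cong[OF ev0]) (simp add: eta_minus_eq[OF int] m_minus_eq[OF int])
  have "(\<exists>\<theta><1. eventually (\<lambda>x. x * tail_mean p neg_step x / ?N x \<le> \<theta>) at_top)
      \<longleftrightarrow> (\<exists>\<theta><1. eventually (\<lambda>x. x * tail_mean p pos_step x / ?P x \<le> \<theta>) at_top)"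
    by (rule slope_ratio_transfer[OF cN cP posN posP lim]) simp
  moreover have "(\<exists>\<theta><1. eventually (\<lambda>x. x * \<eta> x / m x \<le> \<theta>) at_top)
      \<longleftrightarrow> (\<exists>\<theta><1. eventually (\<lambda>x. x * tail_mean p pos_step x / ?P x \<le> \<theta>) at_top)"
    by (rule slope_ratio_transfer[OF concave_primitive_axioms cP posM posP limM]) simp
  ultimately show ?thesis
    using gamma unfolding L_total L_plus L_minus pot_bound central by simp
qed

end
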